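(* Let $\mathbb{X}$ be a complete separable computable metric space. If $F:\mathbb{X}\to\mathcal{R}(\mathbb{X})$ is a parameterised Markov process and $X_{\mathrm{init}}\in\mathcal{R}(\mathbb{X})$ is a random variable giving the initial state, then from $F$ and $X_{\mathrm{init}}$ one can compute the stochastic process $(X_0,X_1,X_2,\ldots)$ defined by $$X_0(\omega_0,\omega_1,\ldots)=X_{\mathrm{init}}(\omega_0),\qquad X_n(\omega_0,\omega_1,\ldots)=F\bigl(X_{n-1}(\omega_0,\omega_1,\ldots)\bigr)(\omega_n)\quad(n\ge1),$$ as a measurable random variable with values in $\mathbb{X}^\infty$.
   Context: Computability is in the sense of type-two effectivity (TTE): a computable type is a quotient of a countably-based (QCB) space with an equivalence class of admissible quotient representations; an object is computable from given data if there is a type-two Turing machine transforming names of the data into a name of the object. $\mathbb{A}\to\mathbb{B}$ denotes the exponential type of continuous functions. A computable metric space is a computable type $\mathbb{X}$ with a computable metric $d$ such that $(x,A)\mapsto d(x,A)=\inf\{d(x,y)\mid y\in A\}$ ($A$ closed) is computable into $[0,\infty]$ with the lower topology. The base probability space is $(\Omega,P)$, with $\Omega=\{0,1\}^\omega$ and $P$ the standard (fair-coin) measure; it is identified with its countable product $(\Omega,P)^\omega$, whose points are written $(\omega_0,\omega_1,\ldots)$. A continuous random variable is a continuous $X:\Omega\to\mathbb{X}$; the Fan metric is $d(X,Y)=\inf\{\varepsilon\in\mathbb{Q}^+\mid P(\{\omega\mid d(X(\omega),Y(\omega))\ge\varepsilon\})<\varepsilon\}$. $\mathcal{R}(\mathbb{X})$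 is the type of measurable random variables, the effective completion of the continuous random variables in the Fan metric: a name is a sequence $(X_m)$ of continuous random variables with $d(X_m,X_n)<2^{-\min(m,n)}$, two sequences being identified if their Fan distance tends to $0$. Classically, an element of $\mathcal{R}(\mathbb{X})$ is an almost-everywhere equivalence class of measurable functions $\Omega\to\mathbb{X}$. A parameterised Markov process is given by an element $F$ of $\mathbb{X}\to\mathcal{R}(\mathbb{X})$ and an initial random variable; the expression $F(X_{n-1})(\omega_n)$ is understood through a jointly measurable version $(x,\omega)\mapsto F(x)(\omega)$ (the resulting class of $X_n$ does not depend on the version, as $X_{n-1}$ depends only on $\omega_0,\ldots,\omega_{n-1}$). $\mathbb{X}^\infty$ is the countable product, metrised by e.g. $\sum_n2^{-n}\min(1,d(x_n,y_n))$. *)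

theory Defs
  imports "HOL-Probability.Probability" "HOL-Library.Nat_Bijection"
begin

section \<open>Type-two Turing machines\<close>

text \<open>
  A machine has a one-way read-only input tape and a one-way write-only output tape, both over
  the alphabet \<^typ>\<open>bool\<close>, and \<open>tapes M\<close> two-way infinite work tapes over the alphabet
  \<open>{..<symbols M}\<close>, whose blank is \<open>0\<close>. The states are \<open>{..<states M}\<close>, the initial one is \<open>0\<close>.
  The transition function maps a state, the scanned input symbol and the scanned work symbols to
  the new state, the symbols to be written on the work tapes, the moves of the work heads,
  whether the input head advances, and the symbol to be output, if any. Only its
  restriction to the finitely many legal arguments matters, so a machine is a finite object.
\<close>

datatype move = Left_Move | No_Move | Right_Move

type_synonym transition =
  "nat \<Rightarrow> bool \<Rightarrow> nat list \<Rightarrow> nat \<times> nat list \<times> move list \<times> bool \<times> bool option"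

record machine =
  states :: nat
  symbols :: nat
  tapes :: nat
  delta :: transition

definition type2_machine :: "machine \<Rightarrow> bool" where
  "type2_machine M \<longleftrightarrow> 0 < states M \<and> 0 < symbols M \<and>
    (\<forall>q b s. q < states M \<and> length s = tapes M \<and> set s \<subseteq> {..<symbols M} \<longrightarrow>
      (case delta M q b s of (q', s', mv, _, _) \<Rightarrow>
        q' < states M \<and> length s' = tapes M \<and> set s' \<subseteq> {..<symbols M} \<and> length mv = tapes M))"

text \<open>State, position of the input head, work tapes with their head positions, output so far.\<close>

type_synonym config = "nat \<times> nat \<times> ((int \<Rightarrow> nat) \<times> int) list \<times> bool list"

fun shift :: "move \<Rightarrow> int \<Rightarrow> int" where
  "shift Left_Move h = h - 1"
| "shift No_Move h = h"
| "shift Right_Move h = h + 1"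

definition initial :: "machine \<Rightarrow> config" where
  "initial M = (0, 0, replicate (tapes M) (\<lambda>_. 0, 0), [])"

fun step :: "machine \<Rightarrow> (nat \<Rightarrow> bool) \<Rightarrow> config \<Rightarrow> config" where
  "step M u (q, i, ts, out) =
    (case delta M q (u i) (map (\<lambda>(t, h). t h) ts) of (q', s', mv, adv, w) \<Rightarrow>
      (q',
       if adv then Suc i else i,
       map (\<lambda>((t, h), s, m). (t(h := s), shift m h)) (zip ts (zip s' mv)),
       case w of None \<Rightarrow> out | Some b \<Rightarrow> out @ [b]))"

definition output_after :: "machine \<Rightarrow> (nat \<Rightarrow> bool) \<Rightarrow> nat \<Rightarrow> bool list" where
  "output_after M u t = snd (snd (snd ((step M u ^^ t) (initial M))))"

definition outputs :: "machine \<Rightarrow> (nat \<Rightarrow> bool) \<Rightarrow> (nat \<Rightarrow> bool) \<Rightarrow> bool" where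
  "outputs M u v \<longleftrightarrow>
    (\<forall>n. \<exists>t. n \<le> length (output_after M u t) \<and> take n (output_after M u t) = map v [0..<n])"

text \<open>
  Names are points of Baire space; on a tape, \<open>p\<close> is written in unary, as \<open>p 0\<close> symbols
  \<^const>\<open>True\<close>, then \<^const>\<open>False\<close>, then \<open>p 1\<close> symbols \<^const>\<open>True\<close>, then \<^const>\<open>False\<close>, and so on.
\<close>

type_synonym name = "nat \<Rightarrow> nat"

definition unary_tape :: "name \<Rightarrow> nat \<Rightarrow> bool" where
  "unary_tape p i \<longleftrightarrow> (\<forall>n. i \<noteq> (\<Sum>k\<le>n. p k) + n)"

definition transforms :: "machine \<Rightarrow> name \<Rightarrow> name \<Rightarrow> bool" where
  "transforms M p q \<longleftrightarrow> outputs M (unary_tape p) (unary_tape q)"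


section \<open>Representations\<close>

text \<open>\<open>\<delta> p x\<close> means that \<open>p\<close> is a name of \<open>x\<close>.\<close>

type_synonym 'a rep = "name \<Rightarrow> 'a \<Rightarrow> bool"

definition computable :: "'a rep \<Rightarrow> 'b rep \<Rightarrow> ('a \<Rightarrow> 'b) \<Rightarrow> bool" where
  "computable \<delta> \<epsilon> f \<longleftrightarrow>
    (\<exists>M. type2_machine M \<and> (\<forall>p x. \<delta> p x \<longrightarrow> (\<exists>q. transforms M p q \<and> \<epsilon> q (f x))))"

definition admissible_quotient_rep :: "'a::topological_space rep \<Rightarrow> bool" where
  "admissible_quotient_rep \<delta> \<longleftrightarrow>
    (\<forall>p x y. \<delta> p x \<and> \<delta> p y \<longrightarrow> x = y) \<and>
    quotient_map (top_of_set {p. \<exists>x. \<delta> p x}) euclidean (\<lambda>p. THE x. \<delta> p x) \<and>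
    (\<forall>D (\<phi> :: name \<Rightarrow> 'a). continuous_on D \<phi> \<longrightarrow>
      (\<exists>g :: name \<Rightarrow> name. continuous_on D g \<and> (\<forall>p\<in>D. \<delta> (g p) (\<phi> p))))"

definition slice :: "(nat \<Rightarrow> 'b) \<Rightarrow> nat \<Rightarrow> nat \<Rightarrow> 'b" where
  "slice p n i = p (prod_encode (n, i))"

definition prod_rep :: "'a rep \<Rightarrow> 'b rep \<Rightarrow> ('a \<times> 'b) rep" where
  "prod_rep \<delta> \<epsilon> p z \<longleftrightarrow> \<delta> (\<lambda>n. p (2 * n)) (fst z) \<and> \<epsilon> (\<lambda>n. p (2 * n + 1)) (snd z)"

definition seq_rep :: "'a rep \<Rightarrow> (nat \<Rightarrow> 'a) rep" where
  "seq_rep \<delta> p x \<longleftrightarrow> (\<forall>n. \<delta> (slice p n) (x n))"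

text \<open>
  Exponential types: a name of \<open>f\<close> is an associate (in the sense of Kleene) of a continuous
  realizer of \<open>f\<close>. An associate \<open>p\<close> computes the \<open>n\<close>-th value of the realizer at \<open>q\<close> from the
  first prefix of \<open>q\<close> at which it is positive; that value is then the predecessor.
\<close>

definition associate :: "name \<Rightarrow> name \<Rightarrow> name \<Rightarrow> bool" where
  "associate p q r \<longleftrightarrow>
    (\<forall>n. \<exists>m. p (list_encode (n # map q [0..<m])) = Suc (r n) \<and>
             (\<forall>k<m. p (list_encode (n # map q [0..<k])) = 0))"

definition exp_rep :: "'a rep \<Rightarrow> 'b rep \<Rightarrow> ('a \<Rightarrow> 'b) rep" where
  "exp_rep \<delta> \<epsilon> p f \<longleftrightarrow> (\<forall>q x. \<delta> q x \<longrightarrow> (\<exists>r. associate p q r \<and> \<epsilon> r (f x)))"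

definition rat_number :: "nat \<Rightarrow> real" where
  "rat_number k =
    (case prod_decode k of (i, c) \<Rightarrow> case prod_decode i of (a, b) \<Rightarrow> (real a - real b) / (real c + 1))"

definition real_rep :: "real rep" where
  "real_rep p x \<longleftrightarrow> (\<forall>n. \<bar>rat_number (p n) - x\<bar> \<le> (1/2) ^ n)"

text \<open>
  \<open>[0,\<infinity>]\<close> with the topology of the sets \<open>(a,\<infinity>]\<close>: a name enumerates rational lower bounds whose
  supremum is the point (\<^const>\<open>ennreal\<close> maps the negative ones to \<open>0\<close>).
\<close>

definition lower_rep :: "ennreal rep" where
  "lower_rep p x \<longleftrightarrow> x = (SUP n. ennreal (rat_number (p n)))"

definition sierpinski_rep :: "bool rep" where
  "sierpinski_rep p b \<longleftrightarrow> (b \<longleftrightarrow> (\<exists>n. p n \<noteq> 0))"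

definition closed_rep :: "'a::topological_space rep \<Rightarrow> 'a set rep" where
  "closed_rep \<delta> p A \<longleftrightarrow> closed A \<and> exp_rep \<delta> sierpinski_rep p (\<lambda>x. x \<notin> A)"

text \<open>
  The type's topology is taken to be that of the metric. This is no restriction: the two
  computability conditions force it.
\<close>

definition computable_metric_space :: "'a::metric_space rep \<Rightarrow> bool" where
  "computable_metric_space \<delta> \<longleftrightarrow>
    admissible_quotient_rep \<delta> \<and>
    computable (prod_rep \<delta> \<delta>) real_rep (\<lambda>(x, y). dist x y) \<and>
    computable (prod_rep \<delta> (closed_rep \<delta>)) lower_rep (\<lambda>(x, A). INF y\<in>A. ennreal (dist x y))"


section \<open>Random variables\<close>

type_synonym cantor = "nat \<Rightarrow> bool"

definition coin :: "cantor measure" where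
  "coin = PiM UNIV (\<lambda>_. measure_pmf (bernoulli_pmf (1/2)))"

definition cantor_rep :: "cantor rep" where
  "cantor_rep p \<omega> \<longleftrightarrow> (\<forall>n. p n = of_bool (\<omega> n))"

definition rv_eq :: "(cantor \<Rightarrow> 'b::topological_space) \<Rightarrow> (cantor \<Rightarrow> 'b) \<Rightarrow> bool" where
  "rv_eq x y \<longleftrightarrow> x \<in> borel_measurable coin \<and> y \<in> borel_measurable coin \<and> (AE \<omega> in coin. x \<omega> = y \<omega>)"

quotient_type (overloaded) 'b rv = "cantor \<Rightarrow> 'b::topological_space" / partial: rv_eq
proof (rule part_equivpI)
  show "\<exists>x::cantor \<Rightarrow> 'b. rv_eq x x"
    by (rule exI[of _ "\<lambda>_. undefined"]) (simp add: rv_eq_def)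
  show "symp (rv_eq :: (cantor \<Rightarrow> 'b) \<Rightarrow> _)"
    by (rule sympI) (auto simp: rv_eq_def elim: eventually_mono)
  show "transp (rv_eq :: (cantor \<Rightarrow> 'b) \<Rightarrow> _)"
    by (rule transpI) (auto simp: rv_eq_def elim: eventually_elim2)
qed

definition version :: "(cantor \<Rightarrow> 'b::topological_space) \<Rightarrow> 'b rv \<Rightarrow> bool" where
  "version x X \<longleftrightarrow> x \<in> borel_measurable coin \<and> abs_rv x = X"

definition fan_dist :: "('b \<Rightarrow> 'b \<Rightarrow> real) \<Rightarrow> (cantor \<Rightarrow> 'b) \<Rightarrow> (cantor \<Rightarrow> 'b) \<Rightarrow> real" where
  "fan_dist d x y =
    Inf {\<epsilon>. \<epsilon> \<in> \<rat> \<and> 0 < \<epsilon> \<and> measure coin {\<omega> \<in> space coin. \<epsilon> \<le> d (x \<omega>) (y \<omega>)} < \<epsilon>}"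

text \<open>
  The metric is a parameter, because on sequences the metric of the library's type class weights
  the coordinates by means of an unspecified enumeration of the index type.
\<close>

definition rv_rep :: "'b::topological_space rep \<Rightarrow> ('b \<Rightarrow> 'b \<Rightarrow> real) \<Rightarrow> 'b rv rep" where
  "rv_rep \<delta> d p X \<longleftrightarrow>
    (\<exists>Z x. (\<forall>m. continuous_on UNIV (Z m) \<and> exp_rep cantor_rep \<delta> (slice p m) (Z m)) \<and>
           (\<forall>m n. fan_dist d (Z m) (Z n) < (1/2) ^ min m n) \<and>
           version x X \<and> (\<lambda>m. fan_dist d (Z m) x) \<longlonglongrightarrow> 0)"

definition seq_dist :: "(nat \<Rightarrow> 'a::metric_space) \<Rightarrow> (nat \<Rightarrow> 'a) \<Rightarrow> real" where
  "seq_dist x y = (\<Sum>n. (1/2) ^ n * min 1 (dist (x n) (y n)))"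


section \<open>Markov processes\<close>

text \<open>
  The base space is identified with its countable power by
  \<open>\<omega> \<mapsto> (slice \<omega> 0, slice \<omega> 1, \<dots>)\<close>.
\<close>

primrec process :: "('a \<Rightarrow> cantor \<Rightarrow> 'a) \<Rightarrow> (cantor \<Rightarrow> 'a) \<Rightarrow> nat \<Rightarrow> cantor \<Rightarrow> 'a" where
  "process f x 0 \<omega> = x (slice \<omega> 0)"
| "process f x (Suc n) \<omega> = f (process f x n \<omega>) (slice \<omega> (Suc n))"

definition joint_version ::
  "('a::topological_space \<Rightarrow> cantor \<Rightarrow> 'b::topological_space) \<Rightarrow> ('a \<Rightarrow> 'b rv) \<Rightarrow> bool" where
  "joint_version f F \<longleftrightarrow>
    (\<lambda>(x, \<omega>). f x \<omega>) \<in> borel_measurable (borel \<Otimes>\<^sub>M coin) \<and> (\<forall>x. version (f x) (F x))"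

definition markov_process ::
  "('a::topological_space \<Rightarrow> 'a rv) \<Rightarrow> 'a rv \<Rightarrow> (nat \<Rightarrow> 'a) rv \<Rightarrow> bool" where
  "markov_process F X Y \<longleftrightarrow>
    (\<exists>f x. joint_version f F \<and> version x X \<and> version (\<lambda>\<omega> n. process f x n \<omega>) Y)"

end

theory Submission
  imports Defs
begin

text \<open>
  Let \<open>W\<^sub>m\<close> be continuous approximations of the state \<open>X\<close> with \<open>P (dist W\<^sub>m X > 2\<^sup>-\<^sup>m) \<le> 2\<^sup>-\<^sup>m\<close>.
  From a name of \<open>W\<^sub>m \<omega>\<close> one computes continuous approximations of \<open>F (W\<^sub>m \<omega>)\<close>, and thus
  approximations of \<open>F (W\<^sub>m \<omega>)(\<omega>')\<close> that are continuous in \<open>(\<omega>, \<omega>')\<close>. The difficulty is to find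
  an \<open>m\<close> for which \<open>F (W\<^sub>m)\<close> is known to be close to \<open>F X\<close>. The points \<open>y\<close> with
  \<open>P (dist (F y) (F x) < 2\<^sup>-\<^sup>k) > 1 - 2\<^sup>-\<^sup>k\<close> form an open set, uniformly in a name of \<open>x\<close>, so the
  computable distance to its complement \<open>A\<close> semidecides \<open>dist x A > 2\<^sup>-\<^sup>m\<close>. One searches for an
  \<open>m\<close> for which this holds at \<open>x = W\<^sub>m \<omega>\<close> with probability more than \<open>1 - 2\<^sup>-\<^sup>k\<close>. The search
  succeeds because \<open>F\<close> is continuous and \<open>W\<^sub>m\<close> tends to \<open>X\<close> in probability, and then \<open>X\<close> is
  outside \<open>A\<close> up to a small probability.

  All searches are run in stages, on finite prefixes of the names, so that every stage is primitive
  recursive; a machine has only to repeat a primitive recursive stage forever.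
\<close>


section \<open>Primitive recursive functions and loop programs\<close>

text \<open>A realizer is continuous in names, so every test used only confirms a strict inequality
  from finite prefixes. Probabilities fit this pattern: a test on the first \<open>s\<close> coin
  tosses holds on a union of cylinders, whose measure is a count divided by \<open>2 ^ s\<close>.

  \<open>F\<close> need not be uniformly continuous and no modulus of continuity is given. The scale
  \<open>m\<close> must therefore be found for the random state at hand, and distances to closed
  sets serve this purpose alone. The \<open>m\<close> found may depend on the names, but it must be
  one number for all sample points and must never be revised, or the values would not form one
  approximation with a controlled error. The search list is therefore only ever extended, and its
  head is used.

  The index shift by 2 in each transition pays for four errors of size 2^-(k+2). The shift by
  \<open>m + n + 4\<close> at the end makes the errors of all coordinates summable.

  The process is given by a definite description, so a jointly measurable version of
  \<open>F\<close> must be shown to exist. This is where completeness of the space enters.\<close>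

inductive prim_rec :: "(nat \<Rightarrow> nat) \<Rightarrow> bool" where
  prim_rec_zero: "prim_rec (\<lambda>_. 0)"
| prim_rec_Suc: "prim_rec Suc"
| prim_rec_fst: "prim_rec (\<lambda>n. fst (prod_decode n))"
| prim_rec_snd: "prim_rec (\<lambda>n. snd (prod_decode n))"
| prim_rec_comp: "prim_rec f \<Longrightarrow> prim_rec g \<Longrightarrow> prim_rec (\<lambda>n. f (g n))"
| prim_rec_pair: "prim_rec f \<Longrightarrow> prim_rec g \<Longrightarrow> prim_rec (\<lambda>n. prod_encode (f n, g n))"
| prim_rec_iter: "prim_rec f \<Longrightarrow> prim_rec (\<lambda>n. (f ^^ fst (prod_decode n)) (snd (prod_decode n)))"

datatype cmd = Inc nat | Dec nat | Read nat | Out bool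
  | Seq cmd cmd (infixr ";;" 60) | Cond nat cmd cmd | Loop nat cmd

text \<open>Registers, input position, output so far.\<close>

type_synonym cstate = "(nat \<Rightarrow> nat) \<times> nat \<times> bool list"

text \<open>The big-step semantics describes terminating programs only; the endless outer loop of a
  machine is treated separately, in \<open>machine_of_rounds\<close>.\<close>

inductive exec :: "(nat \<Rightarrow> bool) \<Rightarrow> cmd \<Rightarrow> cstate \<Rightarrow> cstate \<Rightarrow> bool" for u where
  Inc: "exec u (Inc r) (s, i, w) (s(r := Suc (s r)), i, w)"
| Dec: "exec u (Dec r) (s, i, w) (s(r := s r - 1), i, w)"
| Read: "exec u (Read r) (s, i, w) (s(r := s r + of_bool (u i)), Suc i, w)"
| Out: "exec u (Out b) (s, i, w) (s, i, w @ [b])"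
| Seq: "exec u c \<sigma> \<tau> \<Longrightarrow> exec u d \<tau> \<rho> \<Longrightarrow> exec u (c ;; d) \<sigma> \<rho>"
| Cond1: "fst \<sigma> r \<noteq> 0 \<Longrightarrow> exec u c \<sigma> \<tau> \<Longrightarrow> exec u (Cond r c d) \<sigma> \<tau>"
| Cond2: "fst \<sigma> r = 0 \<Longrightarrow> exec u d \<sigma> \<tau> \<Longrightarrow> exec u (Cond r c d) \<sigma> \<tau>"
| Loop1: "fst \<sigma> r = 0 \<Longrightarrow> exec u (Loop r c) \<sigma> \<sigma>"
| Loop2: "fst \<sigma> r \<noteq> 0 \<Longrightarrow> exec u c \<sigma> \<tau> \<Longrightarrow> exec u (Loop r c) \<tau> \<rho> \<Longrightarrow> exec u (Loop r c) \<sigma> \<rho>"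

lemma exec_eq: "exec u c \<sigma> \<tau> \<Longrightarrow> \<tau> = \<tau>' \<Longrightarrow> exec u c \<sigma> \<tau>'"
  by simp

text \<open>The index of \<open>S\<close> counts the rounds still to be done, so that the loop
  register can serve as the index.\<close>

lemma exec_Loop:
  assumes "\<And>n. n < N \<Longrightarrow> exec u c (S (Suc n)) (S n)"
    and "\<And>n. n < N \<Longrightarrow> fst (S (Suc n)) r \<noteq> 0" "fst (S 0) r = 0"
  shows "exec u (Loop r c) (S N) (S 0)"
  using assms
proof (induction N)
  case 0
  then show ?case by (auto intro: exec.Loop1)
next
  case (Suc N)
  show ?case
    by (rule exec.Loop2[where \<tau> = "S N"]) (use Suc in auto)
qed

definition move :: "nat \<Rightarrow> nat \<Rightarrow> cmd" where
  "move a b = Loop a (Dec a ;; Inc b)"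

lemma exec_move:
  assumes "a \<noteq> b"
  shows "exec u (move a b) (s, i, w) (s(a := 0, b := s b + s a), i, w)"
proof -
  let ?S = "\<lambda>k. (s(a := k, b := s b + (s a - k)), i, w)"
  have "exec u (move a b) (?S (s a)) (?S 0)" unfolding move_def
  proof (rule exec_Loop)
    fix n assume "n < s a"
    then show "exec u (Dec a ;; Inc b) (?S (Suc n)) (?S n)"
      using assms by (intro exec.Seq[OF exec.Dec] exec_eq[OF exec.Inc]) (auto simp: fun_eq_iff)
  qed (use assms in auto)
  moreover have "?S (s a) = (s, i, w)" by (auto simp: fun_eq_iff)
  ultimately show ?thesis by simp
qed

definition move2 :: "nat \<Rightarrow> nat \<Rightarrow> nat \<Rightarrow> cmd" where
  "move2 a b c = Loop a (Dec a ;; Inc b ;; Inc c)"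

lemma exec_move2:
  assumes "a \<noteq> b" "a \<noteq> c" "b \<noteq> c"
  shows "exec u (move2 a b c) (s, i, w) (s(a := 0, b := s b + s a, c := s c + s a), i, w)"
proof -
  let ?S = "\<lambda>k. (s(a := k, b := s b + (s a - k), c := s c + (s a - k)), i, w)"
  have "exec u (move2 a b c) (?S (s a)) (?S 0)" unfolding move2_def
  proof (rule exec_Loop)
    fix n assume "n < s a"
    then show "exec u (Dec a ;; Inc b ;; Inc c) (?S (Suc n)) (?S n)"
      using assms
      by (intro exec.Seq[OF exec.Dec] exec.Seq[OF exec.Inc] exec_eq[OF exec.Inc]) (auto simp: fun_eq_iff)
  qed (use assms in auto)
  moreover have "?S (s a) = (s, i, w)" by (auto simp: fun_eq_iff)
  ultimately show ?thesis by simp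
qed

definition copy :: "nat \<Rightarrow> nat \<Rightarrow> nat \<Rightarrow> cmd" where
  "copy a b t = move2 a b t ;; move t a"

lemma exec_copy:
  assumes "a \<noteq> b" "a \<noteq> t" "b \<noteq> t" "s t = 0"
  shows "exec u (copy a b t) (s, i, w) (s(b := s b + s a), i, w)"
  unfolding copy_def
  by (rule exec.Seq[OF exec_move2 exec_eq[OF exec_move]]) (use assms in \<open>auto simp: fun_eq_iff\<close>)

definition clear :: "nat \<Rightarrow> cmd" where
  "clear a = Loop a (Dec a)"

lemma exec_clear: "exec u (clear a) (s, i, w) (s(a := 0), i, w)"
proof -
  let ?S = "\<lambda>k. (s(a := k), i, w)"
  have "exec u (clear a) (?S (s a)) (?S 0)" unfolding clear_def
  proof (rule exec_Loop)
    fix n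
    show "exec u (Dec a) (?S (Suc n)) (?S n)"
      by (rule exec_eq[OF exec.Dec]) auto
  qed auto
  then show ?thesis by simp
qed

text \<open>One step along the antidiagonals of the Cantor enumeration. The program
  \<open>decode\<close> performs it once for each unit of the coded number.\<close>

lemma prod_decode_Suc:
  "prod_decode (Suc m) = (case prod_decode m of (a, b) \<Rightarrow> if b = 0 then (0, Suc a) else (Suc a, b - 1))"
proof -
  obtain a b where ab: "prod_decode m = (a, b)" by fastforce
  have m: "m = prod_encode (a, b)" by (metis ab prod_decode_inverse)
  have "prod_encode (if b = 0 then (0, Suc a) else (Suc a, b - 1)) = Suc m"
    by (cases b) (auto simp: m prod_encode_def)
  then show ?thesis using ab
    by (metis (mono_tags, lifting) case_prod_conv prod_encode_inverse)
qed

definition decode :: "nat \<Rightarrow> nat \<Rightarrow> nat \<Rightarrow> cmd" where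
  "decode n a b = Loop n (Dec n ;; Cond b (Dec b ;; Inc a) (move a b ;; Inc b))"

lemma exec_decode:
  assumes "n \<noteq> a" "n \<noteq> b" "a \<noteq> b" "s a = 0" "s b = 0"
  shows "exec u (decode n a b) (s, i, w)
    (s(n := 0, a := fst (prod_decode (s n)), b := snd (prod_decode (s n))), i, w)"
proof -
  let ?S = "\<lambda>k. (s(n := k, a := fst (prod_decode (s n - k)), b := snd (prod_decode (s n - k))), i, w)"
  have "exec u (decode n a b) (?S (s n)) (?S 0)" unfolding decode_def
  proof (rule exec_Loop)
    fix k assume k: "k < s n"
    then have eq: "s n - k = Suc (s n - Suc k)" by simp
    let ?m = "prod_decode (s n - Suc k)"
    show "exec u (Dec n ;; Cond b (Dec b ;; Inc a) (move a b ;; Inc b)) (?S (Suc k)) (?S k)"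
    proof (rule exec.Seq[OF exec.Dec])
      show "exec u (Cond b (Dec b ;; Inc a) (move a b ;; Inc b))
        ((s(n := Suc k, a := fst ?m, b := snd ?m))
          (n := (s(n := Suc k, a := fst ?m, b := snd ?m)) n - 1), i, w) (?S k)"
      proof (cases "snd ?m = 0")
        case True
        show ?thesis
          by (rule exec.Cond2, use assms True in force)
            (rule exec.Seq[OF exec_move exec_eq[OF exec.Inc]],
              use assms True in \<open>auto simp: fun_eq_iff eq prod_decode_Suc split: prod.split\<close>)
      next
        case False
        show ?thesis
          by (rule exec.Cond1, use assms False in force)
            (rule exec.Seq[OF exec.Dec exec_eq[OF exec.Inc]],
              use assms False in \<open>auto simp: fun_eq_iff eq prod_decode_Suc split: prod.split\<close>)
      qed
    qed
  qed (use assms in auto)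
  moreover have "?S (s n) = (s, i, w)"
    using assms by (auto simp: fun_eq_iff prod_decode_def prod_decode_aux.simps)
  ultimately show ?thesis by simp
qed

text \<open>\<open>prod_encode (x, y)\<close> is \<open>x\<close> plus the triangle number of
  \<open>x + y\<close>. The loop adds up \<open>x + y\<close>, \<open>x + y - 1\<close> and so on
  down to 1.\<close>

definition encode :: "nat \<Rightarrow> nat \<Rightarrow> nat \<Rightarrow> cmd" where
  "encode a b n = move2 a n b ;; Loop b (move2 b n a ;; move a b ;; Dec b)"

lemma exec_encode:
  assumes "n \<noteq> a" "n \<noteq> b" "a \<noteq> b" "s n = 0"
  shows "exec u (encode a b n) (s, i, w) (s(a := 0, b := 0, n := prod_encode (s a, s b)), i, w)"
proof -
  let ?S = "\<lambda>k. (s(a := 0, b := k, n := s a + (triangle (s a + s b) - triangle k)), i, w)"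
  have mono: "triangle k \<le> triangle (k + l)" for k l by (induction l) auto
  have "exec u (Loop b (move2 b n a ;; move a b ;; Dec b)) (?S (s a + s b)) (?S 0)"
  proof (rule exec_Loop)
    fix k assume k: "k < s a + s b"
    have "triangle (Suc k) \<le> triangle (s a + s b)"
      using mono[of "Suc k" "s a + s b - Suc k"] k by (metis Suc_leI le_add_diff_inverse)
    then show "exec u (move2 b n a ;; move a b ;; Dec b) (?S (Suc k)) (?S k)"
      using assms
      by (intro exec.Seq[OF exec_move2] exec.Seq[OF exec_move] exec_eq[OF exec.Dec]) (auto simp: fun_eq_iff)
  qed (use assms in auto)
  moreover have "exec u (move2 a n b) (s, i, w) (?S (s a + s b))"
    by (rule exec_eq[OF exec_move2]) (use assms in \<open>auto simp: fun_eq_iff\<close>)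
  moreover have "?S 0 = (s(a := 0, b := 0, n := prod_encode (s a, s b)), i, w)"
    by (auto simp: fun_eq_iff prod_encode_def)
  ultimately show ?thesis
    unfolding encode_def by (metis (no_types, lifting) exec.Seq)
qed

text \<open>A function is evaluated in place, in register \<open>n\<close>, with the registers above \<open>n\<close> as scratch
  space that is clean before and after.\<close>

definition implements :: "nat \<Rightarrow> cmd \<Rightarrow> (nat \<Rightarrow> nat) \<Rightarrow> bool" where
  "implements n c f \<longleftrightarrow>
    (\<forall>u s i w. (\<forall>m>n. s m = 0) \<longrightarrow> exec u c (s, i, w) (s(n := f (s n)), i, w))"

lemma implementsD:
  "implements n c f \<Longrightarrow> (\<And>m. n < m \<Longrightarrow> s m = 0) \<Longrightarrow> exec u c (s, i, w) (s(n := f (s n)), i, w)"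
  unfolding implements_def by blast

text \<open>The register is arbitrary because subprograms run on higher registers while the lower
  ones keep intermediate results.\<close>

lemma prim_rec_implements: "prim_rec f \<Longrightarrow> \<exists>c. implements n c f"
proof (induction arbitrary: n rule: prim_rec.induct)
  case prim_rec_zero
  show ?case unfolding implements_def using exec_clear by blast
next
  case prim_rec_Suc
  show ?case unfolding implements_def using exec.Inc by blast
next
  case prim_rec_fst
  have "implements n (decode n (n+1) (n+2) ;; move (n+1) n ;; clear (n+2)) (\<lambda>n. fst (prod_decode n))"
    unfolding implements_def
    by (intro allI impI exec.Seq[OF exec_decode] exec.Seq[OF exec_move] exec_eq[OF exec_clear])
      (auto simp: fun_eq_iff)
  then show ?case by blast
next
  case prim_rec_snd
  have "implements n (decode n (n+1) (n+2) ;; move (n+2) n ;; clear (n+1)) (\<lambda>n. snd (prod_decode n))"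
    unfolding implements_def
    by (intro allI impI exec.Seq[OF exec_decode] exec.Seq[OF exec_move] exec_eq[OF exec_clear])
      (auto simp: fun_eq_iff)
  then show ?case by blast
next
  case (prim_rec_comp f g)
  obtain c d where c: "implements n c f" and d: "implements n d g"
    using prim_rec_comp.IH by blast
  have "implements n (d ;; c) (\<lambda>n. f (g n))"
    unfolding implements_def
    by (intro allI impI exec.Seq[OF implementsD[OF d]] exec_eq[OF implementsD[OF c]]) auto
  then show ?case by blast
next
  case (prim_rec_pair f g)
  obtain c d where c: "implements (n+1) c f" and d: "implements (n+2) d g"
    using prim_rec_pair.IH by blast
  have "implements n (copy n (n+1) (n+2) ;; c ;; copy n (n+2) (n+3) ;; d ;; clear n ;; encode (n+1) (n+2) n)
      (\<lambda>n. prod_encode (f n, g n))"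
    unfolding implements_def
    by (intro allI impI exec.Seq[OF exec_copy] exec.Seq[OF implementsD[OF c]]
        exec.Seq[OF implementsD[OF d]] exec.Seq[OF exec_clear] exec_eq[OF exec_encode])
      (auto simp: fun_eq_iff)
  then show ?case by blast
next
  case (prim_rec_iter f)
  obtain c where c: "implements (n+2) c f"
    using prim_rec_iter.IH by blast
  let ?L = "Loop (n+1) (c ;; Dec (n+1))"
  have "implements n (decode n (n+1) (n+2) ;; ?L ;; move (n+2) n)
      (\<lambda>n. (f ^^ fst (prod_decode n)) (snd (prod_decode n)))"
    unfolding implements_def
  proof (intro allI impI)
    fix u and i :: nat and s :: "nat \<Rightarrow> nat" and w :: "bool list" assume s: "\<forall>m>n. s m = 0"
    define k y where "k = fst (prod_decode (s n))" and "y = snd (prod_decode (s n))"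
    let ?S = "\<lambda>j. (s(n := 0, n+1 := j, n+2 := (f ^^ (k - j)) y), i, w)"
    have 1: "exec u (decode n (n+1) (n+2)) (s, i, w) (?S k)"
      by (rule exec_eq[OF exec_decode]) (use s in \<open>auto simp: k_def y_def fun_eq_iff\<close>)
    have 2: "exec u ?L (?S k) (?S 0)"
    proof (rule exec_Loop)
      fix j assume "j < k"
      then have "(f ^^ (k - j)) y = f ((f ^^ (k - Suc j)) y)"
        by (metis Suc_diff_Suc comp_apply funpow.simps(2))
      moreover have "exec u (c ;; Dec (n+1)) (s(n := 0, n+1 := Suc j, n+2 := z), i, w)
          (s(n := 0, n+1 := j, n+2 := f z), i, w)" for z
        by (rule exec.Seq[OF implementsD[OF c] exec_eq[OF exec.Dec]]) (use s in \<open>auto simp: fun_eq_iff\<close>)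
      ultimately show "exec u (c ;; Dec (n+1)) (?S (Suc j)) (?S j)" by metis
    qed auto
    have 3: "exec u (move (n+2) n) (?S 0) (s(n := (f ^^ k) y), i, w)"
      by (rule exec_eq[OF exec_move]) (use s in \<open>auto simp: fun_eq_iff\<close>)
    show "exec u (decode n (n+1) (n+2) ;; ?L ;; move (n+2) n) (s, i, w)
        (s(n := (f ^^ fst (prod_decode (s n))) (snd (prod_decode (s n)))), i, w)"
      by (rule exec.Seq[OF 1[unfolded k_def y_def] exec.Seq[OF 2[unfolded k_def y_def] 3[unfolded k_def y_def]]])
  qed
  then show ?case by blast
qed


section \<open>Compilation of loop programs to machines\<close>

datatype instr = IInc nat | IDec nat | IRead nat | IOut bool | IJz nat nat | IJmp nat

text \<open>Jump targets are capped at \<open>length P\<close>, where execution rests; the program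
  counter thus takes finitely many values and can be kept in the state of a machine.\<close>

fun istep :: "instr list \<Rightarrow> (nat \<Rightarrow> bool) \<Rightarrow> nat \<times> cstate \<Rightarrow> nat \<times> cstate" where
  "istep P u (pc, s, i, w) =
    (if pc < length P then
      (case P ! pc of
        IInc r \<Rightarrow> (Suc pc, s(r := Suc (s r)), i, w)
      | IDec r \<Rightarrow> (Suc pc, s(r := s r - 1), i, w)
      | IRead r \<Rightarrow> (Suc pc, s(r := s r + of_bool (u i)), Suc i, w)
      | IOut b \<Rightarrow> (Suc pc, s, i, w @ [b])
      | IJz r l \<Rightarrow> (if s r = 0 then min l (length P) else Suc pc, s, i, w)
      | IJmp l \<Rightarrow> (min l (length P), s, i, w))
     else (pc, s, i, w))"

declare istep.simps [simp del]

fun csize :: "cmd \<Rightarrow> nat" where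
  "csize (c ;; d) = csize c + csize d"
| "csize (Cond r c d) = csize c + csize d + 2"
| "csize (Loop r c) = csize c + 2"
| "csize _ = 1"

text \<open>The first argument is the absolute address of the generated code, from which the jump
  targets are computed.\<close>

fun comp :: "nat \<Rightarrow> cmd \<Rightarrow> instr list" where
  "comp pc (Inc r) = [IInc r]"
| "comp pc (Dec r) = [IDec r]"
| "comp pc (Read r) = [IRead r]"
| "comp pc (Out b) = [IOut b]"
| "comp pc (c ;; d) = comp pc c @ comp (pc + csize c) d"
| "comp pc (Cond r c d) = IJz r (pc + csize c + 2) # comp (Suc pc) c @
    IJmp (pc + csize c + csize d + 2) # comp (pc + csize c + 2) d"
| "comp pc (Loop r c) = IJz r (pc + csize c + 2) # comp (Suc pc) c @ [IJmp pc]"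

lemma length_comp [simp]: "length (comp pc c) = csize c"
  by (induction c arbitrary: pc) auto

definition reaches :: "instr list \<Rightarrow> (nat \<Rightarrow> bool) \<Rightarrow> nat \<times> cstate \<Rightarrow> nat \<times> cstate \<Rightarrow> bool" where
  "reaches P u x y \<longleftrightarrow> (\<exists>t. (istep P u ^^ t) x = y)"

lemma reaches_trans: "reaches P u x y \<Longrightarrow> reaches P u y z \<Longrightarrow> reaches P u x z"
  unfolding reaches_def by (metis comp_apply funpow_add)

lemma reaches_step: "istep P u x = y \<Longrightarrow> reaches P u x y"
  unfolding reaches_def by (rule exI[of _ 1]) simp

text \<open>The surrounding code \<open>A\<close> and \<open>B\<close> is arbitrary, since in the
  induction a subprogram is surrounded by the rest of the program.\<close>

lemma exec_reaches:
  assumes "exec u c \<sigma> \<tau>" "P = A @ comp (length A) c @ B"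
  shows "reaches P u (length A, \<sigma>) (length A + csize c, \<tau>)"
  using assms
proof (induction arbitrary: A B rule: exec.induct)
  case (Seq c \<sigma> \<tau> d \<rho>)
  have "reaches P u (length A, \<sigma>) (length A + csize c, \<tau>)"
    by (rule Seq.IH(1)[of A "comp (length A + csize c) d @ B"]) (simp add: Seq.prems)
  moreover have "reaches P u (length (A @ comp (length A) c), \<tau>)
      (length (A @ comp (length A) c) + csize d, \<rho>)"
    by (rule Seq.IH(2)[of _ B]) (simp add: Seq.prems)
  ultimately show ?case using reaches_trans by (fastforce simp: add.assoc)
next
  case (Cond1 \<sigma> r c \<tau> d)
  let ?l = "length A + csize c + csize d + 2"
  have "reaches P u (length A, \<sigma>) (Suc (length A), \<sigma>)"
    using Cond1.hyps(1)
    by (cases \<sigma>) (intro reaches_step, simp add: Cond1.prems istep.simps nth_append)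
  moreover have "reaches P u (length (A @ [IJz r (length A + csize c + 2)]), \<sigma>)
     (length (A @ [IJz r (length A + csize c + 2)]) + csize c, \<tau>)"
    by (rule Cond1.IH[of _ "IJmp ?l # comp (length A + csize c + 2) d @ B"]) (simp add: Cond1.prems)
  moreover have "reaches P u (Suc (length A) + csize c, \<tau>) (?l, \<tau>)"
    by (cases \<tau>) (intro reaches_step, simp add: Cond1.prems istep.simps nth_append)
  ultimately have "reaches P u (length A, \<sigma>) (?l, \<tau>)"
    by (metis (no_types, lifting) add_Suc_right length_append_singleton reaches_trans)
  then show ?case by (simp add: add.assoc)
next
  case (Cond2 \<sigma> r d \<tau> c)
  let ?l = "length A + csize c + csize d + 2"
  have "reaches P u (length A, \<sigma>) (length A + csize c + 2, \<sigma>)"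
    using Cond2.hyps(1)
    by (cases \<sigma>) (intro reaches_step, simp add: Cond2.prems istep.simps nth_append)
  moreover let ?A = "A @ IJz r (length A + csize c + 2) # comp (Suc (length A)) c @ [IJmp ?l]"
  have "reaches P u (length ?A, \<sigma>) (length ?A + csize d, \<tau>)"
    by (rule Cond2.IH[of _ B]) (simp add: Cond2.prems)
  ultimately show ?case
    using reaches_trans by (fastforce simp: add.assoc)
next
  case (Loop1 \<sigma> r c)
  then show ?case
    by (cases \<sigma>) (intro reaches_step, simp add: istep.simps nth_append)
next
  case (Loop2 \<sigma> r c \<tau> \<rho>)
  have 1: "reaches P u (length A, \<sigma>) (Suc (length A), \<sigma>)"
    using Loop2.hyps(1)
    by (cases \<sigma>) (intro reaches_step, simp add: Loop2.prems istep.simps nth_append)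
  have "reaches P u (length (A @ [IJz r (length A + csize c + 2)]), \<sigma>)
     (length (A @ [IJz r (length A + csize c + 2)]) + csize c, \<tau>)"
    by (rule Loop2.IH(1)[of _ "IJmp (length A) # B"]) (simp add: Loop2.prems)
  then have 2: "reaches P u (Suc (length A), \<sigma>) (Suc (length A) + csize c, \<tau>)" by simp
  have 3: "reaches P u (Suc (length A) + csize c, \<tau>) (length A, \<tau>)"
    by (cases \<tau>) (intro reaches_step, simp add: Loop2.prems istep.simps nth_append)
  show ?case
    using reaches_trans[OF reaches_trans[OF reaches_trans[OF 1 2] 3] Loop2.IH(2)[OF Loop2.prems]] .
qed (auto simp: istep.simps nth_append intro!: reaches_step)

text \<open>Register \<open>r\<close> is the position of the head of tape \<open>r\<close>; cell \<open>0\<close> of each tape is marked.\<close>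

definition machine_of :: "instr list \<Rightarrow> nat \<Rightarrow> machine" where
  "machine_of P k = \<lparr>states = length P + 2, symbols = 2, tapes = k,
    delta = (\<lambda>q b s. let stay = replicate k No_Move in
      case q of
        0 \<Rightarrow> (1, replicate k 1, stay, False, None)
      | Suc pc \<Rightarrow>
        if pc < length P then
          (case P ! pc of
            IInc r \<Rightarrow> (Suc q, s, stay[r := Right_Move], False, None)
          | IDec r \<Rightarrow> (Suc q, s, if s ! r = 1 then stay else stay[r := Left_Move], False, None)
          | IRead r \<Rightarrow> (Suc q, s, if b then stay[r := Right_Move] else stay, True, None)
          | IOut b \<Rightarrow> (Suc q, s, stay, False, Some b)
          | IJz r l \<Rightarrow> (if s ! r = 1 then Suc (min l (length P)) else Suc q, s, stay, False, None)
          | IJmp l \<Rightarrow> (Suc (min l (length P)), s, stay, False, None))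
        else (q, s, stay, False, None))\<rparr>"

lemma type2_machine_machine_of: "type2_machine (machine_of P k)"
  unfolding type2_machine_def machine_of_def
  by (auto simp: Let_def split: nat.splits instr.splits)

definition mark :: "int \<Rightarrow> nat" where
  "mark = (\<lambda>_. 0)(0 := 1)"

text \<open>After the marks are placed the tape contents never change, so the scanned symbol is 1
  exactly when the register is zero. State 0 is spent on placing the marks; hence position
  \<open>pc\<close> of the program is state \<open>Suc pc\<close>.\<close>

fun conf_of :: "nat \<Rightarrow> nat \<times> cstate \<Rightarrow> config" where
  "conf_of k (pc, s, i, w) = (Suc pc, i, map (\<lambda>r. (mark, int (s r))) [0..<k], w)"

fun instr_regs :: "instr \<Rightarrow> nat set" where
  "instr_regs (IInc r) = {r}"
| "instr_regs (IDec r) = {r}"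
| "instr_regs (IRead r) = {r}"
| "instr_regs (IJz r l) = {r}"
| "instr_regs _ = {}"

lemma finite_instr_regs: "finite (instr_regs I)"
  by (cases I) auto

lemma machine_of_initial:
  "step (machine_of P k) u (initial (machine_of P k)) = conf_of k (0, \<lambda>_. 0, 0, [])"
  by (auto simp: initial_def machine_of_def Let_def mark_def zip_replicate intro!: nth_equalityI)

lemma machine_of_step:
  assumes "\<And>I. I \<in> set P \<Longrightarrow> instr_regs I \<subseteq> {..<k}"
  shows "step (machine_of P k) u (conf_of k x) = conf_of k (istep P u x)"
proof (cases x)
  case (fields pc s i w)
  show ?thesis
  proof (cases "pc < length P")
    case True
    then have "instr_regs (P ! pc) \<subseteq> {..<k}" using assms by simp
    then show ?thesis using True
      by (cases "P ! pc") (auto simp: fields istep.simps machine_of_def Let_def mark_def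
          list_eq_iff_nth_eq nth_list_update of_nat_diff)
  next
    case False
    then show ?thesis
      by (auto simp: fields istep.simps machine_of_def Let_def list_eq_iff_nth_eq)
  qed
qed

lemma output_after_machine_of:
  assumes "\<And>I. I \<in> set P \<Longrightarrow> instr_regs I \<subseteq> {..<k}"
    and "reaches P u (0, \<lambda>_. 0, 0, []) (pc, s, i, w)"
  shows "\<exists>t. output_after (machine_of P k) u t = w"
proof -
  obtain t where t: "(istep P u ^^ t) (0, \<lambda>_. 0, 0, []) = (pc, s, i, w)"
    using assms(2) unfolding reaches_def by blast
  have "(step (machine_of P k) u ^^ t) (conf_of k x) = conf_of k ((istep P u ^^ t) x)" for x
    by (induction t) (simp_all add: machine_of_step[OF assms(1)])
  then have "(step (machine_of P k) u ^^ Suc t) (initial (machine_of P k)) = conf_of k (pc, s, i, w)"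
    using t by (simp only: funpow_Suc_right comp_apply machine_of_initial)
  then have "output_after (machine_of P k) u (Suc t) = w"
    unfolding output_after_def by (simp del: funpow.simps)
  then show ?thesis by blast
qed

text \<open>The machine runs \<open>c0\<close> and then \<open>Loop 0 c\<close>, which never ends.\<close>

lemma machine_of_rounds:
  "\<exists>M. type2_machine M \<and> (\<forall>u S.
    exec u c0 (\<lambda>_. 0, 0, []) (S 0) \<longrightarrow> (\<forall>n. fst (S n) 0 \<noteq> 0 \<and> exec u c (S n) (S (Suc n))) \<longrightarrow>
    (\<forall>n. \<exists>t. output_after M u t = snd (snd (S n))))"
proof -
  let ?d = "c0 ;; Loop 0 c"
  define P where "P = comp 0 ?d"
  have "finite (\<Union>I\<in>set P. instr_regs I)"
    by (intro finite_UN_I) (auto simp: finite_instr_regs)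
  then obtain k where "(\<Union>I\<in>set P. instr_regs I) \<subseteq> {..<k}"
    by (meson finite_nat_bounded)
  then have k: "\<And>I. I \<in> set P \<Longrightarrow> instr_regs I \<subseteq> {..<k}" by auto
  have "\<exists>t. output_after (machine_of P k) u t = snd (snd (S n))"
    if 0: "exec u c0 (\<lambda>_. 0, 0, []) (S 0)"
      and S: "\<And>n. fst (S n) 0 \<noteq> 0 \<and> exec u c (S n) (S (Suc n))" for u S n
  proof -
    have "reaches P u (0, \<lambda>_. 0, 0, []) (csize c0, S n)" for n
    proof (induction n)
      case 0
      show ?case
        using exec_reaches[OF that(1), of P "[]"] by (simp add: P_def)
    next
      case (Suc n)
      have 1: "reaches P u (csize c0, S n) (Suc (csize c0), S n)"
        using S[of n] by (cases "S n") (intro reaches_step, simp add: P_def istep.simps nth_append)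
      have 2: "reaches P u (Suc (csize c0), S n) (Suc (csize c0) + csize c, S (Suc n))"
        using exec_reaches[of u c "S n" "S (Suc n)" P "comp 0 c0 @ [IJz 0 (csize c0 + csize c + 2)]"
            "[IJmp (csize c0)]"] S[of n] by (simp add: P_def)
      have 3: "reaches P u (Suc (csize c0) + csize c, S (Suc n)) (csize c0, S (Suc n))"
        by (cases "S (Suc n)") (intro reaches_step, simp add: P_def istep.simps nth_append)
      show ?case
        using reaches_trans[OF Suc reaches_trans[OF 1 reaches_trans[OF 2 3]]] .
    qed
    then have "reaches P u (0, \<lambda>_. 0, 0, []) (csize c0, fst (S n), fst (snd (S n)), snd (snd (S n)))"
      by simp
    then show ?thesis using output_after_machine_of[OF k] by blast
  qed
  then show ?thesis using type2_machine_machine_of by blast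
qed


section \<open>Primitive recursion on encoded data\<close>

class code =
  fixes enc :: "'a \<Rightarrow> nat"
  assumes enc_inject: "enc x = enc y \<Longrightarrow> x = y"

lemma enc_eq_iff [simp]: "enc x = enc y \<longleftrightarrow> x = y"
  using enc_inject by blast

instantiation nat :: code
begin
definition enc_nat :: "nat \<Rightarrow> nat" where [simp]: "enc_nat n = n"
instance by standard simp
end

instantiation bool :: code
begin
definition enc_bool :: "bool \<Rightarrow> nat" where [simp]: "enc_bool b = of_bool b"
instance by standard (simp add: of_bool_def split: if_splits)
end

instantiation prod :: (code, code) code
begin
definition enc_prod :: "'a \<times> 'b \<Rightarrow> nat" where [simp]: "enc_prod z = prod_encode (enc (fst z), enc (snd z))"
instance by standard (auto simp: prod_eq_iff)
end

text \<open>Lists are coded by \<open>list_encode\<close> because associates are queried with such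
  codes; on lists of numbers \<open>list_encode\<close> and \<open>list_decode\<close> are then the
  identity on codes.\<close>

instantiation list :: (code) code
begin
definition enc_list :: "'a list \<Rightarrow> nat" where "enc_list l = list_encode (map enc l)"
instance by standard (auto simp: enc_list_def list_encode_eq inj_map_eq_map[OF injI[OF enc_inject]])
end

instantiation option :: (code) code
begin
definition enc_option :: "'a option \<Rightarrow> nat" where
  "enc_option x = (case x of None \<Rightarrow> 0 | Some y \<Rightarrow> Suc (enc y))"
instance by standard (auto simp: enc_option_def split: option.splits)
end

lemma enc_list_simps [simp]:
  "enc [] = 0" "enc (x # l) = Suc (prod_encode (enc x, enc l))"
  by (simp_all add: enc_list_def)

lemma enc_nat_list: "enc (l :: nat list) = list_encode l"
  by (induction l) simp_all

lemma enc_option_simps [simp]: "enc None = 0" "enc (Some x) = Suc (enc x)"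
  by (simp_all add: enc_option_def)

lemma length_le_enc: "length l \<le> enc l"
proof (induction l)
  case (Cons x l)
  then show ?case using le_prod_encode_2[of "enc l" "enc x"] by simp
qed simp

text \<open>Lifts unary primitive recursion to coded types, several arguments being packed into a
  tuple. The behaviour of \<open>g\<close> outside the range of \<open>enc\<close> is left
  open.\<close>

definition pr :: "('a::code \<Rightarrow> 'b::code) \<Rightarrow> bool" where
  "pr f \<longleftrightarrow> (\<exists>g. prim_rec g \<and> (\<forall>x. g (enc x) = enc (f x)))"

lemma prI: "prim_rec g \<Longrightarrow> (\<And>x. g (enc x) = enc (f x)) \<Longrightarrow> pr f"
  unfolding pr_def by blast

lemma pr_compose: "pr f \<Longrightarrow> pr g \<Longrightarrow> pr (\<lambda>x. f (g x))"
  unfolding pr_def using prim_rec_comp by fastforce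

lemma prim_rec_id: "prim_rec (\<lambda>n. n)"
  using prim_rec_pair[OF prim_rec_fst prim_rec_snd] by simp

lemma prim_rec_const: "prim_rec (\<lambda>_. c)"
proof (induction c)
  case (Suc c)
  then show ?case using prim_rec_comp[OF prim_rec_Suc] by simp
qed (rule prim_rec_zero)

named_theorems pr_intros

lemma pr_id [pr_intros]: "pr (\<lambda>x. x)"
  by (rule prI[OF prim_rec_id]) simp

lemma pr_const [pr_intros]: "pr (\<lambda>_. c)"
  by (rule prI[OF prim_rec_const]) simp

lemma pr_Suc [pr_intros]: "pr f \<Longrightarrow> pr (\<lambda>x. Suc (f x))"
  by (rule pr_compose[of Suc]) (rule prI[OF prim_rec_Suc], simp)

lemma pr_fst [pr_intros]: "pr f \<Longrightarrow> pr (\<lambda>x. fst (f x))"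
  by (rule pr_compose[of fst]) (rule prI[OF prim_rec_fst], simp)

lemma pr_snd [pr_intros]: "pr f \<Longrightarrow> pr (\<lambda>x. snd (f x))"
  by (rule pr_compose[of snd]) (rule prI[OF prim_rec_snd], simp)

lemma pr_Pair [pr_intros]:
  assumes "pr f" "pr g" shows "pr (\<lambda>x. (f x, g x))"
proof -
  obtain f' g' where "prim_rec f'" "\<forall>x. f' (enc x) = enc (f x)" "prim_rec g'" "\<forall>x. g' (enc x) = enc (g x)"
    using assms unfolding pr_def by blast
  then show ?thesis
    by (intro prI[OF prim_rec_pair[of f' g']]) simp_all
qed

text \<open>Only codes matter to \<open>pr\<close>, so a conversion that leaves the code unchanged
  costs nothing.\<close>

lemma pr_recode:
  assumes "pr f" "\<And>x. enc (f x) = enc (g x)"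
  shows "pr g"
  using assms unfolding pr_def by simp

lemma pr_prod_encode [pr_intros]: "pr f \<Longrightarrow> pr (\<lambda>x. prod_encode (f x))"
  by (erule pr_recode) simp

lemma pr_prod_decode [pr_intros]: "pr f \<Longrightarrow> pr (\<lambda>x. prod_decode (f x))"
  by (erule pr_recode) simp

lemma pr_list_encode [pr_intros]: "pr f \<Longrightarrow> pr (\<lambda>x. list_encode (f x))"
  by (erule pr_recode) (simp add: enc_nat_list)

lemma pr_list_decode [pr_intros]: "pr f \<Longrightarrow> pr (\<lambda>x. list_decode (f x))"
  by (erule pr_recode) (simp add: enc_nat_list)

lemma pr_funpow_nat:
  assumes "pr n" "pr a" "pr h"
  shows "pr (\<lambda>x. ((h::nat \<Rightarrow> nat) ^^ n x) (a x))"
proof -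
  obtain h' where h': "prim_rec h'" "\<forall>x. h' x = h x" using assms(3) unfolding pr_def by auto
  then have "h' = h" by auto
  have "pr (\<lambda>z. (h ^^ fst (prod_decode z)) (snd (prod_decode z)))"
    by (rule prI[OF prim_rec_iter[OF h'(1)]]) (simp add: \<open>h' = h\<close>)
  from pr_compose[OF this pr_prod_encode[OF pr_Pair[OF assms(1,2)]]]
  show ?thesis by simp
qed

text \<open>Iteration with a parameter, which is carried along in the state.\<close>

lemma pr_funpow [pr_intros]:
  fixes h :: "'a::code \<Rightarrow> 'b::code \<Rightarrow> 'b"
  assumes "pr n" "pr a" "pr (\<lambda>z. h (fst z) (snd z))"
  shows "pr (\<lambda>x. (h x ^^ n x) (a x))"
proof -
  obtain h' where h': "prim_rec h'" "\<And>x y. h' (prod_encode (enc x, enc y)) = enc (h x y)"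
    using assms(3) unfolding pr_def by fastforce
  define H where "H = (\<lambda>z. prod_encode (fst (prod_decode z), h' z))"
  have "pr H" unfolding H_def
    by (intro pr_intros prI[OF h'(1)]) simp
  have H: "(H ^^ k) (prod_encode (enc x, enc y)) = prod_encode (enc x, enc ((h x ^^ k) y))" for k x y
    unfolding H_def by (induction k) (simp_all add: h' del: enc_prod_def)
  have "pr (\<lambda>x. enc x)" by (rule pr_recode[OF pr_id]) simp
  moreover have "pr (\<lambda>x. enc (a x))" by (rule pr_recode[OF assms(2)]) simp
  ultimately have "pr (\<lambda>x. snd (prod_decode ((H ^^ n x) (prod_encode (enc x, enc (a x))))))"
    by (intro pr_intros pr_funpow_nat assms(1) \<open>pr H\<close>)
  then show ?thesis
    by (rule pr_recode) (simp add: H)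
qed

lemma pr_rec_nat [pr_intros]:
  assumes "pr n" "pr a" "pr (\<lambda>z. h (fst z) (fst (snd z)) (snd (snd z)))"
  shows "pr (\<lambda>x. rec_nat (a x) (h x) (n x))"
proof -
  have *: "((\<lambda>z. (Suc (fst z), h x (fst z) (snd z))) ^^ k) (0, y) = (k, rec_nat y (h x) k)" for k x y
    by (induction k) simp_all
  have "pr (\<lambda>x. snd (((\<lambda>z. (Suc (fst z), h x (fst z) (snd z))) ^^ n x) (0, a x)))"
    by (intro pr_intros assms(1,2) pr_compose[OF assms(3), of "\<lambda>z. (fst z, fst (snd z), snd (snd z))", simplified])
  then show ?thesis by (simp add: *)
qed

lemma pr_if [pr_intros]:
  assumes "pr b" "pr f" "pr g"
  shows "pr (\<lambda>x. if b x then f x else g x)"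
proof -
  have e: "pr (\<lambda>x. enc (f x))" "pr (\<lambda>x. enc (g x))" "pr (\<lambda>x. enc (b x))"
    by (rule pr_recode[OF assms(2)] pr_recode[OF assms(3)] pr_recode[OF assms(1)]; simp)+
  have "pr (\<lambda>x. rec_nat (enc (g x)) (\<lambda>_ _. enc (f x)) (enc (b x)))"
    by (intro pr_intros e pr_compose[OF e(1)])
  then show ?thesis by (rule pr_recode) simp
qed

lemma pr_not [pr_intros]: "pr b \<Longrightarrow> pr (\<lambda>x. \<not> b x)"
  by (rule pr_recode[OF pr_if[of b "\<lambda>_. False" "\<lambda>_. True"]]) (simp_all add: pr_const)

lemma pr_conj [pr_intros]: "pr b \<Longrightarrow> pr c \<Longrightarrow> pr (\<lambda>x. b x \<and> c x)"
  by (rule pr_recode[OF pr_if[of b c "\<lambda>_. False"]]) (simp_all add: pr_const)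

lemma pr_of_bool [pr_intros]: "pr b \<Longrightarrow> pr (\<lambda>x. of_bool (b x) :: nat)"
  by (erule pr_recode) simp

section \<open>Arithmetic and comparisons\<close>

lemma pr_pred: "pr f \<Longrightarrow> pr (\<lambda>x. f x - 1 :: nat)"
proof -
  have "rec_nat 0 (\<lambda>n _. n) k = k - 1" for k by (cases k) auto
  then show "pr f \<Longrightarrow> pr (\<lambda>x. f x - 1)"
    using pr_rec_nat[of f "\<lambda>_. 0::nat" "\<lambda>_ n _. n"] by (simp add: pr_intros)
qed

lemma pr_add [pr_intros]:
  assumes "pr f" "pr g" shows "pr (\<lambda>x. f x + g x :: nat)"
proof -
  have "pr (\<lambda>x. ((\<lambda>n. Suc n) ^^ g x) (f x))" by (intro pr_intros assms)
  then show ?thesis by (simp add: add.commute)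
qed

lemma pr_diff [pr_intros]:
  assumes "pr f" "pr g" shows "pr (\<lambda>x. f x - g x :: nat)"
proof -
  have "pr (\<lambda>x. ((\<lambda>n. n - 1) ^^ g x) (f x))" by (intro pr_intros pr_pred assms)
  moreover have "((\<lambda>n. n - 1) ^^ k) n = n - k" for k n :: nat by (induction k) auto
  ultimately show ?thesis by simp
qed

lemma pr_mult [pr_intros]:
  assumes "pr f" "pr g" shows "pr (\<lambda>x. f x * g x :: nat)"
proof -
  have "((\<lambda>m. m + a) ^^ k) 0 = a * k" for k a :: nat by (induction k) auto
  moreover have "pr (\<lambda>x. ((\<lambda>m. m + f x) ^^ g x) 0)"
    by (intro pr_intros assms(2) pr_compose[OF assms(1)])
  ultimately show ?thesis by simp
qed

lemma pr_power [pr_intros]: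
  assumes "pr f" "pr g" shows "pr (\<lambda>x. f x ^ g x :: nat)"
proof -
  have "((\<lambda>m. m * a) ^^ k) 1 = a ^ k" for k a :: nat by (induction k) auto
  moreover have "pr (\<lambda>x. ((\<lambda>m. m * f x) ^^ g x) 1)"
    by (intro pr_intros assms(2) pr_compose[OF assms(1)])
  ultimately show ?thesis by simp
qed

lemma pr_eq0: "pr f \<Longrightarrow> pr (\<lambda>x. f x = (0::nat))"
proof -
  have "rec_nat True (\<lambda>_ _. False) k = (k = 0)" for k by (cases k) auto
  then show "pr f \<Longrightarrow> pr (\<lambda>x. f x = (0::nat))"
    using pr_rec_nat[of f "\<lambda>_. True" "\<lambda>_ _ _. False"] by (simp add: pr_intros)
qed

lemma pr_le [pr_intros]: "pr f \<Longrightarrow> pr g \<Longrightarrow> pr (\<lambda>x. f x \<le> (g x :: nat))"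
  using pr_eq0[OF pr_diff, of f g] by simp

lemma pr_less [pr_intros]: "pr f \<Longrightarrow> pr g \<Longrightarrow> pr (\<lambda>x. f x < (g x :: nat))"
  using pr_not[OF pr_le, of g f] by (simp add: not_le)

lemma pr_eq [pr_intros]:
  assumes "pr f" "pr g" shows "pr (\<lambda>x. f x = g x)"
proof -
  have "pr (\<lambda>x. enc (f x))" "pr (\<lambda>x. enc (g x))"
    by (rule pr_recode[OF assms(1)] pr_recode[OF assms(2)]; simp)+
  then have "pr (\<lambda>x. enc (f x) \<le> enc (g x) \<and> enc (g x) \<le> enc (f x))" by (intro pr_intros)
  moreover have "(enc (f x) \<le> enc (g x) \<and> enc (g x) \<le> enc (f x)) = (f x = g x)" for x
    by (metis enc_eq_iff le_antisym order_refl)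
  ultimately show ?thesis by simp
qed

lemma pr_even [pr_intros]:
  assumes "pr f" shows "pr (\<lambda>x. even (f x :: nat))"
proof -
  have "rec_nat True (\<lambda>_ b. \<not> b) k = even k" for k by (induction k) auto
  moreover have "pr (\<lambda>x. rec_nat True (\<lambda>_ b. \<not> b) (f x))" by (intro pr_intros assms)
  ultimately show ?thesis by simp
qed

lemma pr_div2 [pr_intros]:
  assumes "pr f" shows "pr (\<lambda>x. f x div 2 :: nat)"
proof -
  have "rec_nat 0 (\<lambda>n m. if even n then m else Suc m) k = k div 2" for k :: nat
    by (induction k) auto
  moreover have "pr (\<lambda>x. rec_nat (0::nat) (\<lambda>n m. if even n then m else Suc m) (f x))"
    by (intro pr_intros assms)
  ultimately show ?thesis by simp
qed

text \<open>Makes the transition function of an arbitrary machine primitive recursive, as only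
  finitely many arguments are legal.\<close>

lemma pr_finite_table:
  assumes "finite S"
  shows "pr (\<lambda>x. if x \<in> S then h x else d)"
  using assms
proof (induction S)
  case (insert a S)
  have "(\<lambda>x. if x \<in> insert a S then h x else d) = (\<lambda>x. if x = a then h a else if x \<in> S then h x else d)"
    by auto
  then show ?case using insert.IH by (auto intro!: pr_intros)
qed (simp add: pr_const)

lemma pr_the [pr_intros]: "pr f \<Longrightarrow> pr (\<lambda>x. case f x of None \<Rightarrow> d | Some y \<Rightarrow> y)"
proof -
  assume f: "pr f"
  have 1: "pr (\<lambda>x. enc (f x))" by (rule pr_recode[OF f]) simp
  have "pr (\<lambda>x. if enc (f x) = 0 then enc d else enc (f x) - 1)"
    by (intro pr_intros 1 pr_pred)
  then show ?thesis by (rule pr_recode) (simp split: option.split)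
qed

section \<open>List functions\<close>

lemma pr_Cons [pr_intros]:
  assumes "pr f" "pr g" shows "pr (\<lambda>x. f x # g x)"
  by (rule pr_recode[OF pr_Suc[OF pr_recode[OF pr_Pair[OF assms]]]]) simp_all

definition hdd :: "'a \<Rightarrow> 'a list \<Rightarrow> 'a" where
  "hdd d l = (case l of [] \<Rightarrow> d | x # _ \<Rightarrow> x)"

lemma hdd_simps [simp]: "hdd d [] = d" "hdd d (x # l) = x"
  by (simp_all add: hdd_def)

lemma pr_hdd [pr_intros]:
  assumes "pr d" "pr f" shows "pr (\<lambda>x. hdd (d x) (f x))"
proof -
  have 1: "pr (\<lambda>x. enc (f x))" "pr (\<lambda>x. enc (d x))"
    by (rule pr_recode[OF assms(1)] pr_recode[OF assms(2)]; simp)+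
  have "pr (\<lambda>x. if enc (f x) = 0 then enc (d x) else fst (prod_decode (enc (f x) - 1)))"
    by (intro pr_intros 1 pr_pred)
  then show ?thesis by (rule pr_recode) (simp add: hdd_def split: list.split)
qed

lemma pr_tl [pr_intros]: "pr f \<Longrightarrow> pr (\<lambda>x. tl (f x))"
proof -
  assume f: "pr f"
  have 1: "pr (\<lambda>x. enc (f x))" by (rule pr_recode[OF f]) simp
  have "pr (\<lambda>x. if enc (f x) = 0 then 0 else snd (prod_decode (enc (f x) - 1)))"
    by (intro pr_intros 1 pr_pred)
  then show ?thesis
  proof (rule pr_recode)
    show "enc (if enc (f x) = 0 then 0 else snd (prod_decode (enc (f x) - 1))) = enc (tl (f x))" for x
      by (cases "f x") simp_all
  qed
qed

text \<open>A fold is an iteration that consumes the list. The code of the list bounds its length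
  and serves as the number of rounds; surplus rounds find the list empty and change nothing. The
  element \<open>?d\<close> is a default that is never reached.\<close>

lemma pr_foldl [pr_intros]:
  assumes "pr a" "pr l" "pr (\<lambda>z. h (fst z) (fst (snd z)) (snd (snd z)))"
  shows "pr (\<lambda>x. foldl (h x) (a x) (l x))"
proof -
  let ?d = "SOME d. True"
  let ?H = "\<lambda>x z. if snd z = [] then z else (h x (fst z) (hdd ?d (snd z)), tl (snd z))"
  have *: "length m \<le> k \<Longrightarrow> (?H x ^^ k) (y, m) = (foldl (h x) y m, [])" for x k y m
  proof (induction k arbitrary: y m)
    case (Suc k)
    show ?case
    proof (cases m)
      case Nil
      have "(?H x ^^ j) (y, []) = (y, [])" for j by (induction j) auto
      from this[of "Suc k"] show ?thesis using Nil by simp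
    next
      case (Cons b m')
      then show ?thesis using Suc by (simp add: funpow_Suc_right del: funpow.simps)
    qed
  qed auto
  have e: "pr (\<lambda>x. enc (l x))" by (rule pr_recode[OF assms(2)]) simp
  have "pr (\<lambda>x. fst ((?H x ^^ enc (l x)) (a x, l x)))"
    by (intro pr_intros e assms(1,2)
        pr_compose[OF assms(3), of "\<lambda>z. (fst z, fst (snd z), hdd ?d (snd (snd z)))", simplified])
  then show ?thesis by (simp add: *[OF length_le_enc])
qed

lemma list_folds:
  "foldl (\<lambda>m y. y # m) m l = rev l @ m"
  "foldr (\<lambda>a b. a # b) l m = l @ m"
  "foldr (\<lambda>_. Suc) l 0 = length l"
  "foldr (\<lambda>a b. a @ b) ll [] = concat ll"
  "(tl ^^ k) l = drop k l"
proof -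
  show "foldl (\<lambda>m y. y # m) m l = rev l @ m" by (induction l arbitrary: m) auto
  show "foldr (\<lambda>a b. a # b) l m = l @ m" "foldr (\<lambda>_. Suc) l 0 = length l"
    by (induction l) auto
  show "foldr (\<lambda>a b. a @ b) ll [] = concat ll" by (induction ll) auto
  show "(tl ^^ k) l = drop k l" by (induction k) (auto simp: drop_Suc tl_drop)
qed

lemma pr_rev [pr_intros]: "pr l \<Longrightarrow> pr (\<lambda>x. rev (l x))"
proof -
  assume "pr l"
  then have "pr (\<lambda>x. foldl (\<lambda>m y. y # m) [] (l x))" by (intro pr_intros)
  then show ?thesis by (simp add: list_folds)
qed

lemma pr_foldr [pr_intros]:
  assumes "pr a" "pr l" "pr (\<lambda>z. h (fst z) (fst (snd z)) (snd (snd z)))"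
  shows "pr (\<lambda>x. foldr (h x) (l x) (a x))"
proof -
  have "pr (\<lambda>x. foldl (\<lambda>y z. h x z y) (a x) (rev (l x)))"
    by (intro pr_intros assms(1,2)
        pr_compose[OF assms(3), of "\<lambda>z. (fst z, snd (snd z), fst (snd z))", simplified])
  then show ?thesis by (simp add: foldl_conv_foldr)
qed

lemma pr_append [pr_intros]:
  assumes "pr l" "pr m" shows "pr (\<lambda>x. l x @ m x)"
proof -
  have "pr (\<lambda>x. foldr (\<lambda>a b. a # b) (l x) (m x))" by (intro pr_intros assms)
  then show ?thesis by (simp add: list_folds)
qed

lemma pr_length [pr_intros]: "pr l \<Longrightarrow> pr (\<lambda>x. length (l x))"
proof -
  assume "pr l"
  then have "pr (\<lambda>x. foldr (\<lambda>_ n. Suc n) (l x) 0)" by (intro pr_intros)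
  then show ?thesis by (simp add: list_folds)
qed

lemma pr_map [pr_intros]:
  assumes "pr l" "pr (\<lambda>z. f (fst z) (snd z))" shows "pr (\<lambda>x. map (f x) (l x))"
proof -
  have "foldr (\<lambda>y m. f x y # m) l [] = map (f x) l" for x l by (induction l) auto
  moreover have "pr (\<lambda>x. foldr (\<lambda>y m. f x y # m) (l x) [])"
    by (intro pr_intros assms(1) pr_compose[OF assms(2), of "\<lambda>z. (fst z, fst (snd z))", simplified])
  ultimately show ?thesis by simp
qed

lemma pr_filter [pr_intros]:
  assumes "pr l" "pr (\<lambda>z. P (fst z) (snd z))" shows "pr (\<lambda>x. filter (P x) (l x))"
proof -
  have "foldr (\<lambda>y m. if P x y then y # m else m) l [] = filter (P x) l" for x l by (induction l) auto
  moreover have "pr (\<lambda>x. foldr (\<lambda>y m. if P x y then y # m else m) (l x) [])"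
    by (intro pr_intros assms(1) pr_compose[OF assms(2), of "\<lambda>z. (fst z, fst (snd z))", simplified])
  ultimately show ?thesis by simp
qed

lemma pr_takeWhile [pr_intros]:
  assumes "pr l" "pr (\<lambda>z. P (fst z) (snd z))" shows "pr (\<lambda>x. takeWhile (P x) (l x))"
proof -
  have "foldr (\<lambda>y m. if P x y then y # m else []) l [] = takeWhile (P x) l" for x l by (induction l) auto
  moreover have "pr (\<lambda>x. foldr (\<lambda>y m. if P x y then y # m else []) (l x) [])"
    by (intro pr_intros assms(1) pr_compose[OF assms(2), of "\<lambda>z. (fst z, fst (snd z))", simplified])
  ultimately show ?thesis by simp
qed

lemma pr_list_ex [pr_intros]:
  assumes "pr l" "pr (\<lambda>z. P (fst z) (snd z))" shows "pr (\<lambda>x. list_ex (P x) (l x))"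
proof -
  have "pr (\<lambda>x. 0 < length (filter (P x) (l x)))" by (intro pr_intros assms)
  then show ?thesis by (simp add: filter_empty_conv list_ex_iff)
qed

lemma pr_concat [pr_intros]: "pr l \<Longrightarrow> pr (\<lambda>x. concat (l x))"
proof -
  assume "pr l"
  then have "pr (\<lambda>x. foldr (\<lambda>a b. a @ b) (l x) [])" by (intro pr_intros)
  then show ?thesis by (simp add: list_folds)
qed

lemma pr_upt [pr_intros]: "pr f \<Longrightarrow> pr g \<Longrightarrow> pr (\<lambda>x. [f x..<g x])"
proof -
  assume fg: "pr f" "pr g"
  have "rec_nat [] (\<lambda>n l. l @ [n]) k = [0..<k]" for k by (induction k) auto
  moreover have "pr (\<lambda>x. rec_nat [] (\<lambda>n l. l @ [n]) (g x))" by (intro pr_intros fg)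
  ultimately have "pr (\<lambda>x. [0..<g x])" by simp
  then have "pr (\<lambda>x. filter (\<lambda>n. f x \<le> n) [0..<g x])"
    by (intro pr_intros pr_compose[OF fg(1)])
  moreover have "filter (\<lambda>n. a \<le> n) [0..<b] = [a..<b]" for a b :: nat
    by (induction b) auto
  ultimately show ?thesis by simp
qed

lemma pr_drop [pr_intros]: "pr n \<Longrightarrow> pr l \<Longrightarrow> pr (\<lambda>x. drop (n x) (l x))"
proof -
  assume "pr n" "pr l"
  then have "pr (\<lambda>x. ((\<lambda>l. tl l) ^^ n x) (l x))" by (intro pr_intros)
  then show ?thesis by (simp add: list_folds)
qed

definition nthd :: "'a \<Rightarrow> 'a list \<Rightarrow> nat \<Rightarrow> 'a" where
  "nthd d l i = (if i < length l then l ! i else d)"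

lemma nthd_conv_hdd: "nthd d l i = hdd d (drop i l)"
  by (auto simp: nthd_def hdd_def simp flip: Cons_nth_drop_Suc)

lemma pr_nthd [pr_intros]:
  assumes "pr d" "pr l" "pr i" shows "pr (\<lambda>x. nthd (d x) (l x) (i x))"
  unfolding nthd_conv_hdd by (intro pr_intros assms)

lemma pr_take [pr_intros]: "pr n \<Longrightarrow> pr l \<Longrightarrow> pr (\<lambda>x. take (n x) (l x))"
proof -
  assume nl: "pr n" "pr l"
  have "pr (\<lambda>x. rev (drop (length (l x) - n x) (rev (l x))))" by (intro pr_intros nl)
  then show ?thesis by (rule pr_recode) (simp add: rev_drop diff_diff_cancel not_le split: nat_diff_split)
qed

lemma zip_conv_nthd:
  "map (\<lambda>i. (nthd d l i, nthd e m i)) [0..<if length l \<le> length m then length l else length m] = zip l m"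
  by (rule nth_equalityI) (auto simp: nthd_def split: if_splits)

lemma pr_zip [pr_intros]:
  assumes "pr l" "pr m" shows "pr (\<lambda>x. zip (l x) (m x))"
proof -
  let ?d = "SOME d. True"
  have "pr (\<lambda>x. map (\<lambda>i. (nthd ?d (l x) i, nthd ?d (m x) i))
      [0..<if length (l x) \<le> length (m x) then length (l x) else length (m x)])"
    by (intro pr_intros assms pr_compose[OF assms(1)] pr_compose[OF assms(2)])
  then show ?thesis by (simp only: zip_conv_nthd)
qed


section \<open>Machines from stage functions\<close>

text \<open>The tape position where the block for \<open>p n\<close> begins, which consists of
  \<open>p n\<close> symbols \<open>True\<close> and a closing \<open>False\<close>.\<close>

definition block_start :: "name \<Rightarrow> nat \<Rightarrow> nat" where
  "block_start p n = (\<Sum>k<n. Suc (p k))"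

lemma block_start_simps [simp]:
  "block_start p 0 = 0" "block_start p (Suc n) = Suc (block_start p n + p n)"
  by (simp_all add: block_start_def)

lemma block_start_mono: "m \<le> n \<Longrightarrow> block_start p m \<le> block_start p n"
  by (induction n) (auto simp: le_Suc_eq)

lemma le_block_start: "n \<le> block_start p n"
  by (induction n) auto

lemma unary_tape_iff: "unary_tape p i \<longleftrightarrow> (\<forall>n. i \<noteq> block_start p n + p n)"
proof -
  have "(\<Sum>k\<le>n. p k) + n = block_start p n + p n" for n
    by (induction n) simp_all
  then show ?thesis unfolding unary_tape_def by simp
qed

lemma unary_tape_block:
  assumes "v \<le> p n"
  shows "unary_tape p (block_start p n + v) \<longleftrightarrow> v < p n"
proof
  assume "unary_tape p (block_start p n + v)"
  then show "v < p n" using assms unary_tape_iff by (metis le_neq_implies_less)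
next
  assume v: "v < p n"
  have "block_start p n + v \<noteq> block_start p m + p m" for m
  proof (cases "m < n")
    case True
    then show ?thesis using block_start_mono[of "Suc m" n p] by simp
  next
    case False
    then show ?thesis using block_start_mono[of n m p] v
      by (cases "m = n") (use block_start_mono[of "Suc n" m p] in auto)
  qed
  then show "unary_tape p (block_start p n + v)" by (simp add: unary_tape_iff)
qed

definition blocks :: "nat list \<Rightarrow> bool list" where
  "blocks l = concat (map (\<lambda>v. replicate v True @ [False]) l)"

lemma blocks_prefix: "blocks (map p [0..<n]) = map (unary_tape p) [0..<block_start p n]"
proof (induction n)
  case (Suc n)
  have "replicate (p n) True @ [False] = map (\<lambda>v. unary_tape p (block_start p n + v)) [0..<Suc (p n)]"
    by (rule nth_equalityI) (auto simp: nth_append unary_tape_block simp del: upt_Suc)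
  also have "\<dots> = map (unary_tape p) [block_start p n..<block_start p (Suc n)]"
    by (rule nth_equalityI) (simp_all del: upt_Suc)
  finally have "blocks (map p [0..<Suc n]) =
      map (unary_tape p) ([0..<block_start p n] @ [block_start p n..<block_start p (Suc n)])"
    using Suc by (simp add: blocks_def del: block_start_simps)
  also have "[0..<block_start p n] @ [block_start p n..<block_start p (Suc n)] = [0..<block_start p (Suc n)]"
    using upt_add_eq_append[of 0 "block_start p n" "Suc (p n)"] by simp
  finally show ?case .
qed (simp add: blocks_def)

lemma prim_rec_of_pr: "pr (f :: nat \<Rightarrow> nat) \<Longrightarrow> prim_rec f"
  unfolding pr_def by (auto simp flip: fun_eq_iff)

text \<open>Register 5 holds the last symbol read. Register 4 counts the closing
  \<open>False\<close> too, whence the final decrement.\<close>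

definition read_number :: cmd where
  "read_number = (Inc 5 ;; Loop 5 (Dec 5 ;; Inc 4 ;; Read 5) ;; Dec 4)"

lemma exec_read_number:
  assumes "s 4 = 0" "s 5 = 0"
  shows "exec (unary_tape p) read_number (s, block_start p k, w) (s(4 := p k), block_start p (Suc k), w)"
proof -
  let ?v = "p k"
  let ?S = "\<lambda>n. (s(5 := of_bool (0 < n), 4 := Suc ?v - n), block_start p k + (Suc ?v - n), w)"
  have "exec (unary_tape p) (Loop 5 (Dec 5 ;; Inc 4 ;; Read 5)) (?S (Suc ?v)) (?S 0)"
  proof (rule exec_Loop)
    fix n assume n: "n < Suc ?v"
    then show "exec (unary_tape p) (Dec 5 ;; Inc 4 ;; Read 5) (?S (Suc n)) (?S n)"
      using unary_tape_block[of "?v - n" p k]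
      by (intro exec.Seq[OF exec.Dec] exec.Seq[OF exec.Inc] exec_eq[OF exec.Read])
        (auto simp: fun_eq_iff Suc_diff_le)
  qed auto
  moreover have "exec (unary_tape p) (Inc 5) (s, block_start p k, w) (?S (Suc ?v))"
    by (rule exec_eq[OF exec.Inc]) (use assms in \<open>auto simp: fun_eq_iff\<close>)
  moreover have "exec (unary_tape p) (Dec 4) (?S 0) (s(4 := p k), block_start p (Suc k), w)"
    by (rule exec_eq[OF exec.Dec]) (use assms in \<open>auto simp: fun_eq_iff\<close>)
  ultimately show ?thesis unfolding read_number_def by (meson exec.Seq)
qed

definition emit_number :: cmd where
  "emit_number = (Dec 5 ;; Loop 5 (Dec 5 ;; Out True) ;; Out False)"

lemma exec_emit_number:
  assumes "s 5 = Suc v"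
  shows "exec u emit_number (s, i, w) (s(5 := 0), i, w @ replicate v True @ [False])"
proof -
  let ?S = "\<lambda>n. (s(5 := n), i, w @ replicate (v - n) True)"
  have "exec u (Loop 5 (Dec 5 ;; Out True)) (?S v) (?S 0)"
  proof (rule exec_Loop)
    fix n assume "n < v"
    then have "replicate (v - n) True = replicate (v - Suc n) True @ [True]"
      by (metis Suc_diff_Suc replicate_Suc replicate_append_same)
    then show "exec u (Dec 5 ;; Out True) (?S (Suc n)) (?S n)"
      by (intro exec.Seq[OF exec.Dec] exec_eq[OF exec.Out]) auto
  qed auto
  moreover have "exec u (Dec 5) (s, i, w) (?S v)"
    by (rule exec_eq[OF exec.Dec]) (use assms in auto)
  moreover have "exec u (Out False) (?S 0) (s(5 := 0), i, w @ replicate v True @ [False])"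
    by (rule exec_eq[OF exec.Out]) auto
  ultimately show ?thesis unfolding emit_number_def by (meson exec.Seq)
qed

text \<open>\<open>\<Phi> \<sigma> j\<close> is the successor of the \<open>j\<close>-th value, or \<open>0\<close> if the prefix \<open>\<sigma>\<close> does not determine it.\<close>

theorem pr_machine:
  fixes \<Phi> :: "nat list \<Rightarrow> nat \<Rightarrow> nat"
  assumes "pr (\<lambda>z. \<Phi> (fst z) (snd z))"
  shows "\<exists>M. type2_machine M \<and> (\<forall>p q. (\<forall>j k. \<Phi> (map p [0..<k]) j \<in> {0, Suc (q j)}) \<longrightarrow>
    (\<forall>j. \<forall>\<^sub>F k in sequentially. \<Phi> (map p [0..<k]) j \<noteq> 0) \<longrightarrow> transforms M p q)"
proof -
  define H where "H n = \<Phi> (list_decode (fst (prod_decode n))) (snd (prod_decode n))" for n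
  have "pr H" unfolding H_def
    using pr_compose[OF assms, of "\<lambda>n. (list_decode (fst (prod_decode n)), snd (prod_decode n))"]
    by (simp add: pr_intros)
  then obtain cH where cH: "implements 5 cH H"
    using prim_rec_implements prim_rec_of_pr by blast
  define A where "A n = list_encode (list_decode (fst (prod_decode n)) @ [snd (prod_decode n)])" for n
  have "pr A" unfolding A_def by (intro pr_intros)
  then obtain cA where cA: "implements 2 cA A"
    using prim_rec_implements prim_rec_of_pr by blast
  \<comment> \<open>Between rounds, register 0 keeps the loop alive, 1 holds the number of values
    emitted and 3 the code of the prefix read so far. A round reads one number and then asks
    \<open>\<Phi>\<close> for the next value not yet emitted; registers 2 and 5 return the longer
    prefix and the answer.\<close>
  define update where "update = (read_number ;; encode 3 4 2 ;; cA ;; copy 2 3 4 ;; copy 1 4 5 ;; encode 3 4 5 ;; cH)"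
  define body where "body = (update ;; Cond 5 (Inc 1 ;; emit_number) (clear 5) ;; clear 3 ;; move 2 3)"
  obtain M where M: "type2_machine M" "\<And>u S n.
      exec u (Inc 0) (\<lambda>_. 0, 0, []) (S 0) \<Longrightarrow> (\<And>n. fst (S n) 0 \<noteq> 0 \<and> exec u body (S n) (S (Suc n))) \<Longrightarrow>
      (\<exists>t. output_after M u t = snd (snd (S n)))"
    using machine_of_rounds[of "Inc 0" body] by blast
  have "transforms M p q"
    if 1: "\<And>j k. \<Phi> (map p [0..<k]) j \<in> {0, Suc (q j)}"
      and 2: "\<And>j. \<forall>\<^sub>F k in sequentially. \<Phi> (map p [0..<k]) j \<noteq> 0" for p q
  proof -
    let ?u = "unary_tape p"
    \<comment> \<open>\<open>J k\<close> is the number of values emitted in the first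
      \<open>k\<close> rounds.\<close>
    define J where "J = rec_nat 0 (\<lambda>k j. if \<Phi> (map p [0..<Suc k]) j = 0 then j else Suc j)"
    have J0: "J 0 = 0" and JS: "J (Suc k) = (if \<Phi> (map p [0..<Suc k]) (J k) = 0 then J k else Suc (J k))" for k
      by (simp_all add: J_def)
    define R where "R j c = (\<lambda>_::nat. 0::nat)(0 := 1, 1 := j, 3 := c)" for j c
    define S where "S k = (R (J k) (list_encode (map p [0..<k])), block_start p k, blocks (map q [0..<J k]))" for k
    have "exec ?u (Inc 0) (\<lambda>_. 0, 0, []) (S 0)"
      by (rule exec_eq[OF exec.Inc]) (simp add: S_def R_def J0 blocks_def fun_eq_iff)
    moreover have "fst (S n) 0 \<noteq> 0 \<and> exec ?u body (S n) (S (Suc n))" for n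
    proof
      show "fst (S n) 0 \<noteq> 0" by (simp add: S_def R_def)
      let ?c = "list_encode (map p [0..<n])" and ?c' = "list_encode (map p [0..<Suc n])"
      let ?w = "blocks (map q [0..<J n])"
      let ?r = "\<Phi> (map p [0..<Suc n]) (J n)"
      define T where "T = (\<lambda>_::nat. 0::nat)(0 := 1, 1 := J n, 2 := ?c', 5 := ?r)"
      have snoc: "map p [0..<n] @ [p n] = map p [0..<Suc n]" by simp
      have A: "A (prod_encode (?c, p n)) = ?c'" by (simp add: A_def)
      have H: "H (prod_encode (?c', J n)) = ?r" by (simp add: H_def del: upt_Suc)
      have 3: "exec ?u update (S n) (T, block_start p (Suc n), ?w)"
        unfolding update_def S_def
        by (intro exec.Seq[OF exec_read_number] exec.Seq[OF exec_encode] exec.Seq[OF implementsD[OF cA]]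
            exec.Seq[OF exec_copy] exec_eq[OF implementsD[OF cH]])
          (auto simp: R_def T_def A[simplified] H snoc fun_eq_iff simp del: upt_Suc)
      have 4: "exec ?u (Cond 5 (Inc 1 ;; emit_number) (clear 5)) (T, block_start p (Suc n), ?w)
          (T(1 := J (Suc n), 5 := 0), block_start p (Suc n), blocks (map q [0..<J (Suc n)]))"
      proof (cases "?r = 0")
        case True
        show ?thesis
          by (rule exec.Cond2[OF _ exec_eq[OF exec_clear]])
            (use True in \<open>auto simp: T_def JS fun_eq_iff simp del: upt_Suc\<close>)
      next
        case False
        then have "?r = Suc (q (J n))" using 1[of "Suc n" "J n"] by (simp del: upt_Suc)
        then show ?thesis
          by (intro exec.Cond1[OF _ exec.Seq[OF exec.Inc exec_eq[OF exec_emit_number]]])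
            (auto simp: T_def JS blocks_def fun_eq_iff simp del: upt_Suc, simp add: upt_Suc)
      qed
      have 5: "exec ?u (clear 3 ;; move 2 3)
         (T(1 := J (Suc n), 5 := 0), block_start p (Suc n), blocks (map q [0..<J (Suc n)])) (S (Suc n))"
        unfolding S_def
        by (rule exec.Seq[OF exec_clear exec_eq[OF exec_move]]) (auto simp: T_def R_def fun_eq_iff simp del: upt_Suc)
      show "exec ?u body (S n) (S (Suc n))"
        unfolding body_def by (rule exec.Seq[OF 3 exec.Seq[OF 4 5]])
    qed
    ultimately have out: "\<exists>t. output_after M ?u t = blocks (map q [0..<J n])" for n
      using M(2)[of ?u S n] by (simp add: S_def)
    have J_unbounded: "\<exists>k. n \<le> J k" for n
    proof (induction n)
      case (Suc n)
      then obtain k where k: "n \<le> J k" by blast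
      show ?case
      proof (rule ccontr)
        \<comment> \<open>If \<open>J\<close> stopped at \<open>n\<close>, every later round would
          ask for value \<open>n\<close>, which is determined by all sufficiently long
          prefixes.\<close>
        assume no: "\<nexists>k. Suc n \<le> J k"
        have mono: "J k \<le> J (k + l)" for l by (induction l) (auto simp: JS)
        have const: "J (k + l) = n" for l using mono[of l] k no by (metis le_antisym not_less_eq_eq order_trans)
        obtain l where "l > k" "\<Phi> (map p [0..<l]) n \<noteq> 0"
          using 2[of n] eventually_gt_at_top[of k] by (metis (mono_tags, lifting) eventually_conj eventually_happens trivial_limit_sequentially)
        then show False
          using JS[of "l - 1"] const[of "l - 1 - k"] const[of "l - k"] by auto
      qed
    qed auto
    show ?thesis unfolding transforms_def outputs_def
    proof
      fix n
      obtain k where "n \<le> J k" using J_unbounded by blast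
      then have k: "n \<le> block_start q (J k)" using le_block_start order_trans by blast
      obtain t where "output_after M ?u t = blocks (map q [0..<J k])" using out by blast
      with k show "\<exists>t. n \<le> length (output_after M ?u t) \<and> take n (output_after M ?u t) = map (unary_tape q) [0..<n]"
        by (intro exI[of _ t]) (simp add: blocks_prefix take_map)
    qed
  qed
  then show ?thesis using M(1) by blast
qed


section \<open>Simulation of machines\<close>

instantiation move :: code
begin
definition enc_move :: "move \<Rightarrow> nat" where
  [simp]: "enc_move m = (case m of Left_Move \<Rightarrow> 0 | No_Move \<Rightarrow> 1 | Right_Move \<Rightarrow> 2)"
instance by standard (simp split: move.splits)
end

instantiation int :: code
begin
definition enc_int :: "int \<Rightarrow> nat" where [simp]: "enc_int = int_encode"
instance by standard (simp add: int_encode_eq)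
end

lemma pr_int_succ: "pr f \<Longrightarrow> pr (\<lambda>x. f x + 1 :: int)"
proof -
  assume f: "pr f"
  have "pr (\<lambda>x. int_encode (f x))" by (rule pr_recode[OF f]) simp
  then have "pr (\<lambda>x. if even (int_encode (f x)) then int_encode (f x) + 2
      else if int_encode (f x) = 1 then 0 else int_encode (f x) - 2)"
    by (intro pr_intros)
  then show ?thesis
    by (rule pr_recode) (auto simp: int_encode_def sum_encode_def split: if_splits)
qed

lemma pr_int_pred: "pr f \<Longrightarrow> pr (\<lambda>x. f x - 1 :: int)"
proof -
  assume f: "pr f"
  have "pr (\<lambda>x. int_encode (f x))" by (rule pr_recode[OF f]) simp
  then have "pr (\<lambda>x. if odd (int_encode (f x)) then int_encode (f x) + 2
      else if int_encode (f x) = 0 then 1 else int_encode (f x) - 2)"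
    by (intro pr_intros)
  then show ?thesis
    by (rule pr_recode) (auto simp: int_encode_def sum_encode_def split: if_splits)
qed

lemma pr_shift: "pr f \<Longrightarrow> pr g \<Longrightarrow> pr (\<lambda>x. shift (f x) (g x))"
proof -
  assume "pr f" "pr g"
  then have "pr (\<lambda>x. if f x = Left_Move then g x - 1 else if f x = No_Move then g x else g x + 1)"
    by (intro pr_intros pr_int_pred pr_int_succ)
  moreover have "(if m = Left_Move then h - 1 else if m = No_Move then h else h + 1) = shift m h" for m h
    by (cases m) auto
  ultimately show ?thesis by simp
qed

text \<open>A tape is a list of the cells that have been written to, the latest writing first.\<close>

type_synonym tape_log = "(int \<times> nat) list \<times> int"

definition cell :: "(int \<times> nat) list \<Rightarrow> int \<Rightarrow> nat" where
  "cell l x = snd (hdd (x, 0) (filter (\<lambda>z. fst z = x) l))"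

lemma cell_simps [simp]: "cell [] = (\<lambda>_. 0)" "cell ((h, s) # l) = (cell l)(h := s)"
  by (auto simp: cell_def)

definition legal :: "machine \<Rightarrow> (nat \<times> bool \<times> nat list) set" where
  "legal M = {(q, b, s). q < states M \<and> length s = tapes M \<and> set s \<subseteq> {..<symbols M}}"

lemma finite_legal: "finite (legal M)"
proof -
  have "legal M \<subseteq> {..<states M} \<times> UNIV \<times> {s. set s \<subseteq> {..<symbols M} \<and> length s = tapes M}"
    by (auto simp: legal_def)
  then show ?thesis by (rule finite_subset) (simp add: finite_lists_length_eq)
qed

text \<open>Outside the legal arguments \<open>delta M\<close> is an arbitrary function, so only its
  finite legal part is tabulated.\<close>

definition delta_table :: "machine \<Rightarrow> nat \<times> bool \<times> nat list \<Rightarrow> nat \<times> nat list \<times> move list \<times> bool \<times> bool option" where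
  "delta_table M z = (if z \<in> legal M then (case z of (q, b, s) \<Rightarrow> delta M q b s) else (0, [], [], False, None))"

lemma pr_delta_table: "pr f \<Longrightarrow> pr (\<lambda>x. delta_table M (f x))"
  unfolding delta_table_def by (rule pr_compose[OF pr_finite_table[OF finite_legal]])

type_synonym lconfig = "nat \<times> nat \<times> tape_log list \<times> bool list"

text \<open>Uses projections instead of patterns to match the rules \<open>pr_intros\<close>.
  Positions beyond the known part of the input read as \<open>False\<close>.\<close>

definition lstep :: "machine \<Rightarrow> bool list \<Rightarrow> lconfig \<Rightarrow> lconfig" where
  "lstep M us c = (let ls = fst (snd (snd c));
      r = delta_table M (fst c, nthd False us (fst (snd c)), map (\<lambda>z. cell (fst z) (snd z)) ls);
      b = snd (snd (snd (snd r)))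
    in (fst r, if fst (snd (snd (snd r))) then Suc (fst (snd c)) else fst (snd c),
      map (\<lambda>z. ((snd (fst z), fst (snd z)) # fst (fst z), shift (snd (snd z)) (snd (fst z))))
        (zip ls (zip (fst (snd r)) (fst (snd (snd r))))),
      snd (snd (snd c)) @ (if b = None then [] else [case b of None \<Rightarrow> False | Some b \<Rightarrow> b])))"

lemma pr_lstep:
  assumes "pr us" "pr c"
  shows "pr (\<lambda>x. lstep M (us x) (c x))"
  unfolding lstep_def cell_def Let_def by (intro pr_intros pr_delta_table pr_shift assms)

definition linit :: "machine \<Rightarrow> lconfig" where
  "linit M = (0, 0, replicate (tapes M) ([], 0), [])"

text \<open>The number \<open>t\<close> of steps bounds the position of the input head; this keeps
  the head inside the known part of the input.\<close>

definition lrel :: "machine \<Rightarrow> nat \<Rightarrow> config \<Rightarrow> lconfig \<Rightarrow> bool" where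
  "lrel M t c l \<longleftrightarrow> fst l = fst c \<and> fst c < states M \<and> fst (snd l) = fst (snd c) \<and> fst (snd c) \<le> t \<and>
    snd (snd (snd l)) = snd (snd (snd c)) \<and>
    fst (snd (snd c)) = map (\<lambda>z. (cell (fst z), snd z)) (fst (snd (snd l))) \<and>
    length (fst (snd (snd l))) = tapes M \<and>
    (\<forall>z\<in>set (fst (snd (snd l))). \<forall>x. cell (fst z) x < symbols M)"

lemma lrel_init: "type2_machine M \<Longrightarrow> lrel M 0 (initial M) (linit M)"
  by (auto simp: lrel_def initial_def linit_def type2_machine_def)

lemma lrel_step:
  assumes M: "type2_machine M" and c: "lrel M t c l" and us: "nthd False us (fst (snd c)) = u (fst (snd c))"
  shows "lrel M (Suc t) (step M u c) (lstep M us l)"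
proof -
  obtain q i ts w where c_eq: "c = (q, i, ts, w)" by (cases c)
  obtain ls where l_eq: "l = (q, i, ls, w)" using c by (cases l) (auto simp: lrel_def c_eq)
  have ls: "ts = map (\<lambda>z. (cell (fst z), snd z)) ls" "length ls = tapes M"
      "\<And>z x. z \<in> set ls \<Longrightarrow> cell (fst z) x < symbols M" and q: "q < states M" and i: "i \<le> t"
    using c by (auto simp: lrel_def c_eq l_eq)
  define s where "s = map (\<lambda>z. cell (fst z) (snd z)) ls"
  have s: "(q, u i, s) \<in> legal M" using ls q by (auto simp: legal_def s_def)
  obtain q' s' mv a b where d: "delta M q (u i) s = (q', s', mv, a, b)" by (cases "delta M q (u i) s")
  have ok: "q' < states M" "length s' = tapes M" "set s' \<subseteq> {..<symbols M}" "length mv = tapes M"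
  proof -
    have leg: "q < states M \<and> length s = tapes M \<and> set s \<subseteq> {..<symbols M}"
      using s by (simp add: legal_def)
    from M[unfolded type2_machine_def, THEN conjunct2, THEN conjunct2, rule_format, OF leg, where b = "u i"] show "q' < states M" "length s' = tapes M" "set s' \<subseteq> {..<symbols M}" "length mv = tapes M"
      by (simp_all add: d)
  qed
  have tab: "delta_table M (q, u i, s) = (q', s', mv, a, b)"
    using s by (simp add: delta_table_def d)
  have scan: "map (\<lambda>(t, h). t h) ts = s" by (simp add: ls s_def)
  have st: "step M u c = (q', if a then Suc i else i,
      map (\<lambda>((t, h), s, m). (t(h := s), shift m h)) (zip ts (zip s' mv)), case b of None \<Rightarrow> w | Some b \<Rightarrow> w @ [b])"
    by (simp add: c_eq scan d)
  have lst: "lstep M us l = (q', if a then Suc i else i,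
      map (\<lambda>z. ((snd (fst z), fst (snd z)) # fst (fst z), shift (snd (snd z)) (snd (fst z)))) (zip ls (zip s' mv)),
      w @ (if b = None then [] else [case b of None \<Rightarrow> False | Some b \<Rightarrow> b]))"
    using us unfolding lstep_def Let_def by (simp add: l_eq c_eq tab flip: s_def)
  have "\<forall>z\<in>set (zip ls (zip s' mv)). \<forall>x. ((cell (fst (fst z)))(snd (fst z) := fst (snd z))) x < symbols M"
  proof (intro ballI allI)
    fix z x assume z: "z \<in> set (zip ls (zip s' mv))"
    obtain e f g where zeq: "z = (e, f, g)" by (cases z)
    have "e \<in> set ls" "f \<in> set s'"
      using z unfolding zeq by (auto dest: set_zip_leftD set_zip_rightD)
    then have "f < symbols M" "cell (fst e) x < symbols M" using ok(3) ls(3) by auto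
    then show "((cell (fst (fst z)))(snd (fst z) := fst (snd z))) x < symbols M"
      by (simp add: zeq)
  qed
  then show ?thesis
    using ok ls(2) i unfolding lrel_def st lst
    by (auto simp: ls(1) zip_map1 split: option.split)
qed

definition parse :: "bool list \<Rightarrow> nat list" where
  "parse w = fst (foldl (\<lambda>z b. if b then (fst z, Suc (snd z)) else (fst z @ [snd z], 0)) ([], 0) w)"

lemma parse_prefix:
  assumes "block_start q m \<le> n" "n < block_start q (Suc m)"
  shows "parse (map (unary_tape q) [0..<n]) = map q [0..<m]"
proof -
  let ?f = "\<lambda>z b. if b then (fst z, Suc (snd z)) else (fst z @ [snd z], 0)"
  have "\<exists>m. block_start q m \<le> n \<and> n < block_start q (Suc m) \<and>
     foldl ?f ([], 0) (map (unary_tape q) [0..<n]) = (map q [0..<m], n - block_start q m)" for n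
  proof (induction n)
    case 0
    show ?case by (rule exI[of _ 0]) simp
  next
    case (Suc n)
    then obtain m where m: "block_start q m \<le> n" "n < block_start q (Suc m)"
        "foldl ?f ([], 0) (map (unary_tape q) [0..<n]) = (map q [0..<m], n - block_start q m)" by blast
    have u: "unary_tape q n \<longleftrightarrow> n - block_start q m < q m"
      using unary_tape_block[of "n - block_start q m" q m] m by simp
    show ?case
    proof (cases "unary_tape q n")
      case True
      then show ?thesis using m u by (intro exI[of _ m]) auto
    next
      case False
      then show ?thesis using m u by (intro exI[of _ "Suc m"]) auto
    qed
  qed
  then obtain m' where m': "block_start q m' \<le> n" "n < block_start q (Suc m')"
    "foldl ?f ([], 0) (map (unary_tape q) [0..<n]) = (map q [0..<m'], n - block_start q m')" by blast
  have "m' = m"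
    using assms m'(1,2) block_start_mono[of "Suc m" m' q] block_start_mono[of "Suc m'" m q]
    by (metis leD leI le_less_trans less_eq_Suc_le linorder_neqE_nat)
  then show ?thesis using m' by (simp add: parse_def)
qed

text \<open>The tape of \<open>n\<close> numbers has at least \<open>n\<close> symbols, so a
  simulation of \<open>n\<close> steps reads only symbols that the prefix determines.
  \<open>parse\<close> drops an unfinished block at the end of the output.\<close>

definition run :: "machine \<Rightarrow> nat list \<Rightarrow> nat list" where
  "run M \<sigma> = parse (snd (snd (snd ((lstep M (blocks \<sigma>) ^^ length \<sigma>) (linit M)))))"

lemma pr_run [pr_intros]: "pr f \<Longrightarrow> pr (\<lambda>x. run M (f x))"
proof -
  assume f: "pr f"
  have rep: "replicate n True = map (\<lambda>_. True) [0..<n]" for n by (simp add: map_replicate_trivial)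
  show ?thesis
    unfolding run_def parse_def blocks_def rep
    by (intro pr_intros pr_lstep f pr_compose[OF f])
qed

lemma output_after_mono: "\<exists>w. output_after M u (t + k) = output_after M u t @ w"
proof (induction k)
  case (Suc k)
  have "\<exists>w. snd (snd (snd (step M u c))) = snd (snd (snd c)) @ w" for c
    by (cases c) (auto split: prod.split option.split)
  from this[of "(step M u ^^ (t + k)) (initial M)"] obtain w
    where w: "output_after M u (t + Suc k) = output_after M u (t + k) @ w"
    by (auto simp: output_after_def)
  from Suc obtain w' where "output_after M u (t + k) = output_after M u t @ w'" by blast
  with w show ?case by simp
qed (simp add: output_after_def)

text \<open>The notion in which all stage functions are composed. The lengths need not increase,
  they only tend to infinity.\<close>

definition tends :: "(nat \<Rightarrow> nat list) \<Rightarrow> name \<Rightarrow> bool" where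
  "tends L q \<longleftrightarrow> (\<forall>k. L k = map q [0..<length (L k)]) \<and> filterlim (\<lambda>k. length (L k)) at_top sequentially"

lemma tends_prefix: "tends L q \<Longrightarrow> L k = map q [0..<length (L k)]"
  unfolding tends_def by blast

lemma tends_nth: "tends L q \<Longrightarrow> i < length (L k) \<Longrightarrow> L k ! i = q i"
  using tends_prefix[of L q k] by (metis add_0 diff_zero length_upt nth_map nth_upt)

lemma tends_length: "tends L q \<Longrightarrow> \<forall>\<^sub>F k in sequentially. n \<le> length (L k)"
  unfolding tends_def filterlim_at_top by blast

lemma tendsI:
  assumes "\<And>k i. i < length (L k) \<Longrightarrow> L k ! i = q i" "\<And>n. \<forall>\<^sub>F k in sequentially. n \<le> length (L k)"
  shows "tends L q"
  unfolding tends_def filterlim_at_top using assms by (auto intro!: nth_equalityI)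

text \<open>Reduces a stage function to canonical prefixes, as \<open>L k\<close> is the canonical
  prefix of length \<open>length (L k)\<close>.\<close>

lemma tends_compose:
  assumes "tends L p" "tends (\<lambda>k. h (map p [0..<k])) q"
  shows "tends (\<lambda>k. h (L k)) q"
proof -
  have h: "h (L k) = h (map p [0..<length (L k)])" for k using tends_prefix[OF assms(1)] by metis
  show ?thesis
  proof (rule tendsI)
    show "i < length (h (L k)) \<Longrightarrow> h (L k) ! i = q i" for k i
      unfolding h[of k] by (rule tends_nth[OF assms(2)])
    fix n
    have "filterlim (\<lambda>k. length (L k)) at_top sequentially"
      using assms(1) unfolding tends_def by blast
    from eventually_compose_filterlim[OF tends_length[OF assms(2)] this]
    show "\<forall>\<^sub>F k in sequentially. n \<le> length (h (L k))" by (simp flip: h)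
  qed
qed

text \<open>Stage \<open>k\<close> sees the complete blocks of the output after \<open>k\<close>
  steps, and the output grows towards the tape of \<open>q\<close>.\<close>

theorem tends_run:
  assumes M: "type2_machine M" and tr: "transforms M p q" and L: "tends L p"
  shows "tends (\<lambda>k. run M (L k)) q"
proof (rule tends_compose[OF L])
  let ?u = "unary_tape p"
  define W where "W t = output_after M ?u t" for t
  have mono: "\<exists>w. W (t + k) = W t @ w" for t k unfolding W_def by (rule output_after_mono)
  have out: "\<exists>t. n \<le> length (W t) \<and> take n (W t) = map (unary_tape q) [0..<n]" for n
    using tr unfolding transforms_def outputs_def W_def by blast
  have W: "W t = map (unary_tape q) [0..<length (W t)]" for t
  proof -
    obtain t' where t': "length (W t) \<le> length (W t')"
        "take (length (W t)) (W t') = map (unary_tape q) [0..<length (W t)]"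
      using out by blast
    have "take (length (W t)) (W t') = W t"
    proof (cases "t \<le> t'")
      case True
      then show ?thesis using mono[of t "t' - t"] by auto
    next
      case False
      then show ?thesis using mono[of t' "t - t'"] t'(1) by auto
    qed
    then show ?thesis using t' by simp
  qed
  have len: "\<forall>\<^sub>F t in sequentially. n \<le> length (W t)" for n
  proof -
    obtain t where "n \<le> length (W t)" using out by blast
    then have "n \<le> length (W t')" if "t \<le> t'" for t'
      using mono[of t "t' - t"] that by auto
    then show ?thesis unfolding eventually_sequentially by blast
  qed
  have sim: "lrel M t ((step M ?u ^^ t) (initial M)) ((lstep M (blocks (map p [0..<k])) ^^ t) (linit M))"
    if "t \<le> k" for t k
    using that
  proof (induction t)
    case (Suc t)
    then have IH: "lrel M t ((step M ?u ^^ t) (initial M)) ((lstep M (blocks (map p [0..<k])) ^^ t) (linit M))"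
      by simp
    let ?i = "fst (snd ((step M ?u ^^ t) (initial M)))"
    have "?i < block_start p k"
      using IH Suc.prems le_block_start[of k p] by (auto simp: lrel_def)
    then have "nthd False (blocks (map p [0..<k])) ?i = ?u ?i"
      by (simp add: nthd_def blocks_prefix)
    from lrel_step[where u = ?u, OF M IH this] show ?case by simp
  qed (simp add: lrel_init[OF M])
  have run: "run M (map p [0..<k]) = parse (W k)" for k
    using sim[of k k] by (simp add: run_def W_def output_after_def lrel_def)
  have ex: "\<exists>m. block_start q m \<le> n \<and> n < block_start q (Suc m)" for n
  proof (induction n)
    case 0
    show ?case by (rule exI[of _ 0]) simp
  next
    case (Suc n)
    then obtain m where "block_start q m \<le> n" "n < block_start q (Suc m)" by blast
    then show ?case
      by (cases "Suc n < block_start q (Suc m)")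
        (auto intro: exI[of _ m] exI[of _ "Suc m"])
  qed
  show "tends (\<lambda>k. run M (map p [0..<k])) q" unfolding run
  proof (rule tendsI)
    fix k i assume i: "i < length (parse (W k))"
    obtain m where m: "block_start q m \<le> length (W k)" "length (W k) < block_start q (Suc m)"
      using ex by blast
    from parse_prefix[OF m] i show "parse (W k) ! i = q i" by (metis W length_map length_upt diff_zero nth_map_upt add_0)
  next
    fix n
    show "\<forall>\<^sub>F k in sequentially. n \<le> length (parse (W k))"
      using len[of "block_start q n"]
    proof eventually_elim
      case (elim k)
      obtain m where m: "block_start q m \<le> length (W k)" "length (W k) < block_start q (Suc m)"
        using ex by blast
      have "n < Suc m"
        using elim m(2) block_start_mono[of "Suc m" n q] by (meson leI leD le_less_trans)
      moreover have "parse (W k) = map q [0..<m]" using parse_prefix[OF m] W[of k] by simp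
      ultimately show ?case by simp
    qed
  qed
qed


section \<open>Operations on approximations of names\<close>

lemma takeWhile_upt:
  "\<exists>j\<le>l. takeWhile P [0..<l] = [0..<j] \<and> (\<forall>i<j. P i) \<and> (j < l \<longrightarrow> \<not> P j)"
proof (induction l)
  case (Suc l)
  then obtain j where j: "j \<le> l" "takeWhile P [0..<l] = [0..<j]" "\<forall>i<j. P i" "j < l \<longrightarrow> \<not> P j"
    by blast
  show ?case
  proof (cases "j = l \<and> P l")
    case True
    then have "takeWhile P [0..<Suc l] = [0..<Suc l]"
      using j by (intro iffD2[OF takeWhile_eq_all_conv]) (auto simp: less_Suc_eq)
    then show ?thesis using j True by (intro exI[of _ "Suc l"]) (auto simp: less_Suc_eq)
  next
    case False
    have "takeWhile P [0..<Suc l] = takeWhile P [0..<l]"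
    proof (cases "j = l")
      case True
      then have eq: "takeWhile P [0..<l] = [0..<l]" using j by simp
      have "takeWhile P ([0..<l] @ [l]) = [0..<l] @ takeWhile P [l]"
        by (rule takeWhile_append2) (use j(3) True in auto)
      then show ?thesis using False True unfolding eq by simp
    next
      case False
      then have "j < l" "\<not> P j" using j by auto
      then show ?thesis by (auto simp: takeWhile_append intro: bexI[of _ j])
    qed
    then show ?thesis using j False by (intro exI[of _ j]) auto
  qed
qed auto

lemma length_takeWhile_upt_ge:
  assumes "n \<le> l" "\<And>i. i < n \<Longrightarrow> P i"
  shows "n \<le> length (takeWhile P [0..<l])"
  using takeWhile_upt[of l P] assms by (metis diff_zero le_less_linear length_upt less_le_trans)

lemma nth_takeWhile_upt:
  assumes "i < length (takeWhile P [0..<l])"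
  shows "takeWhile P [0..<l] ! i = i" "P i" "i < l"
proof -
  obtain j where "j \<le> l" "takeWhile P [0..<l] = [0..<j]" "\<forall>i<j. P i"
    using takeWhile_upt[of l P] by blast
  then show "takeWhile P [0..<l] ! i = i" "P i" "i < l" using assms by auto
qed

lemma hdd_filter_upt:
  assumes "k < n" "P (f k)" "\<And>j. j < k \<Longrightarrow> \<not> P (f j)"
  shows "hdd d (filter P (map f [0..<n])) = f k"
proof -
  have "[0..<n] = [0..<k] @ k # [Suc k..<n]"
    using assms(1) by (metis le_add1 le_add_same_cancel1 less_imp_add_positive upt_add_eq_append upt_conv_Cons)
  then show ?thesis using assms by simp
qed

text \<open>Kleene application on prefixes, \<open>\<sigma>\<close> of the associate and
  \<open>\<tau>\<close> of its argument. An entry of \<open>\<sigma>\<close> that is not yet known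
  counts as 1 in the search, so that the search stops there instead of skipping a possibly positive
  entry; it counts as 0 in the final lookup, meaning that the value is still undetermined.\<close>

definition app_val :: "nat list \<Rightarrow> nat list \<Rightarrow> nat \<Rightarrow> nat" where
  "app_val \<sigma> \<tau> i = nthd 0 \<sigma> (hdd (length \<sigma>)
    (filter (\<lambda>c. nthd 1 \<sigma> c \<noteq> 0) (map (\<lambda>k. list_encode (i # take k \<tau>)) [0..<Suc (length \<tau>)])))"

definition app_list :: "nat list \<Rightarrow> nat list \<Rightarrow> nat list" where
  "app_list \<sigma> \<tau> = map (\<lambda>i. app_val \<sigma> \<tau> i - 1) (takeWhile (\<lambda>i. app_val \<sigma> \<tau> i \<noteq> 0) [0..<length \<sigma>])"

lemma pr_app_val [pr_intros]:
  assumes "pr s" "pr t" "pr i" shows "pr (\<lambda>x. app_val (s x) (t x) (i x))"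
  unfolding app_val_def by (intro pr_intros assms assms[THEN pr_compose])

lemma pr_app_list [pr_intros]:
  assumes "pr s" "pr t" shows "pr (\<lambda>x. app_list (s x) (t x))"
  unfolding app_list_def by (intro pr_intros assms assms[THEN pr_compose])

lemma app_val_approx:
  assumes "p (list_encode (i # map q [0..<m])) = Suc v"
    and "\<And>k. k < m \<Longrightarrow> p (list_encode (i # map q [0..<k])) = 0"
  shows "app_val (map p [0..<l]) (map q [0..<n]) i \<in> {0, Suc v}"
    and "m \<le> n \<Longrightarrow> (\<And>k. k \<le> m \<Longrightarrow> list_encode (i # map q [0..<k]) < l) \<Longrightarrow>
      app_val (map p [0..<l]) (map q [0..<n]) i = Suc v"
proof -
  let ?c = "\<lambda>k. list_encode (i # map q [0..<k])"
  let ?P = "\<lambda>c. nthd 1 (map p [0..<l]) c \<noteq> 0"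
  have P: "?P c \<longleftrightarrow> l \<le> c \<or> p c \<noteq> 0" for c by (auto simp: nthd_def)
  have map_c: "map (\<lambda>k. list_encode (i # take k (map q [0..<n]))) [0..<Suc (length (map q [0..<n]))]
      = map ?c [0..<Suc n]"
    by (auto simp: take_map min_def simp del: upt_Suc list_encode.simps intro!: map_cong)
  have val: "app_val (map p [0..<l]) (map q [0..<n]) i
      = nthd 0 (map p [0..<l]) (hdd l (filter ?P (map ?c [0..<Suc n])))"
    unfolding app_val_def map_c by simp
  have Pm: "?P (?c m)" unfolding P using assms(1) by (simp del: list_encode.simps)
  define K where "K = (LEAST k. ?P (?c k))"
  have K: "?P (?c K)" "K \<le> m" "\<And>j. j < K \<Longrightarrow> \<not> ?P (?c j)"
    unfolding K_def using Pm by (rule LeastI, rule Least_le, metis not_less_Least)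
  show "app_val (map p [0..<l]) (map q [0..<n]) i \<in> {0, Suc v}"
  proof (cases "K < Suc n")
    case True
    have "hdd l (filter ?P (map ?c [0..<Suc n])) = ?c K"
      by (rule hdd_filter_upt[OF True]) (use K in auto)
    then show ?thesis
      using K assms unfolding val P by (cases "K = m") (auto simp: nthd_def)
  next
    case False
    then have "filter ?P (map ?c [0..<Suc n]) = []"
      using K(3) by (auto simp: filter_empty_conv simp del: upt_Suc)
    then show ?thesis unfolding val by (simp add: nthd_def)
  qed
  assume mn: "m \<le> n" and l: "\<And>k. k \<le> m \<Longrightarrow> ?c k < l"
  have "hdd l (filter ?P (map ?c [0..<Suc n])) = ?c m"
    by (rule hdd_filter_upt) (use mn l assms P in \<open>auto simp: not_le\<close>)
  then show "app_val (map p [0..<l]) (map q [0..<n]) i = Suc v"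
    using l[of m] assms(1) unfolding val by (simp add: nthd_def)
qed

lemma tends_app_list:
  assumes A: "tends A p" and B: "tends B q" and r: "associate p q r"
  shows "tends (\<lambda>k. app_list (A k) (B k)) r"
proof -
  obtain m where m: "\<And>i. p (list_encode (i # map q [0..<m i])) = Suc (r i)"
      "\<And>i k. k < m i \<Longrightarrow> p (list_encode (i # map q [0..<k])) = 0"
    using r unfolding associate_def by metis
  have 1: "app_val (A k) (B k) i \<in> {0, Suc (r i)}" for k i
    using app_val_approx(1)[of p i q "m i" "r i"] m tends_prefix[OF A, of k] tends_prefix[OF B, of k]
    by metis
  have 2: "\<forall>\<^sub>F k in sequentially. app_val (A k) (B k) i = Suc (r i)" for i
  proof -
    \<comment> \<open>Once \<open>N\<close> entries of the associate are known, all its answers up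
      to the decisive one are known.\<close>
    define N where "N = Suc (Max ((\<lambda>k. list_encode (i # map q [0..<k])) ` {..m i}))"
    have N: "list_encode (i # map q [0..<k]) < N" if "k \<le> m i" for k
      unfolding N_def less_Suc_eq_le using that by (intro Max_ge) auto
    show ?thesis
      using tends_length[OF A, of N] tends_length[OF B, of "m i"]
    proof eventually_elim
      case (elim k)
      have "app_val (map p [0..<length (A k)]) (map q [0..<length (B k)]) i = Suc (r i)"
        by (rule app_val_approx(2)[of p i q "m i"]) (use m elim N less_le_trans in blast)+
      then show ?case using tends_prefix[OF A, of k] tends_prefix[OF B, of k] by simp
    qed
  qed
  show ?thesis
  proof (rule tendsI)
    fix k i assume i: "i < length (app_list (A k) (B k))"
    then have "i < length (takeWhile (\<lambda>i. app_val (A k) (B k) i \<noteq> 0) [0..<length (A k)])"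
      by (simp add: app_list_def)
    from nth_takeWhile_upt[OF this] show "app_list (A k) (B k) ! i = r i"
      using 1[of k i] i by (simp add: app_list_def)
  next
    fix n
    have "\<forall>\<^sub>F k in sequentially. \<forall>i<n. app_val (A k) (B k) i = Suc (r i)"
      using 2 by (simp add: eventually_all_finite eventually_ball_finite_distrib[of "{..<n}", simplified, unfolded Ball_def, simplified])
    with tends_length[OF A, of n] show "\<forall>\<^sub>F k in sequentially. n \<le> length (app_list (A k) (B k))"
    proof eventually_elim
      case (elim k)
      then show ?case unfolding app_list_def length_map by (intro length_takeWhile_upt_ge) auto
    qed
  qed
qed

definition slice_list :: "nat list \<Rightarrow> nat \<Rightarrow> nat list" where
  "slice_list \<sigma> m = map (\<lambda>i. nthd 0 \<sigma> (prod_encode (m, i)))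
    (takeWhile (\<lambda>i. prod_encode (m, i) < length \<sigma>) [0..<length \<sigma>])"

lemma pr_slice_list [pr_intros]:
  assumes "pr s" "pr m" shows "pr (\<lambda>x. slice_list (s x) (m x))"
  unfolding slice_list_def by (intro pr_intros assms assms[THEN pr_compose])

lemma tends_slice_list:
  assumes A: "tends A p"
  shows "tends (\<lambda>k. slice_list (A k) m) (slice p m)"
proof (rule tendsI)
  fix k i assume i: "i < length (slice_list (A k) m)"
  then have "i < length (takeWhile (\<lambda>i. prod_encode (m, i) < length (A k)) [0..<length (A k)])"
    by (simp add: slice_list_def)
  from nth_takeWhile_upt[OF this] show "slice_list (A k) m ! i = slice p m i"
    using i by (simp add: slice_list_def slice_def nthd_def tends_nth[OF A])
next
  fix n
  define N where "N = Suc (Max ((\<lambda>i. prod_encode (m, i)) ` {..n}))"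
  have N: "prod_encode (m, i) < N" if "i \<le> n" for i
    unfolding N_def less_Suc_eq_le using that by (intro Max_ge) auto
  have "n \<le> N" using N[of n] le_prod_encode_2[of n m] by simp
  show "\<forall>\<^sub>F k in sequentially. n \<le> length (slice_list (A k) m)"
    using tends_length[OF A, of N]
  proof eventually_elim
    case (elim k)
    then show ?case
      unfolding slice_list_def length_map using \<open>n \<le> N\<close>
      by (intro length_takeWhile_upt_ge) (auto intro: less_le_trans[OF N])
  qed
qed

definition pair_name :: "name \<Rightarrow> name \<Rightarrow> name" where
  "pair_name p q i = (if even i then p (i div 2) else q (i div 2))"

lemma prod_rep_pair_name: "prod_rep \<delta> \<epsilon> (pair_name p q) (x, y) \<longleftrightarrow> \<delta> p x \<and> \<epsilon> q y"
  by (simp add: prod_rep_def pair_name_def)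

definition pair_list :: "nat list \<Rightarrow> nat list \<Rightarrow> nat list" where
  "pair_list \<sigma> \<tau> = map (\<lambda>i. if even i then nthd 0 \<sigma> (i div 2) else nthd 0 \<tau> (i div 2))
    [0..<2 * (if length \<sigma> \<le> length \<tau> then length \<sigma> else length \<tau>)]"

lemma pr_pair_list [pr_intros]:
  assumes "pr s" "pr t" shows "pr (\<lambda>x. pair_list (s x) (t x))"
  unfolding pair_list_def by (intro pr_intros assms assms[THEN pr_compose])

lemma tends_pair_list:
  assumes A: "tends A p" and B: "tends B q"
  shows "tends (\<lambda>k. pair_list (A k) (B k)) (pair_name p q)"
proof (rule tendsI)
  fix k i assume "i < length (pair_list (A k) (B k))"
  then have "i div 2 < length (A k)" "i div 2 < length (B k)"
    "i < 2 * (if length (A k) \<le> length (B k) then length (A k) else length (B k))"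
    by (auto simp: pair_list_def split: if_splits)
  then show "pair_list (A k) (B k) ! i = pair_name p q i"
    by (simp add: pair_list_def pair_name_def nthd_def tends_nth[OF A] tends_nth[OF B])
next
  fix n
  show "\<forall>\<^sub>F k in sequentially. n \<le> length (pair_list (A k) (B k))"
    using tends_length[OF A, of n] tends_length[OF B, of n]
    by eventually_elim (simp add: pair_list_def)
qed

lemma length_tl_list_decode: "length (tl (list_decode c)) \<le> c"
proof -
  have "length (list_decode c) \<le> c"
    using length_le_enc[of "list_decode c"] by (simp add: enc_nat_list)
  then show ?thesis by simp
qed

text \<open>The values of an associate of the functional that is approximated by \<open>h\<close>.\<close>

definition curry_val :: "(nat list \<Rightarrow> nat list) \<Rightarrow> nat \<Rightarrow> nat" where
  "curry_val h c = (if hdd 0 (list_decode c) < length (h (tl (list_decode c)))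
    then Suc (nthd 0 (h (tl (list_decode c))) (hdd 0 (list_decode c))) else 0)"

lemma pr_curry_val:
  assumes "pr (\<lambda>z. h (fst z) (snd z))" "pr c" shows "pr (\<lambda>x. curry_val (h x) (c x))"
proof -
  have "pr (\<lambda>x. h x (tl (list_decode (c x))))"
    using pr_compose[OF assms(1), of "\<lambda>x. (x, tl (list_decode (c x)))"]
    by (simp add: pr_intros assms(2))
  then show ?thesis unfolding curry_val_def by (intro pr_intros assms(2))
qed

text \<open>Prefixes of \<open>q\<close> may give outputs of varying length; an associate uses the
  first one whose output contains the entry asked for. All outputs are prefixes of \<open>r\<close>,
  so that the entry is the right one.\<close>

lemma associate_curry:
  assumes "\<And>c. p c = curry_val h c" "tends (\<lambda>k. h (map q [0..<k])) r"
  shows "associate p q r"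
  unfolding associate_def
proof
  fix n
  let ?L = "\<lambda>k. length (h (map q [0..<k]))"
  have p: "p (list_encode (n # map q [0..<k])) = (if n < ?L k then Suc (r n) else 0)" for k
    using tends_nth[OF assms(2), of n k] by (simp add: assms(1) curry_val_def nthd_def del: list_encode.simps)
  have "\<exists>k. n < ?L k"
    using tends_length[OF assms(2), of "Suc n"] unfolding eventually_sequentially Suc_le_eq by blast
  then have "n < ?L (LEAST k. n < ?L k)" "\<And>k. k < (LEAST k. n < ?L k) \<Longrightarrow> \<not> n < ?L k"
    by (rule LeastI_ex, metis not_less_Least)
  then show "\<exists>m. p (list_encode (n # map q [0..<m])) = Suc (r n) \<and> (\<forall>k<m. p (list_encode (n # map q [0..<k])) = 0)"
    by (intro exI[of _ "LEAST k. n < ?L k"]) (simp add: p del: list_encode.simps)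
qed


section \<open>The algorithm\<close>

definition bit_lists :: "nat \<Rightarrow> nat list list" where
  "bit_lists s = rec_nat [[]] (\<lambda>_ l. map ((#) 0) l @ map ((#) 1) l) s"

lemma pr_bit_lists [pr_intros]: "pr s \<Longrightarrow> pr (\<lambda>x. bit_lists (s x))"
  unfolding bit_lists_def by (intro pr_intros)

lemma set_bit_lists: "set (bit_lists s) = {w. length w = s \<and> set w \<subseteq> {0, 1}}"
proof (induction s)
  case (Suc s)
  have "set (bit_lists (Suc s)) = (#) 0 ` set (bit_lists s) \<union> (#) 1 ` set (bit_lists s)"
    by (simp add: bit_lists_def)
  also have "\<dots> = {w. length w = Suc s \<and> set w \<subseteq> {0, 1}}"
    unfolding Suc by (auto simp: length_Suc_conv)
  finally show ?case .
qed (auto simp: bit_lists_def)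

lemma distinct_bit_lists: "distinct (bit_lists s)"
proof (induction s)
  case (Suc s)
  have "bit_lists (Suc s) = map ((#) 0) (bit_lists s) @ map ((#) 1) (bit_lists s)"
    by (simp add: bit_lists_def)
  then show ?case using Suc by (auto simp: distinct_map)
qed (simp add: bit_lists_def)

section \<open>Comparisons of rationals with cleared denominators\<close>

definition rat_pos :: "nat \<Rightarrow> nat" where "rat_pos e = fst (prod_decode (fst (prod_decode e)))"
definition rat_neg :: "nat \<Rightarrow> nat" where "rat_neg e = snd (prod_decode (fst (prod_decode e)))"
definition rat_den :: "nat \<Rightarrow> nat" where "rat_den e = Suc (snd (prod_decode e))"

lemma rat_number_eq: "rat_number e = (real (rat_pos e) - real (rat_neg e)) / real (rat_den e)"
  by (simp add: rat_number_def rat_pos_def rat_neg_def rat_den_def split_beta)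

lemma rat_den_pos: "0 < rat_den e"
  by (simp add: rat_den_def)

lemma pr_rat [pr_intros]:
  assumes "pr e"
  shows "pr (\<lambda>x. rat_pos (e x))" "pr (\<lambda>x. rat_neg (e x))" "pr (\<lambda>x. rat_den (e x))"
  unfolding rat_pos_def rat_neg_def rat_den_def by (intro pr_intros assms)+

text \<open>The inequality of \<open>near_iff\<close>, multiplied out so that only natural numbers
  occur. One of the three margins 2^-l absorbs the error of the name of the distance, the other two
  the errors of the \<open>l\<close>-th approximations of both random variables.\<close>

definition near :: "nat \<Rightarrow> nat \<Rightarrow> nat list \<Rightarrow> bool" where
  "near k l out \<longleftrightarrow> l < length out \<and>
    rat_pos (nthd 0 out l) * 2 ^ (k + l) + 3 * rat_den (nthd 0 out l) * 2 ^ k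
    < rat_den (nthd 0 out l) * 2 ^ l + rat_neg (nthd 0 out l) * 2 ^ (k + l)"

lemma pr_near [pr_intros]:
  assumes "pr k" "pr l" "pr r" shows "pr (\<lambda>x. near (k x) (l x) (r x))"
  unfolding near_def by (intro pr_intros assms)

lemma near_iff: "near k l out \<longleftrightarrow> l < length out \<and> rat_number (out ! l) < (1/2) ^ k - 3 * (1/2) ^ l"
proof -
  have "rat_pos e * 2 ^ (k + l) + 3 * rat_den e * 2 ^ k < rat_den e * 2 ^ l + rat_neg e * 2 ^ (k + l)
      \<longleftrightarrow> rat_number e < (1/2) ^ k - 3 * (1/2) ^ l" for e
  proof -
    have "rat_number e < (1/2) ^ k - 3 * (1/2) ^ l \<longleftrightarrow>
        real (rat_pos e) - real (rat_neg e) < ((1/2) ^ k - 3 * (1/2) ^ l) * rat_den e"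
      unfolding rat_number_eq using rat_den_pos[of e] by (simp add: divide_less_eq)
    also have "\<dots> \<longleftrightarrow> (real (rat_pos e) - real (rat_neg e)) * 2 ^ (k + l)
        < (((1/2) ^ k - 3 * (1/2) ^ l) * rat_den e) * 2 ^ (k + l)"
      by simp
    also have "(((1/2) ^ k - 3 * (1/2) ^ l) * rat_den e) * 2 ^ (k + l)
        = real (rat_den e) * 2 ^ l - 3 * real (rat_den e) * 2 ^ k"
      by (simp add: power_add power_one_over field_simps)
    also have "(real (rat_pos e) - real (rat_neg e)) * 2 ^ (k + l) < real (rat_den e) * 2 ^ l - 3 * real (rat_den e) * 2 ^ k
        \<longleftrightarrow> real (rat_pos e * 2 ^ (k + l) + 3 * rat_den e * 2 ^ k)
          < real (rat_den e * 2 ^ l + rat_neg e * 2 ^ (k + l))"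
      by (simp add: algebra_simps)
    finally show ?thesis by (simp only: of_nat_less_iff)
  qed
  then show ?thesis by (auto simp: near_def nthd_def)
qed

definition far :: "nat \<Rightarrow> nat list \<Rightarrow> bool" where
  "far m out \<longleftrightarrow> list_ex (\<lambda>e. rat_den e + rat_neg e * 2 ^ m < rat_pos e * 2 ^ m) out"

lemma pr_far [pr_intros]:
  assumes "pr m" "pr r" shows "pr (\<lambda>x. far (m x) (r x))"
  unfolding far_def by (intro pr_intros assms assms[THEN pr_compose])

lemma far_iff: "far m out \<longleftrightarrow> (\<exists>e\<in>set out. (1/2) ^ m < rat_number e)"
proof -
  have "rat_den e + rat_neg e * 2 ^ m < rat_pos e * 2 ^ m \<longleftrightarrow> (1/2) ^ m < rat_number e" for e
  proof -
    have "(1/2) ^ m < rat_number e \<longleftrightarrow> (1/2) ^ m * rat_den e < real (rat_pos e) - real (rat_neg e)"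
      unfolding rat_number_eq using rat_den_pos[of e] by (simp add: less_divide_eq)
    also have "\<dots> \<longleftrightarrow> (1/2) ^ m * rat_den e * 2 ^ m < (real (rat_pos e) - real (rat_neg e)) * 2 ^ m"
      by simp
    also have "(1/2) ^ m * rat_den e * 2 ^ m = real (rat_den e)"
      by (simp add: power_one_over)
    also have "real (rat_den e) < (real (rat_pos e) - real (rat_neg e)) * 2 ^ m
        \<longleftrightarrow> real (rat_den e + rat_neg e * 2 ^ m) < real (rat_pos e * 2 ^ m)"
      by (simp add: algebra_simps)
    finally show ?thesis by (simp only: of_nat_less_iff)
  qed
  then show ?thesis by (simp add: far_def list_ex_iff)
qed

text \<open>In what follows, the machine \<open>M\<close> computes the metric and \<open>N\<close> the distance to a closed set;
  \<open>a\<close> stands for a name of \<open>F\<close>, \<open>b\<close> for a name of a random state.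
  The prefix \<open>v\<close> of a name of a point \<open>y\<close> is accepted if it witnesses
  \<open>P (dist (F y) (F x) < 2\<^sup>-\<^sup>k) > 1 - 2\<^sup>-\<^sup>k\<close>, where \<open>x\<close> is named by \<open>g\<close>.\<close>

definition close :: "machine \<Rightarrow> nat \<Rightarrow> nat list \<Rightarrow> nat list \<Rightarrow> nat list \<Rightarrow> bool" where
  "close M k a g v \<longleftrightarrow> list_ex (\<lambda>l.
    2 ^ (k + l + length v) + 2 ^ (k + length v + 1) <
      length (filter (\<lambda>w. near k l (run M (pair_list
        (app_list (slice_list (app_list a v) l) w) (app_list (slice_list (app_list a g) l) w))))
        (bit_lists (length v))) * 2 ^ (k + l) + 2 ^ (l + length v)) [0..<length v]"

lemma pr_close [pr_intros]:
  assumes "pr k" "pr a" "pr g" "pr v" shows "pr (\<lambda>x. close M (k x) (a x) (g x) (v x))"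
  unfolding close_def by (intro pr_intros assms assms[THEN pr_compose])

text \<open>A name of the closed set of the points that are never accepted.\<close>

definition apart_val :: "machine \<Rightarrow> nat \<Rightarrow> nat list \<Rightarrow> nat list \<Rightarrow> nat \<Rightarrow> nat" where
  "apart_val M k a g c = (let v = tl (list_decode c) in
    if hdd 0 (list_decode c) \<le> length v
    then Suc (of_bool (close M k (take (length v) a) (take (length v) g) v)) else 0)"

text \<open>The list coded by \<open>c\<close> has at most \<open>c\<close> entries, so
  \<open>c\<close> entries of \<open>a\<close> and \<open>g\<close> suffice to answer the query
  \<open>c\<close>.\<close>

definition apart_name :: "machine \<Rightarrow> nat \<Rightarrow> name \<Rightarrow> name \<Rightarrow> name" where
  "apart_name M k a g c = apart_val M k (map a [0..<c]) (map g [0..<c]) c"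

definition apart_list :: "machine \<Rightarrow> nat \<Rightarrow> nat list \<Rightarrow> nat list \<Rightarrow> nat list" where
  "apart_list M k a g = map (apart_val M k a g) [0..<if length a \<le> length g then length a else length g]"

lemma pr_apart_list [pr_intros]:
  assumes "pr k" "pr a" "pr g" shows "pr (\<lambda>x. apart_list M (k x) (a x) (g x))"
  unfolding apart_list_def apart_val_def Let_def by (intro pr_intros assms assms[THEN pr_compose])

lemma apart_val_take:
  assumes "c \<le> n" "c \<le> n'"
  shows "apart_val M k (map a [0..<n]) (map g [0..<n']) c = apart_name M k a g c"
  using assms length_tl_list_decode[of c]
  by (simp add: apart_name_def apart_val_def Let_def take_map)

lemma tends_apart_list:
  assumes A: "tends A a" and B: "tends B g"
  shows "tends (\<lambda>j. apart_list M k (A j) (B j)) (apart_name M k a g)"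
proof (rule tendsI)
  fix j i assume "i < length (apart_list M k (A j) (B j))"
  then have i: "i < length (A j)" "i < length (B j)" by (auto simp: apart_list_def split: if_splits)
  then have "apart_list M k (A j) (B j) ! i = apart_val M k (A j) (B j) i"
    by (simp add: apart_list_def)
  also have "\<dots> = apart_val M k (map a [0..<length (A j)]) (map g [0..<length (B j)]) i"
    using tends_prefix[OF A] tends_prefix[OF B] by metis
  also have "\<dots> = apart_name M k a g i" using i by (intro apart_val_take) auto
  finally show "apart_list M k (A j) (B j) ! i = apart_name M k a g i" .
next
  fix n
  show "\<forall>\<^sub>F j in sequentially. n \<le> length (apart_list M k (A j) (B j))"
    using tends_length[OF A, of n] tends_length[OF B, of n]
    by eventually_elim (simp add: apart_list_def)
qed

text \<open>Tests whether \<open>F\<close> varies by less than \<open>2\<^sup>-\<^sup>k\<close> on the ball of radius \<open>2\<^sup>-\<^sup>m\<close> around the point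
  named by \<open>g\<close>.\<close>

definition steady :: "machine \<Rightarrow> machine \<Rightarrow> nat \<Rightarrow> nat \<Rightarrow> nat list \<Rightarrow> nat list \<Rightarrow> bool" where
  "steady M N m k a g \<longleftrightarrow> far m (run N (pair_list g (apart_list M k a g)))"

lemma pr_steady [pr_intros]:
  assumes "pr m" "pr k" "pr a" "pr g" shows "pr (\<lambda>x. steady M N (m x) (k x) (a x) (g x))"
  unfolding steady_def by (intro pr_intros assms)

text \<open>The inequality is that of \<open>count_iff'\<close>: the fraction of prefixes of length
  \<open>s\<close> that pass the test exceeds 1 - 2^-k.\<close>

definition precise :: "machine \<Rightarrow> machine \<Rightarrow> nat \<Rightarrow> nat list \<Rightarrow> nat list \<Rightarrow> nat \<Rightarrow> nat \<Rightarrow> bool" where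
  "precise M N k a b m s \<longleftrightarrow>
    2 ^ (k + s) < length (filter (\<lambda>w. steady M N m k (take s a) (app_list (slice_list (take s b) m) w))
      (bit_lists s)) * 2 ^ k + 2 ^ s"

lemma pr_precise [pr_intros]:
  assumes "pr k" "pr a" "pr b" "pr m" "pr s"
  shows "pr (\<lambda>x. precise M N (k x) (a x) (b x) (m x) (s x))"
  unfolding precise_def by (intro pr_intros assms assms[THEN pr_compose])

text \<open>The successes are listed by stage \<open>s\<close>, and stage \<open>s\<close> looks
  only at the first \<open>s\<close> entries of the names. Longer prefixes therefore only append to
  the list, and its head is final as soon as it exists. The lower bound \<open>k\<close> on the
  candidates makes the error 2^-m of the state at most 2^-k.\<close>

definition precisions :: "machine \<Rightarrow> machine \<Rightarrow> nat \<Rightarrow> nat list \<Rightarrow> nat list \<Rightarrow> nat list" where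
  "precisions M N k a b =
    concat (map (\<lambda>s. filter (\<lambda>m. precise M N k a b m s) [k..<s]) [0..<Suc (length b)])"

lemma pr_precisions [pr_intros]:
  assumes "pr k" "pr a" "pr b"
  shows "pr (\<lambda>x. precisions M N (k x) (a x) (b x))"
  unfolding precisions_def by (intro pr_intros assms assms[THEN pr_compose])

text \<open>Nothing is output before a precision has been found. The accuracy \<open>k + 2\<close>
  leaves room for four errors of size 2^-(k+2), which are added up in
  \<open>step_state_name\<close>.\<close>

definition next_list :: "machine \<Rightarrow> machine \<Rightarrow> nat \<Rightarrow> nat \<Rightarrow> nat list \<Rightarrow> nat list \<Rightarrow> nat list \<Rightarrow> nat list" where
  "next_list M N n k a b w = (if precisions M N (k + 2) a b = [] then [] else
    app_list (slice_list (app_list a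
      (app_list (slice_list b (hdd 0 (precisions M N (k + 2) a b))) w)) (k + 2)) (slice_list w (Suc n)))"

lemma pr_next_list [pr_intros]:
  assumes "pr n" "pr k" "pr a" "pr b" "pr w"
  shows "pr (\<lambda>x. next_list M N (n x) (k x) (a x) (b x) (w x))"
  unfolding next_list_def by (intro pr_intros assms)

text \<open>A name of a random variable at \<open>e = prod_encode (k, c)\<close> is the value at \<open>c\<close> of an associate of
  its \<open>k\<close>-th approximation.\<close>

definition step_val :: "machine \<Rightarrow> machine \<Rightarrow> nat \<Rightarrow> nat list \<Rightarrow> nat list \<Rightarrow> nat \<Rightarrow> nat" where
  "step_val M N n a b e = curry_val
    (\<lambda>w. next_list M N n (fst (prod_decode e)) (take (length w) a) (take (length w) b) w) (snd (prod_decode e))"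

definition step_name :: "machine \<Rightarrow> machine \<Rightarrow> nat \<Rightarrow> name \<Rightarrow> name \<Rightarrow> name" where
  "step_name M N n a b e = step_val M N n (map a [0..<e]) (map b [0..<e]) e"

definition init_val :: "nat list \<Rightarrow> nat \<Rightarrow> nat" where
  "init_val b e = curry_val
    (\<lambda>w. app_list (slice_list (take (length w) b) (fst (prod_decode e))) (slice_list w 0)) (snd (prod_decode e))"

definition init_name :: "name \<Rightarrow> name" where
  "init_name b e = init_val (map b [0..<e]) e"

definition level_list :: "machine \<Rightarrow> machine \<Rightarrow> nat list \<Rightarrow> nat list \<Rightarrow> nat \<Rightarrow> nat list" where
  "level_list M N a b n = rec_nat (map (init_val b) [0..<length b])
    (\<lambda>j r. map (step_val M N j a r) [0..<length b]) n"

definition level_name :: "machine \<Rightarrow> machine \<Rightarrow> name \<Rightarrow> name \<Rightarrow> nat \<Rightarrow> name" where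
  "level_name M N a b n = rec_nat (init_name b) (\<lambda>j r. step_name M N j a r) n"

lemma pr_init_val [pr_intros]:
  assumes "pr b" "pr e" shows "pr (\<lambda>x. init_val (b x) (e x))"
  unfolding init_val_def by (intro pr_curry_val pr_intros assms assms[THEN pr_compose])

lemma pr_step_val [pr_intros]:
  assumes "pr n" "pr a" "pr b" "pr e" shows "pr (\<lambda>x. step_val M N (n x) (a x) (b x) (e x))"
  unfolding step_val_def by (intro pr_curry_val pr_intros assms assms[THEN pr_compose])

lemma pr_level_list [pr_intros]:
  assumes "pr a" "pr b" "pr n" shows "pr (\<lambda>x. level_list M N (a x) (b x) (n x))"
  unfolding level_list_def by (intro pr_intros assms assms[THEN pr_compose])

section \<open>Dependence of the computed names on prefixes\<close>

lemma length_tl_list_decode_snd: "length (tl (list_decode (snd (prod_decode e)))) \<le> e"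
  using length_tl_list_decode[of "snd (prod_decode e)"] le_prod_encode_2[of "snd (prod_decode e)" "fst (prod_decode e)"]
  by simp

lemma step_val_take:
  assumes "e \<le> n" "e \<le> n'"
  shows "step_val M N j (map a [0..<n]) (map b [0..<n']) e = step_name M N j a b e"
  using assms length_tl_list_decode_snd[of e]
  by (simp add: step_name_def step_val_def curry_val_def take_map)

lemma init_val_take:
  assumes "e \<le> n"
  shows "init_val (map b [0..<n]) e = init_name b e"
  using assms length_tl_list_decode_snd[of e]
  by (simp add: init_name_def init_val_def curry_val_def take_map)

text \<open>The entry at \<open>e\<close> of each level depends on at most \<open>e\<close> entries
  of \<open>a\<close> and of the previous level, so no entries are lost in passing from one state to
  the next.\<close>

lemma level_list_prefix:
  "level_list M N (map a [0..<l]) (map b [0..<l]) n = map (level_name M N a b n) [0..<l]"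
proof (induction n)
  case 0
  then show ?case by (simp add: level_list_def level_name_def init_val_take)
next
  case (Suc n)
  then show ?case by (simp add: level_list_def level_name_def step_val_take)
qed



lemma associate_step_name:
  assumes "tends (\<lambda>s. next_list M N n k (map a [0..<s]) (map b [0..<s]) (map q [0..<s])) r"
  shows "associate (slice (step_name M N n a b) k) q r"
proof (rule associate_curry)
  show "tends (\<lambda>s. (\<lambda>w. next_list M N n k (map a [0..<length w]) (map b [0..<length w]) w) (map q [0..<s])) r"
    using assms by simp
  show "slice (step_name M N n a b) k c
      = curry_val (\<lambda>w. next_list M N n k (map a [0..<length w]) (map b [0..<length w]) w) c" for c
    using length_tl_list_decode_snd[of "prod_encode (k, c)"]
    by (simp add: slice_def step_name_def step_val_def curry_val_def take_map min_def)
qed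

lemma associate_init_name:
  assumes "associate (slice b k) (slice q 0) r"
  shows "associate (slice (init_name b) k) q r"
proof (rule associate_curry)
  have L: "tends (\<lambda>s. map p [0..<s]) p" for p
    by (rule tendsI) (auto simp: eventually_sequentially)
  show "tends (\<lambda>s. (\<lambda>w. app_list (slice_list (map b [0..<length w]) k) (slice_list w 0)) (map q [0..<s])) r"
    using tends_app_list[OF tends_slice_list[OF L] tends_slice_list[OF L] assms] by simp
  show "slice (init_name b) k c
      = curry_val (\<lambda>w. app_list (slice_list (map b [0..<length w]) k) (slice_list w 0)) c" for c
    using length_tl_list_decode_snd[of "prod_encode (k, c)"]
    by (simp add: slice_def init_name_def init_val_def curry_val_def take_map min_def)
qed

text \<open>The \<open>m\<close>-th approximation of the process has as its \<open>n\<close>-th component the approximation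
  of index \<open>m + n + 4\<close> of the \<open>n\<close>-th state.\<close>

definition output_index :: "nat \<Rightarrow> nat" where
  "output_index e = (let l = list_decode (snd (prod_decode e)) in
    prod_encode (fst (prod_decode e) + fst (prod_decode (hdd 0 l)) + 4,
      list_encode (snd (prod_decode (hdd 0 l)) # tl l)))"

definition output_level :: "nat \<Rightarrow> nat" where
  "output_level e = fst (prod_decode (hdd 0 (list_decode (snd (prod_decode e)))))"

definition output_name :: "machine \<Rightarrow> machine \<Rightarrow> name \<Rightarrow> name \<Rightarrow> name" where
  "output_name M N a b e = level_name M N a b (output_level e) (output_index e)"

text \<open>A query for entry \<open>(n, i)\<close> of the name of a sequence is passed on as a
  query for entry \<open>i\<close> to the name of the \<open>n\<close>-th state.\<close>

lemma associate_output_name: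
  assumes "\<And>n. associate (slice (level_name M N a b n) (m + n + 4)) q (slice r n)"
  shows "associate (slice (output_name M N a b) m) q r"
  unfolding associate_def
proof
  fix c
  obtain n i where c: "c = prod_encode (n, i)" by (metis prod_decode_inverse surj_pair)
  have "slice (output_name M N a b) m (list_encode (c # w))
      = slice (level_name M N a b n) (m + n + 4) (list_encode (i # w))" for w
    by (simp add: slice_def output_name_def output_level_def output_index_def c Let_def del: list_encode.simps)
  moreover have "r c = slice r n i" by (simp add: slice_def c)
  moreover have "\<exists>j. slice (level_name M N a b n) (m + n + 4) (list_encode (i # map q [0..<j])) = Suc (slice r n i) \<and>
      (\<forall>k<j. slice (level_name M N a b n) (m + n + 4) (list_encode (i # map q [0..<k])) = 0)"
    using assms[of n] unfolding associate_def by blast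
  ultimately show "\<exists>j. slice (output_name M N a b) m (list_encode (c # map q [0..<j])) = Suc (r c) \<and>
      (\<forall>k<j. slice (output_name M N a b) m (list_encode (c # map q [0..<k])) = 0)"
    by (simp del: list_encode.simps)
qed

text \<open>The formula for \<open>output_name\<close> makes sense on every point of Baire space, so
  the machine works for all \<open>p\<close>; whether its output names the process is a separate
  question.\<close>

theorem output_machine:
  "\<exists>K. type2_machine K \<and>
    (\<forall>p. transforms K p (output_name M N (\<lambda>n. p (2 * n)) (\<lambda>n. p (2 * n + 1))))"
proof -
  define ev where "ev \<sigma> = map (\<lambda>i. nthd 0 \<sigma> (2 * i)) [0..<length \<sigma> div 2]" for \<sigma> :: "nat list"
  define od where "od \<sigma> = map (\<lambda>i. nthd 0 \<sigma> (2 * i + 1)) [0..<length \<sigma> div 2]" for \<sigma> :: "nat list"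
  define \<Phi> where "\<Phi> \<sigma> e = (if output_index e < length (level_list M N (ev \<sigma>) (od \<sigma>) (output_level e))
    then Suc (nthd 0 (level_list M N (ev \<sigma>) (od \<sigma>) (output_level e)) (output_index e)) else 0)" for \<sigma> e
  have "pr (\<lambda>z. \<Phi> (fst z) (snd z))"
    unfolding \<Phi>_def ev_def od_def output_index_def output_level_def Let_def by (intro pr_intros)
  then obtain K where K: "type2_machine K"
    "\<And>p q. (\<And>j k. \<Phi> (map p [0..<k]) j \<in> {0, Suc (q j)}) \<Longrightarrow>
      (\<And>j. \<forall>\<^sub>F k in sequentially. \<Phi> (map p [0..<k]) j \<noteq> 0) \<Longrightarrow> transforms K p q"
    using pr_machine[of \<Phi>] by blast
  have "transforms K p (output_name M N (\<lambda>n. p (2 * n)) (\<lambda>n. p (2 * n + 1)))" for p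
  proof (rule K(2))
    let ?a = "\<lambda>n. p (2 * n)" and ?b = "\<lambda>n. p (2 * n + 1)"
    have ev: "ev (map p [0..<k]) = map ?a [0..<k div 2]" for k
      by (auto simp: ev_def nthd_def)
    have od: "od (map p [0..<k]) = map ?b [0..<k div 2]" for k
      by (auto simp: od_def nthd_def)
    have \<Phi>: "\<Phi> (map p [0..<k]) e = (if output_index e < k div 2 then Suc (output_name M N ?a ?b e) else 0)" for k e
      by (simp add: \<Phi>_def ev od level_list_prefix nthd_def output_name_def)
    show "\<Phi> (map p [0..<k]) j \<in> {0, Suc (output_name M N ?a ?b j)}" for j k
      by (simp add: \<Phi>)
    show "\<forall>\<^sub>F k in sequentially. \<Phi> (map p [0..<k]) j \<noteq> 0" for j
      using eventually_ge_at_top[of "2 * Suc (output_index j)"]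
      by eventually_elim (auto simp: \<Phi>)
  qed
  with K(1) show ?thesis by blast
qed


section \<open>The coin-tossing space\<close>

lemma prob_space_coin: "prob_space coin"
  unfolding coin_def by (intro prob_space_PiM measure_pmf.prob_space_axioms)

interpretation coin: prob_space coin by (rule prob_space_coin)

lemma space_coin [simp]: "space coin = UNIV"
  by (simp add: coin_def space_PiM)

text \<open>Used to identify the product sigma-algebra on the Cantor space with its Borel
  sets.\<close>

instance bool :: second_countable_topology
proof
  show "\<exists>B::bool set set. countable B \<and> open = generate_topology B"
    by (intro exI[of _ "range lessThan \<union> range greaterThan"]) (auto simp: open_bool_def)
qed

lemma emeasure_coin_UNIV [simp]: "emeasure coin UNIV = 1"
  using coin.emeasure_space_1 by simp

lemma sets_coin [measurable_cong]: "sets coin = sets borel"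
proof -
  have "sets coin = sets (PiM (UNIV :: nat set) (\<lambda>_. borel :: bool measure))"
    unfolding coin_def by (intro sets_PiM_cong) (simp_all add: sets_borel_eq_count_space)
  also have "\<dots> = sets borel" by (rule sets_PiM_equal_borel)
  finally show ?thesis .
qed

lemma borel_measurable_coin: "borel_measurable coin = borel_measurable borel"
  by (rule measurable_cong_sets) (simp_all add: sets_coin)

lemma emeasure_coin_Collect:
  assumes "finite J"
  shows "emeasure coin {\<omega>. \<forall>i\<in>J. \<omega> i \<in> X i} = (\<Prod>i\<in>J. emeasure (measure_pmf (bernoulli_pmf (1/2))) (X i))"
proof -
  interpret product_prob_space "\<lambda>_::nat. measure_pmf (bernoulli_pmf (1/2))" UNIV
    by unfold_locales
  show ?thesis
    using emeasure_PiM_Collect[of J X] assms by (simp add: coin_def space_PiM)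
qed

definition bits :: "cantor \<Rightarrow> name" where
  "bits \<omega> = (\<lambda>n. of_bool (\<omega> n))"

lemma cantor_rep_iff: "cantor_rep p \<omega> \<longleftrightarrow> p = bits \<omega>"
  by (auto simp: cantor_rep_def bits_def)

lemma slice_bits: "slice (bits \<omega>) n = bits (slice \<omega> n)"
  by (simp add: slice_def bits_def fun_eq_iff)

lemma bits_prefix_in: "map (bits \<omega>) [0..<s] \<in> set (bit_lists s)"
  by (auto simp: set_bit_lists bits_def)

lemma measure_cylinder:
  assumes "w \<in> set (bit_lists s)"
  shows "measure coin {\<omega>. map (bits \<omega>) [0..<s] = w} = (1/2) ^ s"
proof -
  have w: "length w = s" "\<And>i. i < s \<Longrightarrow> w ! i \<in> {0, 1}"
    using assms unfolding set_bit_lists by (auto simp: subset_iff)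
  have "{\<omega>. map (bits \<omega>) [0..<s] = w} = {\<omega>. \<forall>i\<in>{..<s}. \<omega> i \<in> {w ! i = 1}}"
  proof (intro Collect_cong)
    fix \<omega>
    have "bits \<omega> i = w ! i \<longleftrightarrow> \<omega> i \<in> {w ! i = 1}" if "i < s" for i
      using w(2)[OF that] by (cases "\<omega> i") (auto simp: bits_def)
    then show "map (bits \<omega>) [0..<s] = w \<longleftrightarrow> (\<forall>i\<in>{..<s}. \<omega> i \<in> {w ! i = 1})"
      using w(1) by (auto simp: list_eq_iff_nth_eq)
  qed
  also have "emeasure coin \<dots> = (\<Prod>i<s. emeasure (measure_pmf (bernoulli_pmf (1/2))) {w ! i = 1})"
    by (rule emeasure_coin_Collect) simp
  also have "\<dots> = (\<Prod>i<s. ennreal (1/2))"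
    by (intro prod.cong refl) (simp add: emeasure_pmf_single pmf_bernoulli_True pmf_bernoulli_False
        split: bool.split)
  also have "\<dots> = ennreal ((1/2) ^ s)"
    unfolding prod_constant card_lessThan by (rule ennreal_power) simp
  finally show ?thesis by (simp add: measure_def)
qed

lemma prefix_sets [measurable]: "{\<omega>. P (map (bits \<omega>) [0..<s])} \<in> sets coin"
proof -
  have "{\<omega>. P (map (bits \<omega>) [0..<s])} = (\<Union>w\<in>{w\<in>set (bit_lists s). P w}. {\<omega>. map (bits \<omega>) [0..<s] = w})"
    using bits_prefix_in by auto
  also have "\<dots> \<in> sets coin"
  proof (intro sets.finite_UN)
    fix w assume "w \<in> {w \<in> set (bit_lists s). P w}"
    \<comment> \<open>Non-measurable sets have \<open>measure\<close> zero by convention, so a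
      positive value proves measurability.\<close>
    then have "measure coin {\<omega>. map (bits \<omega>) [0..<s] = w} \<noteq> 0" by (simp add: measure_cylinder)
    then show "{\<omega>. map (bits \<omega>) [0..<s] = w} \<in> sets coin"
      by (metis measure_notin_sets)
  qed simp
  finally show ?thesis .
qed

lemma measure_prefix:
  "measure coin {\<omega>. P (map (bits \<omega>) [0..<s])} = length (filter P (bit_lists s)) / 2 ^ s"
proof -
  have "{\<omega>. P (map (bits \<omega>) [0..<s])} = (\<Union>w\<in>{w\<in>set (bit_lists s). P w}. {\<omega>. map (bits \<omega>) [0..<s] = w})"
    using bits_prefix_in by auto
  also have "measure coin \<dots> = (\<Sum>w\<in>{w\<in>set (bit_lists s). P w}. measure coin {\<omega>. map (bits \<omega>) [0..<s] = w})"
    by (rule coin.finite_measure_finite_Union) (auto simp: disjoint_family_on_def prefix_sets)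
  also have "\<dots> = card {w\<in>set (bit_lists s). P w} * (1/2) ^ s"
    by (simp add: measure_cylinder)
  also have "card {w\<in>set (bit_lists s). P w} = length (filter P (bit_lists s))"
    using distinct_card[of "filter P (bit_lists s)"] distinct_bit_lists by simp
  finally show ?thesis by (simp add: power_one_over divide_simps)
qed

text \<open>The points that pass the test at every stage from \<open>S\<close> on form sets that
  increase with \<open>S\<close> and cover \<open>E\<close>; continuity from below gives the claim.
  The test need not be monotone in the stage.\<close>

lemma measure_eventually_detected:
  assumes c: "c < measure coin E" and E: "E \<in> sets coin"
    and V: "\<And>\<omega>. \<omega> \<in> E \<Longrightarrow> \<forall>\<^sub>F s in sequentially. V s (map (bits \<omega>) [0..<s])"
  shows "\<forall>\<^sub>F s in sequentially. c < length (filter (V s) (bit_lists s)) / 2 ^ s"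
proof -
  define B where "B S = {\<omega>. \<forall>s\<ge>S. V s (map (bits \<omega>) [0..<s])}" for S
  have B_eq: "B S = (\<Inter>s\<in>{S..}. {\<omega>. V s (map (bits \<omega>) [0..<s])})" for S
    by (auto simp: B_def)
  have B_sets: "B S \<in> sets coin" for S
    unfolding B_eq by (intro sets.countable_INT') (auto simp: prefix_sets)
  have "incseq B" by (auto simp: incseq_def B_def)
  then have lim: "(\<lambda>S. measure coin (B S)) \<longlonglongrightarrow> measure coin (\<Union>S. B S)"
    by (intro coin.finite_Lim_measure_incseq) (auto simp: B_sets)
  have "E \<subseteq> (\<Union>S. B S)"
    using V by (auto simp: B_def eventually_sequentially)
  then have "measure coin E \<le> measure coin (\<Union>S. B S)"
    using B_sets by (intro coin.finite_measure_mono) auto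
  with c have "c < measure coin (\<Union>S. B S)" by simp
  from order_tendstoD(1)[OF lim this] show ?thesis
  proof eventually_elim
    case (elim s)
    have "measure coin (B s) \<le> measure coin {\<omega>. V s (map (bits \<omega>) [0..<s])}"
      by (intro coin.finite_measure_mono) (auto simp: B_def prefix_sets)
    with elim show ?case unfolding measure_prefix by simp
  qed
qed

definition merge_slice :: "nat \<Rightarrow> cantor \<Rightarrow> cantor \<Rightarrow> cantor" where
  "merge_slice n \<omega> \<omega>' i = (if fst (prod_decode i) = n then \<omega>' (snd (prod_decode i)) else \<omega> i)"

lemma slice_merge_slice: "slice (merge_slice n \<omega> \<omega>') m = (if m = n then \<omega>' else slice \<omega> m)"
  by (auto simp: slice_def merge_slice_def)

lemma measurable_coin_component [measurable]: "(\<lambda>\<omega>. \<omega> i) \<in> measurable coin (count_space UNIV)"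
proof -
  have "(\<lambda>\<omega>. \<omega> i) \<in> measurable coin (measure_pmf (bernoulli_pmf (1/2)))"
    unfolding coin_def by (rule measurable_component_singleton) simp
  then show ?thesis by (simp add: measurable_def)
qed

lemma measurable_into_coin:
  assumes "\<And>i. (\<lambda>x. f x i) \<in> measurable M (count_space UNIV)"
  shows "f \<in> measurable M coin"
proof -
  have "f \<in> measurable M (PiM UNIV (\<lambda>_. measure_pmf (bernoulli_pmf (1/2))))"
    by (rule measurable_PiM_single') (use assms in \<open>auto simp: measurable_def\<close>)
  then show ?thesis by (simp add: coin_def)
qed

lemma measurable_slice [measurable]: "(\<lambda>\<omega>. slice \<omega> n) \<in> measurable coin coin"
  by (rule measurable_into_coin) (simp add: slice_def)

lemma measurable_merge_slice [measurable]:
  "(\<lambda>(\<omega>, \<omega>'). merge_slice n \<omega> \<omega>') \<in> measurable (coin \<Otimes>\<^sub>M coin) coin"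
  by (rule measurable_into_coin) (simp add: merge_slice_def split_beta)

lemma coin_Collect_sets:
  assumes "finite J"
  shows "{\<omega>. \<forall>i\<in>J. \<omega> i \<in> X i} \<in> sets coin"
proof -
  have "{\<omega>\<in>space coin. \<omega> i \<in> X i} \<in> sets coin" for i
    using measurable_sets[OF measurable_coin_component[of i], of "X i"]
    by (simp add: vimage_def)
  then have "{\<omega>\<in>space coin. \<forall>i\<in>J. \<omega> i \<in> X i} \<in> sets coin"
    using assms by (intro sets.sets_Collect_finite_All) auto
  then show ?thesis by simp
qed

text \<open>Replacing one factor of the base space by an independent copy preserves the measure.
  This makes the fresh factor used by a transition accessible to Fubini's theorem. On a cylinder the
  coordinates split into those of factor \<open>n\<close> and the others.\<close>

lemma distr_merge_slice: "distr (coin \<Otimes>\<^sub>M coin) coin (\<lambda>(\<omega>, \<omega>'). merge_slice n \<omega> \<omega>') = coin" (is "?D = _")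
proof -
  interpret P: product_prob_space "\<lambda>_::nat. measure_pmf (bernoulli_pmf (1/2))" UNIV
    by unfold_locales
  let ?b = "measure_pmf (bernoulli_pmf (1/2))"
  have "?D = PiM UNIV (\<lambda>_::nat. ?b)"
  proof (rule P.PiM_eq)
    fix J :: "nat set" and F :: "nat \<Rightarrow> bool set" assume J: "finite J"
    define K where "K = {i\<in>J. fst (prod_decode i) = n}"
    have K: "finite K" "K \<subseteq> J" using J by (auto simp: K_def)
    let ?C = "{\<omega>. \<forall>i\<in>J. \<omega> i \<in> F i}"
    let ?A = "{\<omega>. \<forall>i\<in>J - K. \<omega> i \<in> F i}"
    let ?B = "{\<omega>. \<forall>j\<in>(\<lambda>i. snd (prod_decode i)) ` K. \<omega> j \<in> F (prod_encode (n, j))}"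
    have emb: "prod_emb UNIV (\<lambda>_::nat. ?b) J (Pi\<^sub>E J F) = ?C"
      by (auto simp: prod_emb_def PiE_iff)
    have C: "?C \<in> sets coin" and A: "?A \<in> sets coin" and B: "?B \<in> sets coin"
      using J K by (intro coin_Collect_sets; simp)+
    have K_inv: "prod_encode (n, snd (prod_decode i)) = i" if "i \<in> K" for i
      using that by (auto simp: K_def)
    have inj: "inj_on (\<lambda>i. snd (prod_decode i)) K"
      by (rule inj_onI) (metis K_inv)
    have "(\<lambda>(\<omega>, \<omega>'). merge_slice n \<omega> \<omega>') -` ?C \<inter> space (coin \<Otimes>\<^sub>M coin) = ?A \<times> ?B"
      by (auto simp: space_pair_measure merge_slice_def K_def split: if_splits)
        (metis prod.collapse prod_decode_inverse)+
    then have "emeasure ?D ?C = emeasure (coin \<Otimes>\<^sub>M coin) (?A \<times> ?B)"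
      using C by (simp add: emeasure_distr)
    also have "\<dots> = emeasure coin ?A * emeasure coin ?B"
      using A B by (rule coin.emeasure_pair_measure_Times)
    also have "emeasure coin ?A = (\<Prod>i\<in>J - K. emeasure ?b (F i))"
      using J by (intro emeasure_coin_Collect) simp
    also have "emeasure coin ?B = (\<Prod>j\<in>(\<lambda>i. snd (prod_decode i)) ` K. emeasure ?b (F (prod_encode (n, j))))"
      using K by (intro emeasure_coin_Collect) simp
    also have "\<dots> = (\<Prod>i\<in>K. emeasure ?b (F i))"
      unfolding prod.reindex[OF inj]
      using K_inv by (intro prod.cong refl) simp
    also have "(\<Prod>i\<in>J - K. emeasure ?b (F i)) * (\<Prod>i\<in>K. emeasure ?b (F i)) = (\<Prod>i\<in>J. emeasure ?b (F i))"
      using J K by (metis prod.subset_diff)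
    finally show "emeasure ?D (prod_emb UNIV (\<lambda>_::nat. ?b) J (Pi\<^sub>E J F)) = (\<Prod>i\<in>J. emeasure ?b (F i))"
      by (simp only: emb)
  qed (simp add: coin_def)
  then show ?thesis by (simp only: coin_def)
qed

lemma AE_merge_slice:
  assumes [measurable]: "Measurable.pred coin P"
    and "AE \<omega> in coin. AE \<omega>' in coin. P (merge_slice n \<omega> \<omega>')"
  shows "AE \<omega> in coin. P \<omega>"
proof -
  interpret C: pair_prob_space coin coin ..
  have "AE z in coin \<Otimes>\<^sub>M coin. P (case z of (\<omega>, \<omega>') \<Rightarrow> merge_slice n \<omega> \<omega>')"
    by (rule C.AE_pair_measure) (use assms(2) in simp_all)
  then have "AE \<omega> in distr (coin \<Otimes>\<^sub>M coin) coin (\<lambda>(\<omega>, \<omega>'). merge_slice n \<omega> \<omega>'). P \<omega>"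
    by (subst AE_distr_iff) (simp_all add: split_beta)
  then show ?thesis unfolding distr_merge_slice .
qed

text \<open>Fubini's theorem with factor \<open>n\<close> as the inner variable; over the
  exceptional set \<open>B\<close> the fibres are bounded by 1.\<close>

lemma measure_merge_slice_le:
  assumes E: "E \<in> sets coin" and B: "B \<in> sets coin"
    and "\<And>\<omega>. \<omega> \<notin> B \<Longrightarrow> measure coin {\<omega>'. merge_slice n \<omega> \<omega>' \<in> E} \<le> c" and "0 \<le> c"
  shows "measure coin E \<le> measure coin B + c"
proof -
  let ?m = "\<lambda>(\<omega>, \<omega>'). merge_slice n \<omega> \<omega>'"
  let ?E = "?m -` E \<inter> space (coin \<Otimes>\<^sub>M coin)"
  have [measurable]: "?E \<in> sets (coin \<Otimes>\<^sub>M coin)"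
    using E by (rule measurable_sets[OF measurable_merge_slice])
  have "emeasure coin E = emeasure (coin \<Otimes>\<^sub>M coin) ?E"
    using E by (subst distr_merge_slice[of n, symmetric]) (simp add: emeasure_distr)
  also have "\<dots> = (\<integral>\<^sup>+\<omega>. emeasure coin (Pair \<omega> -` ?E) \<partial>coin)"
    by (rule coin.emeasure_pair_measure_alt) simp
  also have "\<dots> \<le> (\<integral>\<^sup>+\<omega>. indicator B \<omega> + ennreal c \<partial>coin)"
  proof (rule nn_integral_mono)
    fix \<omega>
    have "Pair \<omega> -` ?E = {\<omega>'. merge_slice n \<omega> \<omega>' \<in> E}" by (auto simp: space_pair_measure)
    moreover have "emeasure coin {\<omega>'. merge_slice n \<omega> \<omega>' \<in> E} \<le> indicator B \<omega> + ennreal c"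
    proof (cases "\<omega> \<in> B")
      case True
      then show ?thesis
        using coin.emeasure_le_1[of "{\<omega>'. merge_slice n \<omega> \<omega>' \<in> E}"]
        by (simp add: add_increasing2)
    next
      case False
      then show ?thesis
        using assms(3)[of \<omega>] by (simp add: coin.emeasure_eq_measure ennreal_leI)
    qed
    ultimately show "emeasure coin (Pair \<omega> -` ?E) \<le> indicator B \<omega> + ennreal c" by simp
  qed
  also have "\<dots> = emeasure coin B + ennreal c"
    using B by (simp add: nn_integral_add)
  finally show ?thesis
    using \<open>0 \<le> c\<close> by (simp add: coin.emeasure_eq_measure flip: ennreal_plus)
qed

lemma measure_slice:
  assumes E: "E \<in> sets coin"
  shows "measure coin {\<omega>. slice \<omega> n \<in> E} = measure coin E"
proof -
  have "emeasure coin {\<omega>. slice \<omega> n \<in> E}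
      = emeasure (distr (coin \<Otimes>\<^sub>M coin) coin (\<lambda>(\<omega>, \<omega>'). merge_slice n \<omega> \<omega>')) {\<omega>. slice \<omega> n \<in> E}"
    by (simp add: distr_merge_slice)
  also have "\<dots> = emeasure (coin \<Otimes>\<^sub>M coin) (UNIV \<times> E)"
  proof (subst emeasure_distr)
    show "{\<omega>. slice \<omega> n \<in> E} \<in> sets coin"
      using measurable_sets[OF measurable_slice E] by (simp add: vimage_def)
    have "(\<lambda>(\<omega>, \<omega>'). merge_slice n \<omega> \<omega>') -` {\<omega>. slice \<omega> n \<in> E} \<inter> space (coin \<Otimes>\<^sub>M coin) = UNIV \<times> E"
      by (auto simp: space_pair_measure slice_merge_slice)
    then show "emeasure (coin \<Otimes>\<^sub>M coin) ((\<lambda>(\<omega>, \<omega>'). merge_slice n \<omega> \<omega>') -` {\<omega>. slice \<omega> n \<in> E} \<inter> space (coin \<Otimes>\<^sub>M coin))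
        = emeasure (coin \<Otimes>\<^sub>M coin) (UNIV \<times> E)" by simp
  qed simp
  also have "\<dots> = emeasure coin E"
    using E coin.emeasure_space_1 by (subst coin.emeasure_pair_measure_Times) (auto simp flip: space_coin)
  finally show ?thesis by (simp add: measure_def)
qed


section \<open>Random variables and their approximations\<close>

lemma version_AE:
  assumes "version x X" "version y X"
  shows "AE \<omega> in coin. x \<omega> = y \<omega>"
proof -
  have "rv_eq x x \<and> rv_eq y y \<and> abs_rv x = abs_rv y"
    using assms by (auto simp: version_def rv_eq_def)
  then have "rv_eq x y" using Quotient3_rel[OF Quotient3_rv] by blast
  then show ?thesis by (simp add: rv_eq_def)
qed

lemma version_cong:
  assumes "version x X" "y \<in> borel_measurable coin" "AE \<omega> in coin. x \<omega> = y \<omega>"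
  shows "version y X"
proof -
  have "rv_eq x y" using assms by (auto simp: version_def rv_eq_def)
  then have "abs_rv x = abs_rv y" using Quotient3_rel[OF Quotient3_rv] by blast
  then show ?thesis using assms by (simp add: version_def)
qed

lemma version_ex: "\<exists>x. version x X"
proof -
  have "rv_eq (rep_rv X) (rep_rv X)" by (rule Quotient3_rep_reflp[OF Quotient3_rv])
  moreover have "abs_rv (rep_rv X) = X" by (rule Quotient3_abs_rep[OF Quotient3_rv])
  ultimately show ?thesis by (auto simp: version_def rv_eq_def)
qed

lemma version_abs_rv: "x \<in> borel_measurable coin \<Longrightarrow> version x (abs_rv x)"
  by (simp add: version_def)

lemma fan_dist_nonneg: "0 \<le> fan_dist d x y"
  unfolding fan_dist_def
proof (rule cInf_greatest)
  show "{\<epsilon>. \<epsilon> \<in> \<rat> \<and> 0 < \<epsilon> \<and> measure coin {\<omega> \<in> space coin. \<epsilon> \<le> d (x \<omega>) (y \<omega>)} < \<epsilon>} \<noteq> {}"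
    using coin.prob_le_1 by (auto intro!: exI[of _ 2] intro: le_less_trans)
qed auto

lemma fan_dist_lessD:
  assumes "fan_dist d x y < \<eta>" "\<And>\<epsilon>. {\<omega>. \<epsilon> \<le> d (x \<omega>) (y \<omega>)} \<in> sets coin"
  shows "measure coin {\<omega>. \<eta> \<le> d (x \<omega>) (y \<omega>)} < \<eta>"
proof -
  have "{\<epsilon>. \<epsilon> \<in> \<rat> \<and> 0 < \<epsilon> \<and> measure coin {\<omega> \<in> space coin. \<epsilon> \<le> d (x \<omega>) (y \<omega>)} < \<epsilon>} \<noteq> {}"
    using coin.prob_le_1 by (auto intro!: exI[of _ 2] intro: le_less_trans)
  from cInf_lessD[OF this assms(1)[unfolded fan_dist_def]]
  obtain \<epsilon> where \<epsilon>: "measure coin {\<omega>. \<epsilon> \<le> d (x \<omega>) (y \<omega>)} < \<epsilon>" "\<epsilon> < \<eta>" by auto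
  have "measure coin {\<omega>. \<eta> \<le> d (x \<omega>) (y \<omega>)} \<le> measure coin {\<omega>. \<epsilon> \<le> d (x \<omega>) (y \<omega>)}"
    using \<epsilon> assms(2) by (intro coin.finite_measure_mono) auto
  with \<epsilon> show ?thesis by simp
qed

lemma fan_dist_le:
  assumes "\<epsilon> \<in> \<rat>" "0 < \<epsilon>" "measure coin {\<omega>. \<epsilon> \<le> d (x \<omega>) (y \<omega>)} < \<epsilon>"
  shows "fan_dist d x y \<le> \<epsilon>"
  unfolding fan_dist_def
  by (rule cInf_lower) (use assms in \<open>auto intro: bdd_belowI[of _ 0]\<close>)

lemma dist_sets:
  fixes x y :: "cantor \<Rightarrow> 'a::{metric_space, second_countable_topology}"
  assumes [measurable]: "x \<in> borel_measurable coin" "y \<in> borel_measurable coin"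
  shows "{\<omega>. e \<le> dist (x \<omega>) (y \<omega>)} \<in> sets coin" "{\<omega>. e < dist (x \<omega>) (y \<omega>)} \<in> sets coin"
    "{\<omega>. dist (x \<omega>) (y \<omega>) < e} \<in> sets coin"
proof -
  have "{\<omega>\<in>space coin. e \<le> dist (x \<omega>) (y \<omega>)} \<in> sets coin" "{\<omega>\<in>space coin. e < dist (x \<omega>) (y \<omega>)} \<in> sets coin"
    "{\<omega>\<in>space coin. dist (x \<omega>) (y \<omega>) < e} \<in> sets coin"
    by measurable
  then show "{\<omega>. e \<le> dist (x \<omega>) (y \<omega>)} \<in> sets coin" "{\<omega>. e < dist (x \<omega>) (y \<omega>)} \<in> sets coin"
    "{\<omega>. dist (x \<omega>) (y \<omega>) < e} \<in> sets coin" by simp_all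
qed

lemma measure_less_compl:
  fixes x y :: "cantor \<Rightarrow> 'a::{metric_space, second_countable_topology}"
  assumes "x \<in> borel_measurable coin" "y \<in> borel_measurable coin"
  shows "measure coin {\<omega>. e \<le> dist (x \<omega>) (y \<omega>)} = 1 - measure coin {\<omega>. dist (x \<omega>) (y \<omega>) < e}"
  using coin.prob_compl[OF dist_sets(3)[OF assms, of e]]
  by (simp add: Compl_eq_Diff_UNIV[symmetric] Collect_neg_eq[symmetric] not_less)

text \<open>The sets for \<open>\<delta> = 1 / (j + 1)\<close> increase to the set without
  \<open>\<delta>\<close>.\<close>

lemma measure_less_leI:
  fixes g :: "cantor \<Rightarrow> real"
  assumes [measurable]: "g \<in> borel_measurable coin"
    and "\<And>\<delta>. 0 < \<delta> \<Longrightarrow> measure coin {\<omega>. e + \<delta> < g \<omega>} \<le> c"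
  shows "measure coin {\<omega>. e < g \<omega>} \<le> c"
proof -
  define B where "B j = {\<omega>. e + 1 / real (Suc j) < g \<omega>}" for j
  have sets: "B j \<in> sets coin" for j
  proof -
    have "{\<omega>\<in>space coin. e + 1 / real (Suc j) < g \<omega>} \<in> sets coin" by measurable
    then show ?thesis by (simp add: B_def)
  qed
  have "incseq B"
  proof (intro incseq_SucI subsetI)
    fix j \<omega> assume "\<omega> \<in> B j"
    moreover have "1 / real (Suc (Suc j)) \<le> 1 / real (Suc j)" by (intro divide_left_mono) auto
    ultimately show "\<omega> \<in> B (Suc j)" unfolding B_def by simp
  qed
  then have "(\<lambda>j. measure coin (B j)) \<longlonglongrightarrow> measure coin (\<Union>j. B j)"
    by (intro coin.finite_Lim_measure_incseq) (auto simp: sets)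
  moreover have "(\<Union>j. B j) = {\<omega>. e < g \<omega>}"
  proof (intro set_eqI iffI)
    fix \<omega> assume "\<omega> \<in> {\<omega>. e < g \<omega>}"
    then obtain j where "1 / real (Suc j) < g \<omega> - e"
      using reals_Archimedean[of "g \<omega> - e"] by (auto simp: inverse_eq_divide)
    then show "\<omega> \<in> (\<Union>j. B j)" by (auto simp: B_def algebra_simps intro!: exI[of _ j])
  next
    fix \<omega> assume "\<omega> \<in> (\<Union>j. B j)"
    then obtain j where "e + 1 / real (Suc j) < g \<omega>" by (auto simp: B_def)
    moreover have "0 < 1 / real (Suc j)" by simp
    ultimately show "\<omega> \<in> {\<omega>. e < g \<omega>}" unfolding mem_Collect_eq by linarith
  qed
  ultimately have "(\<lambda>j. measure coin (B j)) \<longlonglongrightarrow> measure coin {\<omega>. e < g \<omega>}" by simp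
  then show ?thesis
    by (rule LIMSEQ_le_const2) (use assms(2) in \<open>auto simp: B_def intro!: exI[of _ 0]\<close>)
qed

lemma measure_dist_triangle:
  fixes x y z :: "cantor \<Rightarrow> 'a::{metric_space, second_countable_topology}"
  assumes "x \<in> borel_measurable coin" "y \<in> borel_measurable coin" "z \<in> borel_measurable coin"
  shows "measure coin {\<omega>. e + d < dist (x \<omega>) (z \<omega>)}
    \<le> measure coin {\<omega>. e < dist (x \<omega>) (y \<omega>)} + measure coin {\<omega>. d < dist (y \<omega>) (z \<omega>)}"
proof -
  have "{\<omega>. e + d < dist (x \<omega>) (z \<omega>)} \<subseteq> {\<omega>. e < dist (x \<omega>) (y \<omega>)} \<union> {\<omega>. d < dist (y \<omega>) (z \<omega>)}"
  proof
    fix \<omega> assume "\<omega> \<in> {\<omega>. e + d < dist (x \<omega>) (z \<omega>)}"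
    then show "\<omega> \<in> {\<omega>. e < dist (x \<omega>) (y \<omega>)} \<union> {\<omega>. d < dist (y \<omega>) (z \<omega>)}"
      using dist_triangle[of "x \<omega>" "z \<omega>" "y \<omega>"] by auto
  qed
  then have "measure coin {\<omega>. e + d < dist (x \<omega>) (z \<omega>)}
      \<le> measure coin ({\<omega>. e < dist (x \<omega>) (y \<omega>)} \<union> {\<omega>. d < dist (y \<omega>) (z \<omega>)})"
    using assms by (intro coin.finite_measure_mono sets.Un dist_sets) auto
  also have "\<dots> \<le> measure coin {\<omega>. e < dist (x \<omega>) (y \<omega>)} + measure coin {\<omega>. d < dist (y \<omega>) (z \<omega>)}"
    using assms by (intro measure_Un_le dist_sets)
  finally show ?thesis .
qed

text \<open>The Fan bound between \<open>Z m\<close> and \<open>Z n\<close> is combined with the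
  convergence of \<open>Z n\<close> to the random variable. The limit turns the bound into a strict
  inequality inside the event and a weak one outside, the form of all error bounds that
  follow.\<close>

lemma rv_rep_approx:
  fixes \<delta> :: "'a::{metric_space, second_countable_topology} rep"
  assumes p: "rv_rep \<delta> dist p X" and f: "version f X"
  shows "\<exists>Z. \<forall>m. Z m \<in> borel_measurable coin \<and> exp_rep cantor_rep \<delta> (slice p m) (Z m) \<and>
    measure coin {\<omega>. (1/2) ^ m < dist (Z m \<omega>) (f \<omega>)} \<le> (1/2) ^ m"
proof -
  obtain Z x where Z: "\<And>m. continuous_on UNIV (Z m)" "\<And>m. exp_rep cantor_rep \<delta> (slice p m) (Z m)"
      "\<And>m n. fan_dist dist (Z m) (Z n) < (1/2) ^ min m n" "version x X"
      "(\<lambda>m. fan_dist dist (Z m) x) \<longlonglongrightarrow> 0"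
    using p unfolding rv_rep_def by blast
  have m: "Z m \<in> borel_measurable coin" "x \<in> borel_measurable coin" "f \<in> borel_measurable coin" for m
    using Z(1,4) f by (auto simp: borel_measurable_coin version_def intro: borel_measurable_continuous_onI)
  have "measure coin {\<omega>. (1/2) ^ m < dist (Z m \<omega>) (f \<omega>)} \<le> (1/2) ^ m" for m
  proof -
    have [measurable]: "Z m \<in> borel_measurable coin" "x \<in> borel_measurable coin" "f \<in> borel_measurable coin"
      using m by blast+
    have "measure coin {\<omega>. (1/2) ^ m < dist (Z m \<omega>) (x \<omega>)} \<le> (1/2) ^ m"
    proof (rule measure_less_leI)
      fix \<delta> :: real assume "0 < \<delta>"
      show "measure coin {\<omega>. (1/2) ^ m + \<delta> < dist (Z m \<omega>) (x \<omega>)} \<le> (1/2) ^ m"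
      proof (rule field_le_epsilon)
        fix e :: real assume "0 < e"
        \<comment> \<open>\<open>\<eta>\<close> bounds a distance, by \<open>\<delta>\<close>, and a
          probability, by \<open>e\<close>.\<close>
        define \<eta> where "\<eta> = min \<delta> e"
        have "0 < \<eta>" using \<open>0 < \<delta>\<close> \<open>0 < e\<close> by (simp add: \<eta>_def)
        from order_tendstoD(2)[OF Z(5) this]
        obtain n where n: "m \<le> n" "fan_dist dist (Z n) x < \<eta>"
          by (metis (mono_tags, lifting) eventually_sequentially le_cases order_refl)
        have "measure coin {\<omega>. (1/2) ^ m \<le> dist (Z m \<omega>) (Z n \<omega>)} < (1/2) ^ m"
          using Z(3)[of m n] n(1) m by (intro fan_dist_lessD) (auto simp: min_def intro: dist_sets)
        moreover have "measure coin {\<omega>. \<eta> \<le> dist (Z n \<omega>) (x \<omega>)} < \<eta>"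
          using n(2) m by (intro fan_dist_lessD) (auto intro: dist_sets)
        moreover have "measure coin {\<omega>. (1/2) ^ m < dist (Z m \<omega>) (Z n \<omega>)} \<le> measure coin {\<omega>. (1/2) ^ m \<le> dist (Z m \<omega>) (Z n \<omega>)}"
          using m by (intro coin.finite_measure_mono dist_sets) auto
        moreover have "measure coin {\<omega>. \<delta> < dist (Z n \<omega>) (x \<omega>)} \<le> measure coin {\<omega>. \<eta> \<le> dist (Z n \<omega>) (x \<omega>)}"
          using m by (intro coin.finite_measure_mono dist_sets) (auto simp: \<eta>_def)
        moreover have "\<eta> \<le> e" by (simp add: \<eta>_def)
        ultimately show "measure coin {\<omega>. (1/2) ^ m + \<delta> < dist (Z m \<omega>) (x \<omega>)} \<le> (1/2) ^ m + e"
          using measure_dist_triangle[OF m(1)[of m] m(1)[of n] m(2), of "(1/2) ^ m" \<delta>] by linarith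
      qed
    qed measurable
    also have "measure coin {\<omega>. (1/2) ^ m < dist (Z m \<omega>) (x \<omega>)} = measure coin {\<omega>. (1/2) ^ m < dist (Z m \<omega>) (f \<omega>)}"
    proof (rule measure_eq_AE)
      show "AE \<omega> in coin. \<omega> \<in> {\<omega>. (1/2) ^ m < dist (Z m \<omega>) (x \<omega>)} \<longleftrightarrow> \<omega> \<in> {\<omega>. (1/2) ^ m < dist (Z m \<omega>) (f \<omega>)}"
        using version_AE[OF Z(4) f] by eventually_elim simp
    qed (use m in \<open>auto intro: dist_sets\<close>)
    finally show ?thesis .
  qed
  with m Z(2) show ?thesis by blast
qed


section \<open>Correctness of the algorithm\<close>

lemma tends_prefixes: "tends (\<lambda>s. map p [0..<s]) p"
  by (rule tendsI) (auto simp: eventually_sequentially)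

lemma dist_triangle4: "dist u v \<le> dist x u + dist x y + dist y v"
  using dist_triangle[of u v x] dist_triangle[of x v y] by (simp add: dist_commute)

lemma tends_guard:
  assumes L: "tends L q" and P: "\<forall>\<^sub>F k in sequentially. P k"
  shows "tends (\<lambda>k. if P k then L k else []) q"
proof (rule tendsI)
  show "i < length (if P k then L k else []) \<Longrightarrow> (if P k then L k else []) ! i = q i" for k i
    using tends_nth[OF L] by (auto split: if_splits)
  show "\<forall>\<^sub>F k in sequentially. n \<le> length (if P k then L k else [])" for n
    using tends_length[OF L, of n] P by eventually_elim simp
qed

section \<open>Topology of represented spaces\<close>

lemma open_prefix: "open {q :: name. \<forall>i<n. q i = p i}"
proof -
  have "{q :: name. \<forall>i<n. q i = p i} = (\<Inter>i\<in>{..<n}. (\<lambda>q. q i) -` {p i})" by auto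
  also have "open \<dots>"
    by (intro open_INT ballI open_vimage continuous_on_product_coordinates)
      (auto simp: Topological_Spaces.open_discrete)
  finally show ?thesis .
qed

text \<open>Each value is settled by the bits read up to the first positive answer, hence locally
  constant.\<close>

lemma continuous_on_associate:
  assumes "\<And>\<omega>. associate p (bits \<omega>) (G \<omega>)"
  shows "continuous_on UNIV G"
proof (rule continuous_on_coordinatewise_then_product)
  fix n
  have "((\<lambda>\<omega>. G \<omega> n) \<longlongrightarrow> G \<omega> n) (at \<omega>)" for \<omega>
  proof -
    obtain m where m: "p (list_encode (n # map (bits \<omega>) [0..<m])) = Suc (G \<omega> n)"
        "\<forall>k<m. p (list_encode (n # map (bits \<omega>) [0..<k])) = 0"
      using assms[of \<omega>] unfolding associate_def by blast
    have "\<forall>\<^sub>F \<omega>' in at \<omega>. \<omega>' i = \<omega> i" for i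
    proof -
      have "continuous_on UNIV (\<lambda>\<omega> :: cantor. \<omega> i)" by simp
      then show ?thesis unfolding continuous_on_def tendsto_discrete by simp
    qed
    then have "\<forall>\<^sub>F \<omega>' in at \<omega>. \<forall>i\<in>{..<m}. \<omega>' i = \<omega> i"
      by (intro eventually_ball_finite) auto
    then have "\<forall>\<^sub>F \<omega>' in at \<omega>. G \<omega>' n = G \<omega> n"
    proof eventually_elim
      case (elim \<omega>')
      have pre: "map (bits \<omega>') [0..<k] = map (bits \<omega>) [0..<k]" if "k \<le> m" for k
        using elim that by (auto simp: bits_def)
      obtain m' where m': "p (list_encode (n # map (bits \<omega>') [0..<m'])) = Suc (G \<omega>' n)"
          "\<forall>k<m'. p (list_encode (n # map (bits \<omega>') [0..<k])) = 0"
        using assms[of \<omega>'] unfolding associate_def by blast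
      have "m' = m"
        using m m' pre by (metis le_eq_less_or_eq linorder_neqE_nat nat.distinct(1))
      then show ?case using m(1) m'(1) pre[of m] by simp
    qed
    then show ?thesis by (simp add: tendsto_discrete)
  qed
  then show "continuous_on UNIV (\<lambda>\<omega>. G \<omega> n)" by (simp add: continuous_on_def)
qed

lemma rep_unique: "admissible_quotient_rep \<delta> \<Longrightarrow> \<delta> p x \<Longrightarrow> \<delta> p y \<Longrightarrow> x = y"
  unfolding admissible_quotient_rep_def by blast

lemma rep_THE: "admissible_quotient_rep \<delta> \<Longrightarrow> \<delta> p x \<Longrightarrow> (THE x. \<delta> p x) = x"
  by (rule the_equality) (auto intro: rep_unique)

lemma rep_surj:
  assumes "admissible_quotient_rep \<delta>"
  shows "\<exists>p. \<delta> p x"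
proof -
  have "(\<lambda>p. THE x. \<delta> p x) ` {p. \<exists>x. \<delta> p x} = UNIV"
    using assms unfolding admissible_quotient_rep_def quotient_map_def by simp
  then obtain p y where "x = (THE x. \<delta> p x)" "\<delta> p y" by blast
  then show ?thesis using rep_THE[OF assms] by metis
qed

text \<open>\<open>W\<close> is the continuous \<open>G\<close> followed by the quotient map of the
  representation. All approximations constructed by the algorithm obtain their continuity and
  measurability in this way.\<close>

lemma continuous_on_realizer:
  assumes adm: "admissible_quotient_rep \<delta>"
    and G: "\<And>\<omega>. associate p (bits \<omega>) (G \<omega>)" "\<And>\<omega>. \<delta> (G \<omega>) (W \<omega>)"
  shows "continuous_on UNIV W"
proof -
  let ?D = "{p. \<exists>x. \<delta> p x}"
  have "quotient_map (top_of_set ?D) euclidean (\<lambda>p. THE x. \<delta> p x)"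
    using adm unfolding admissible_quotient_rep_def by blast
  then have "continuous_map (top_of_set ?D) euclidean (\<lambda>p. THE x. \<delta> p x)"
    by (rule quotient_imp_continuous_map)
  then have "continuous_on ?D (\<lambda>p. THE x. \<delta> p x)" by simp
  then have "continuous_on UNIV (\<lambda>\<omega>. THE x. \<delta> (G \<omega>) x)"
    using G(2) by (intro continuous_on_compose2[OF _ continuous_on_associate[OF G(1)]]) auto
  moreover have "(\<lambda>\<omega>. THE x. \<delta> (G \<omega>) x) = W"
    using rep_THE[OF adm G(2)] by auto
  ultimately show ?thesis by (simp only:)
qed

text \<open>By the quotient property openness can be checked on names: membership in
  \<open>U\<close> has to be confirmed by a finite prefix of each name of a member.\<close>

lemma open_rep:
  assumes adm: "admissible_quotient_rep \<delta>"
    and U: "\<And>v x. \<delta> v x \<Longrightarrow> x \<in> U \<Longrightarrow> \<exists>n. \<forall>v' x'. \<delta> v' x' \<longrightarrow> (\<forall>i<n. v' i = v i) \<longrightarrow> x' \<in> U"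
  shows "open U"
proof -
  let ?D = "{p. \<exists>x. \<delta> p x}"
  let ?f = "\<lambda>p. THE x. \<delta> p x"
  have q: "openin (top_of_set ?D) {p \<in> ?D. ?f p \<in> U} \<longleftrightarrow> open U"
    using adm unfolding admissible_quotient_rep_def quotient_map_def by simp
  define n where "n v = (SOME n. \<forall>v' x'. \<delta> v' x' \<longrightarrow> (\<forall>i<n. v' i = v i) \<longrightarrow> x' \<in> U)" for v
  have n: "x' \<in> U" if "\<delta> v x" "x \<in> U" "\<delta> v' x'" "\<forall>i<n v. v' i = v i" for v x v' x'
    using someI_ex[OF U[OF that(1,2)]] that(3,4) unfolding n_def by blast
  define T where "T = (\<Union>v\<in>{v. \<exists>x. \<delta> v x \<and> x \<in> U}. {v'. \<forall>i<n v. v' i = v i})"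
  have "open T" unfolding T_def by (intro open_UN ballI open_prefix)
  moreover have "{p \<in> ?D. ?f p \<in> U} = ?D \<inter> T"
  proof (intro set_eqI iffI)
    fix p assume "p \<in> {p \<in> ?D. ?f p \<in> U}"
    then obtain x where x: "\<delta> p x" "?f p \<in> U" by blast
    then have "x \<in> U" using rep_THE[OF adm x(1)] by simp
    then show "p \<in> ?D \<inter> T" using x by (auto simp: T_def)
  next
    fix p assume "p \<in> ?D \<inter> T"
    then obtain x v y where x: "\<delta> p x" and "\<delta> v y" "y \<in> U" "\<forall>i<n v. p i = v i" by (auto simp: T_def)
    have "x \<in> U" by (rule n[OF \<open>\<delta> v y\<close> \<open>y \<in> U\<close> x]) fact
    then show "p \<in> {p \<in> ?D. ?f p \<in> U}"
      unfolding mem_Collect_eq rep_THE[OF adm x] using x by blast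
  qed
  moreover from \<open>open T\<close> have "openin (top_of_set ?D) (?D \<inter> T)" by (rule openin_open_Int)
  ultimately show ?thesis using q by (simp only:)
qed

text \<open>A point of the Cantor space has only one name, so that names of the values can be chosen
  as a function of the point.\<close>

lemma exp_rep_cantor:
  "exp_rep cantor_rep \<delta> p Z \<longleftrightarrow> (\<exists>G. \<forall>\<omega>. associate p (bits \<omega>) (G \<omega>) \<and> \<delta> (G \<omega>) (Z \<omega>))"
proof -
  have "exp_rep cantor_rep \<delta> p Z \<longleftrightarrow> (\<forall>\<omega>. \<exists>r. associate p (bits \<omega>) r \<and> \<delta> r (Z \<omega>))"
    unfolding exp_rep_def cantor_rep_iff by blast
  then show ?thesis unfolding choice_iff .
qed

text \<open>The counting condition in \<open>close\<close>. The excess 2 * 2^-l over 1 - 2^-k pays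
  for the two events, of probability at most 2^-l each, on which an \<open>l\<close>-th
  approximation is off by more than 2^-l.\<close>

lemma count_iff:
  "2 ^ (k + l + s) + 2 ^ (k + s + 1) < n * 2 ^ (k + l) + 2 ^ (l + s)
    \<longleftrightarrow> 1 - (1/2) ^ k + 2 * (1/2) ^ l < real n / 2 ^ s" for n :: nat
proof -
  have "1 - (1/2) ^ k + 2 * (1/2) ^ l < real n / 2 ^ s \<longleftrightarrow>
      (1 - (1/2) ^ k + 2 * (1/2) ^ l) * 2 ^ (k + l + s) < real n / 2 ^ s * (2 ^ (k + l + s) :: real)"
    by (rule mult_less_cancel_right_pos[symmetric]) simp
  also have "(1 - (1/2) ^ k + 2 * (1/2) ^ l) * 2 ^ (k + l + s) = (2 ^ (k + l + s) - 2 ^ (l + s) + 2 ^ (k + s + 1) :: real)"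
    by (simp add: power_add power_one_over field_simps)
  also have "real n / 2 ^ s * 2 ^ (k + l + s) = real n * 2 ^ (k + l)"
    by (simp add: power_add field_simps)
  also have "(2 ^ (k + l + s) - 2 ^ (l + s) + 2 ^ (k + s + 1) < real n * 2 ^ (k + l))
      \<longleftrightarrow> real (2 ^ (k + l + s) + 2 ^ (k + s + 1)) < real (n * 2 ^ (k + l) + 2 ^ (l + s))"
    by auto
  finally show ?thesis by (simp only: of_nat_less_iff)
qed

lemma count_iff':
  "2 ^ (k + s) < n * 2 ^ k + 2 ^ s \<longleftrightarrow> 1 - (1/2) ^ k < real n / 2 ^ s" for n :: nat
proof -
  have "1 - (1/2) ^ k < real n / 2 ^ s \<longleftrightarrow>
      (1 - (1/2) ^ k) * 2 ^ (k + s) < real n / 2 ^ s * (2 ^ (k + s) :: real)"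
    by (rule mult_less_cancel_right_pos[symmetric]) simp
  also have "(1 - (1/2) ^ k) * 2 ^ (k + s) = (2 ^ (k + s) - 2 ^ s :: real)"
    by (simp add: power_add power_one_over field_simps)
  also have "real n / 2 ^ s * 2 ^ (k + s) = real n * 2 ^ k"
    by (simp add: power_add field_simps)
  also have "(2 ^ (k + s) - 2 ^ s < real n * 2 ^ k) \<longleftrightarrow> real (2 ^ (k + s)) < real (n * 2 ^ k + 2 ^ s)"
    by auto
  finally show ?thesis by (simp only: of_nat_less_iff)
qed

section \<open>Tests on distances and on the variation of the kernel\<close>

locale computable_metric =
  fixes \<delta> :: "'a::polish_space rep" and M N :: machine
  assumes adm: "admissible_quotient_rep \<delta>"
    and M: "type2_machine M"
    and M_dist: "\<And>p q x y. \<delta> p x \<Longrightarrow> \<delta> q y \<Longrightarrow> \<exists>r. transforms M (pair_name p q) r \<and> real_rep r (dist x y)"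
    and N: "type2_machine N"
    and N_dist: "\<And>p q x A. \<delta> p x \<Longrightarrow> closed_rep \<delta> q A \<Longrightarrow>
      \<exists>r. transforms N (pair_name p q) r \<and> lower_rep r (INF y\<in>A. ennreal (dist x y))"
begin

text \<open>The factors 2 here, 3 in \<open>near_iff\<close> and 4 in \<open>near_complete\<close>
  differ by one because entry \<open>l\<close> of a name of a real number is accurate up to
  2^-l.\<close>

lemma near_sound:
  assumes "\<delta> p x" "\<delta> q y" "tends A p" "tends B q" "near k l (run M (pair_list (A s) (B s)))"
  shows "dist x y < (1/2) ^ k - 2 * (1/2) ^ l"
proof -
  obtain r where r: "transforms M (pair_name p q) r" "real_rep r (dist x y)"
    using M_dist assms by blast
  have "tends (\<lambda>s. run M (pair_list (A s) (B s))) r"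
    by (intro tends_run[OF M r(1)] tends_pair_list assms)
  from tends_nth[OF this, of l s] assms(5) have "rat_number (r l) < (1/2) ^ k - 3 * (1/2) ^ l"
    by (simp add: near_iff)
  moreover have "\<bar>rat_number (r l) - dist x y\<bar> \<le> (1/2) ^ l" using r(2) by (simp add: real_rep_def)
  ultimately show ?thesis by linarith
qed

lemma near_complete:
  assumes "\<delta> p x" "\<delta> q y" "tends A p" "tends B q" "dist x y < (1/2) ^ k - 4 * (1/2) ^ l"
  shows "\<forall>\<^sub>F s in sequentially. near k l (run M (pair_list (A s) (B s)))"
proof -
  obtain r where r: "transforms M (pair_name p q) r" "real_rep r (dist x y)"
    using M_dist assms by blast
  have t: "tends (\<lambda>s. run M (pair_list (A s) (B s))) r"
    by (intro tends_run[OF M r(1)] tends_pair_list assms)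
  have "\<bar>rat_number (r l) - dist x y\<bar> \<le> (1/2) ^ l" using r(2) by (simp add: real_rep_def)
  then have "rat_number (r l) < (1/2) ^ k - 3 * (1/2) ^ l" using assms(5) by linarith
  then show ?thesis
    using tends_length[OF t, of "Suc l"] tends_nth[OF t, of l]
    by (auto simp: near_iff Suc_le_eq elim!: eventually_mono)
qed

end

text \<open>The versions \<open>f x\<close> are chosen separately for each \<open>x\<close>; that
  they can be chosen jointly measurable is proved only in \<open>joint_version_ex\<close>.\<close>

locale computable_kernel = computable_metric \<delta> M N for \<delta> :: "'a::polish_space rep" and M N +
  fixes a :: name and F :: "'a \<Rightarrow> 'a rv" and f :: "'a \<Rightarrow> cantor \<Rightarrow> 'a"
  assumes a: "exp_rep \<delta> (rv_rep \<delta> dist) a F" and f: "\<And>x. version (f x) (F x)"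
begin

text \<open>By passing to the complement, this says that 2^-k belongs to the set whose infimum is
  the Fan distance of \<open>f y\<close> and \<open>f x\<close>. The form with a lower bound on a
  probability can be confirmed by counting cylinders.\<close>

definition agree :: "nat \<Rightarrow> 'a \<Rightarrow> 'a \<Rightarrow> bool" where
  "agree k x y \<longleftrightarrow> 1 - (1/2) ^ k < measure coin {\<omega>. dist (f y \<omega>) (f x \<omega>) < (1/2) ^ k}"

lemma f_measurable: "f x \<in> borel_measurable coin"
  using f by (auto simp: version_def)

lemma agree_refl: "agree k x x"
proof -
  have "{\<omega>. dist (f x \<omega>) (f x \<omega>) < (1/2) ^ k} = UNIV" by simp
  then show ?thesis using coin.prob_space by (simp add: agree_def)
qed

lemma F_approx:
  assumes "\<delta> g x"
  obtains r Z G where "associate a g r" "\<And>l. Z l \<in> borel_measurable coin"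
    "\<And>l \<omega>. associate (slice r l) (bits \<omega>) (G l \<omega>)" "\<And>l \<omega>. \<delta> (G l \<omega>) (Z l \<omega>)"
    "\<And>l. measure coin {\<omega>. (1/2) ^ l < dist (Z l \<omega>) (f x \<omega>)} \<le> (1/2) ^ l"
proof -
  obtain r where r: "associate a g r" "rv_rep \<delta> dist r (F x)"
    using a assms unfolding exp_rep_def by blast
  obtain Z where Z: "\<And>l. Z l \<in> borel_measurable coin" "\<And>l. exp_rep cantor_rep \<delta> (slice r l) (Z l)"
    "\<And>l. measure coin {\<omega>. (1/2) ^ l < dist (Z l \<omega>) (f x \<omega>)} \<le> (1/2) ^ l"
    using rv_rep_approx[OF r(2) f] by blast
  obtain G where "\<And>l \<omega>. associate (slice r l) (bits \<omega>) (G l \<omega>)" "\<And>l \<omega>. \<delta> (G l \<omega>) (Z l \<omega>)"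
    using Z(2) unfolding exp_rep_cantor by metis
  with r(1) Z(1,3) show thesis by (intro that)
qed

definition detect :: "nat \<Rightarrow> nat \<Rightarrow> name \<Rightarrow> name \<Rightarrow> nat \<Rightarrow> nat list \<Rightarrow> bool" where
  "detect k l g v s = (\<lambda>w. near k l (run M (pair_list
    (app_list (slice_list (app_list (map a [0..<s]) (map v [0..<s])) l) w)
    (app_list (slice_list (app_list (map a [0..<s]) (map g [0..<s])) l) w))))"

lemma close_iff:
  "close M k (map a [0..<s]) (map g [0..<s]) (map v [0..<s]) \<longleftrightarrow>
    (\<exists>l<s. 1 - (1/2) ^ k + 2 * (1/2) ^ l < length (filter (detect k l g v s) (bit_lists s)) / 2 ^ s)"
  unfolding count_iff[symmetric] by (auto simp: close_def list_ex_iff detect_def)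

lemma detect_approx:
  assumes g: "\<delta> g x" and v: "\<delta> v y"
  obtains Z Z' where "\<And>l. Z l \<in> borel_measurable coin" "\<And>l. Z' l \<in> borel_measurable coin"
    "\<And>l. measure coin {\<omega>. (1/2) ^ l < dist (Z l \<omega>) (f x \<omega>)} \<le> (1/2) ^ l"
    "\<And>l. measure coin {\<omega>. (1/2) ^ l < dist (Z' l \<omega>) (f y \<omega>)} \<le> (1/2) ^ l"
    "\<And>k l s \<omega>. detect k l g v s (map (bits \<omega>) [0..<s]) \<Longrightarrow>
      dist (Z' l \<omega>) (Z l \<omega>) < (1/2) ^ k - 2 * (1/2) ^ l"
    "\<And>k l \<omega>. dist (Z' l \<omega>) (Z l \<omega>) < (1/2) ^ k - 4 * (1/2) ^ l \<Longrightarrow>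
      \<forall>\<^sub>F s in sequentially. detect k l g v s (map (bits \<omega>) [0..<s])"
proof -
  from F_approx[OF g] obtain r Z G where r: "associate a g r" "\<And>l. Z l \<in> borel_measurable coin"
    "\<And>l \<omega>. associate (slice r l) (bits \<omega>) (G l \<omega>)" "\<And>l \<omega>. \<delta> (G l \<omega>) (Z l \<omega>)"
    "\<And>l. measure coin {\<omega>. (1/2) ^ l < dist (Z l \<omega>) (f x \<omega>)} \<le> (1/2) ^ l" by blast
  from F_approx[OF v] obtain r' Z' G' where r': "associate a v r'" "\<And>l. Z' l \<in> borel_measurable coin"
    "\<And>l \<omega>. associate (slice r' l) (bits \<omega>) (G' l \<omega>)" "\<And>l \<omega>. \<delta> (G' l \<omega>) (Z' l \<omega>)"
    "\<And>l. measure coin {\<omega>. (1/2) ^ l < dist (Z' l \<omega>) (f y \<omega>)} \<le> (1/2) ^ l" by blast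
  have tG: "tends (\<lambda>s. app_list (slice_list (app_list (map a [0..<s]) (map g [0..<s])) l) (map (bits \<omega>) [0..<s])) (G l \<omega>)" for l \<omega>
    by (intro tends_app_list[OF _ _ r(3)] tends_slice_list tends_app_list[OF _ _ r(1)] tends_prefixes)
  have tG': "tends (\<lambda>s. app_list (slice_list (app_list (map a [0..<s]) (map v [0..<s])) l) (map (bits \<omega>) [0..<s])) (G' l \<omega>)" for l \<omega>
    by (intro tends_app_list[OF _ _ r'(3)] tends_slice_list tends_app_list[OF _ _ r'(1)] tends_prefixes)
  show thesis
  proof (rule that[OF r(2) r'(2) r(5) r'(5)])
    show "dist (Z' l \<omega>) (Z l \<omega>) < (1/2) ^ k - 2 * (1/2) ^ l"
      if "detect k l g v s (map (bits \<omega>) [0..<s])" for k l s \<omega>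
      using near_sound[OF r'(4) r(4) tG' tG] that unfolding detect_def by blast
    show "\<forall>\<^sub>F s in sequentially. detect k l g v s (map (bits \<omega>) [0..<s])"
      if "dist (Z' l \<omega>) (Z l \<omega>) < (1/2) ^ k - 4 * (1/2) ^ l" for k l \<omega>
      unfolding detect_def by (rule near_complete[OF r'(4) r(4) tG' tG that])
  qed
qed

lemma close_sound:
  assumes g: "\<delta> g x" and v: "\<delta> v y"
    and close: "close M k (map a [0..<s]) (map g [0..<s]) (map v [0..<s])"
  shows "agree k x y"
proof -
  obtain Z Z' where Z: "\<And>l. Z l \<in> borel_measurable coin" "\<And>l. Z' l \<in> borel_measurable coin"
    "\<And>l. measure coin {\<omega>. (1/2) ^ l < dist (Z l \<omega>) (f x \<omega>)} \<le> (1/2) ^ l"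
    "\<And>l. measure coin {\<omega>. (1/2) ^ l < dist (Z' l \<omega>) (f y \<omega>)} \<le> (1/2) ^ l"
    and detect: "\<And>l \<omega>. detect k l g v s (map (bits \<omega>) [0..<s]) \<Longrightarrow>
      dist (Z' l \<omega>) (Z l \<omega>) < (1/2) ^ k - 2 * (1/2) ^ l"
    by (rule detect_approx[OF g v]) (rule that; blast)
  obtain l where "1 - (1/2) ^ k + 2 * (1/2) ^ l < measure coin {\<omega>. detect k l g v s (map (bits \<omega>) [0..<s])}"
    using close unfolding close_iff measure_prefix by blast
  also have "\<dots> \<le> measure coin ({\<omega>. dist (f y \<omega>) (f x \<omega>) < (1/2) ^ k}
      \<union> ({\<omega>. (1/2) ^ l < dist (Z' l \<omega>) (f y \<omega>)} \<union> {\<omega>. (1/2) ^ l < dist (Z l \<omega>) (f x \<omega>)}))"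
  proof (intro coin.finite_measure_mono subsetI)
    fix \<omega> assume "\<omega> \<in> {\<omega>. detect k l g v s (map (bits \<omega>) [0..<s])}"
    then have "dist (Z' l \<omega>) (Z l \<omega>) < (1/2) ^ k - 2 * (1/2) ^ l" by (auto intro: detect)
    moreover have "dist (f y \<omega>) (f x \<omega>) \<le> dist (Z' l \<omega>) (f y \<omega>) + dist (Z' l \<omega>) (Z l \<omega>) + dist (Z l \<omega>) (f x \<omega>)"
      by (rule dist_triangle4)
    ultimately show "\<omega> \<in> {\<omega>. dist (f y \<omega>) (f x \<omega>) < (1/2) ^ k}
      \<union> ({\<omega>. (1/2) ^ l < dist (Z' l \<omega>) (f y \<omega>)} \<union> {\<omega>. (1/2) ^ l < dist (Z l \<omega>) (f x \<omega>)})"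
      by auto
  qed (intro sets.Un dist_sets f_measurable Z(1,2))
  also have "\<dots> \<le> measure coin {\<omega>. dist (f y \<omega>) (f x \<omega>) < (1/2) ^ k} +
      measure coin ({\<omega>. (1/2) ^ l < dist (Z' l \<omega>) (f y \<omega>)} \<union> {\<omega>. (1/2) ^ l < dist (Z l \<omega>) (f x \<omega>)})"
    by (intro measure_Un_le sets.Un dist_sets f_measurable Z(1,2))
  also have "measure coin ({\<omega>. (1/2) ^ l < dist (Z' l \<omega>) (f y \<omega>)} \<union> {\<omega>. (1/2) ^ l < dist (Z l \<omega>) (f x \<omega>)})
      \<le> measure coin {\<omega>. (1/2) ^ l < dist (Z' l \<omega>) (f y \<omega>)} + measure coin {\<omega>. (1/2) ^ l < dist (Z l \<omega>) (f x \<omega>)}"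
    by (intro measure_Un_le dist_sets f_measurable Z(1,2))
  finally show ?thesis using Z(3,4)[of l] unfolding agree_def by linarith
qed

lemma close_complete:
  assumes g: "\<delta> g x" and v: "\<delta> v y" and agree: "agree k x y"
  shows "\<exists>s. close M k (map a [0..<s]) (map g [0..<s]) (map v [0..<s])"
proof -
  obtain Z Z' where Z: "\<And>l. Z l \<in> borel_measurable coin" "\<And>l. Z' l \<in> borel_measurable coin"
    "\<And>l. measure coin {\<omega>. (1/2) ^ l < dist (Z l \<omega>) (f x \<omega>)} \<le> (1/2) ^ l"
    "\<And>l. measure coin {\<omega>. (1/2) ^ l < dist (Z' l \<omega>) (f y \<omega>)} \<le> (1/2) ^ l"
    and detect: "\<And>l \<omega>. dist (Z' l \<omega>) (Z l \<omega>) < (1/2) ^ k - 4 * (1/2) ^ l \<Longrightarrow>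
      \<forall>\<^sub>F s in sequentially. detect k l g v s (map (bits \<omega>) [0..<s])"
    by (rule detect_approx[OF g v]) (rule that; blast)
  \<comment> \<open>\<open>6 = 4 + 2\<close>: the margin 4 is demanded by
    \<open>near_complete\<close>, and the approximations of \<open>f x\<close> and
    \<open>f y\<close> are off by 2^-l each.\<close>
  define B where "B l = {\<omega>. dist (f y \<omega>) (f x \<omega>) < (1/2) ^ k - 6 * (1/2) ^ l}" for l
  have B_sets: "B l \<in> sets coin" for l unfolding B_def by (intro dist_sets f_measurable)
  have null: "(\<lambda>l. (1/2 :: real) ^ l) \<longlonglongrightarrow> 0" by (rule LIMSEQ_power_zero) simp
  have "incseq B"
  proof (intro incseq_SucI subsetI)
    fix l \<omega> assume "\<omega> \<in> B l"
    then show "\<omega> \<in> B (Suc l)" unfolding B_def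
      by simp (smt (verit) zero_le_power zero_le_divide_1_iff)
  qed
  then have "(\<lambda>l. measure coin (B l)) \<longlonglongrightarrow> measure coin (\<Union>l. B l)"
    using B_sets by (intro coin.finite_Lim_measure_incseq) auto
  also have "(\<Union>l. B l) = {\<omega>. dist (f y \<omega>) (f x \<omega>) < (1/2) ^ k}"
  proof (intro set_eqI iffI)
    fix \<omega> assume "\<omega> \<in> {\<omega>. dist (f y \<omega>) (f x \<omega>) < (1/2) ^ k}"
    then have "0 < ((1/2) ^ k - dist (f y \<omega>) (f x \<omega>)) / 6" by simp
    from order_tendstoD(2)[OF null this] obtain l where "(1/2) ^ l < ((1/2) ^ k - dist (f y \<omega>) (f x \<omega>)) / 6"
      unfolding eventually_sequentially by blast
    then show "\<omega> \<in> (\<Union>l. B l)" by (auto simp: B_def intro!: exI[of _ l])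
  next
    fix \<omega> assume "\<omega> \<in> (\<Union>l. B l)"
    then obtain l where "dist (f y \<omega>) (f x \<omega>) < (1/2) ^ k - 6 * (1/2) ^ l" by (auto simp: B_def)
    moreover have "0 < (1/2 :: real) ^ l" by simp
    ultimately show "\<omega> \<in> {\<omega>. dist (f y \<omega>) (f x \<omega>) < (1/2) ^ k}" unfolding mem_Collect_eq by linarith
  qed
  \<comment> \<open>\<open>4 = 2 + 2\<close>: two exceptional events of probability at most 2^-l,
    and the excess 2 * 2^-l demanded by \<open>close\<close>.\<close>
  finally have "(\<lambda>l. measure coin (B l) - 4 * (1/2) ^ l)
      \<longlonglongrightarrow> measure coin {\<omega>. dist (f y \<omega>) (f x \<omega>) < (1/2) ^ k} - 4 * 0"
    by (intro tendsto_diff tendsto_mult tendsto_const null)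
  from order_tendstoD(1)[OF this, of "1 - (1/2) ^ k"] agree
  obtain l where l: "1 - (1/2) ^ k < measure coin (B l) - 4 * (1/2) ^ l"
    unfolding eventually_sequentially agree_def by auto
  let ?E = "{\<omega>. dist (Z' l \<omega>) (Z l \<omega>) < (1/2) ^ k - 4 * (1/2) ^ l}"
  have "measure coin (B l) \<le> measure coin (?E
      \<union> ({\<omega>. (1/2) ^ l < dist (Z' l \<omega>) (f y \<omega>)} \<union> {\<omega>. (1/2) ^ l < dist (Z l \<omega>) (f x \<omega>)}))"
  proof (intro coin.finite_measure_mono subsetI)
    fix \<omega> assume "\<omega> \<in> B l"
    moreover have "dist (Z' l \<omega>) (Z l \<omega>) \<le> dist (Z' l \<omega>) (f y \<omega>) + dist (f y \<omega>) (f x \<omega>) + dist (Z l \<omega>) (f x \<omega>)"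
      using dist_triangle4[of "Z' l \<omega>" "Z l \<omega>" "f y \<omega>" "f x \<omega>"] by (simp add: dist_commute)
    ultimately show "\<omega> \<in> ?E \<union> ({\<omega>. (1/2) ^ l < dist (Z' l \<omega>) (f y \<omega>)} \<union> {\<omega>. (1/2) ^ l < dist (Z l \<omega>) (f x \<omega>)})"
      by (auto simp: B_def)
  qed (intro sets.Un dist_sets f_measurable Z(1,2))
  also have "\<dots> \<le> measure coin ?E +
      measure coin ({\<omega>. (1/2) ^ l < dist (Z' l \<omega>) (f y \<omega>)} \<union> {\<omega>. (1/2) ^ l < dist (Z l \<omega>) (f x \<omega>)})"
    by (intro measure_Un_le sets.Un dist_sets f_measurable Z(1,2))
  also have "measure coin ({\<omega>. (1/2) ^ l < dist (Z' l \<omega>) (f y \<omega>)} \<union> {\<omega>. (1/2) ^ l < dist (Z l \<omega>) (f x \<omega>)})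
      \<le> measure coin {\<omega>. (1/2) ^ l < dist (Z' l \<omega>) (f y \<omega>)} + measure coin {\<omega>. (1/2) ^ l < dist (Z l \<omega>) (f x \<omega>)}"
    by (intro measure_Un_le dist_sets f_measurable Z(1,2))
  finally have "1 - (1/2) ^ k + 2 * (1/2) ^ l < measure coin ?E"
    using Z(3,4)[of l] l by linarith
  then have "\<forall>\<^sub>F s in sequentially. 1 - (1/2) ^ k + 2 * (1/2) ^ l < length (filter (detect k l g v s) (bit_lists s)) / 2 ^ s"
  proof (rule measure_eventually_detected)
    show "?E \<in> sets coin" by (intro dist_sets Z(1,2))
    fix \<omega> assume "\<omega> \<in> ?E"
    then show "\<forall>\<^sub>F s in sequentially. detect k l g v s (map (bits \<omega>) [0..<s])"
      by (intro detect) simp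
  qed
  then have "\<forall>\<^sub>F s in sequentially. l < s \<and> 1 - (1/2) ^ k + 2 * (1/2) ^ l < length (filter (detect k l g v s) (bit_lists s)) / 2 ^ s"
    using eventually_gt_at_top[of l] by eventually_elim simp
  then obtain s where "l < s" "1 - (1/2) ^ k + 2 * (1/2) ^ l < length (filter (detect k l g v s) (bit_lists s)) / 2 ^ s"
    unfolding eventually_sequentially by blast
  then show ?thesis unfolding close_iff by blast
qed

text \<open>A prefix that is accepted is accepted in every name that extends it, and acceptance is
  sound. This is the continuity of \<open>F\<close>, for the metric on points and convergence in
  probability.\<close>

lemma open_agree: "open {y. agree k x y}"
proof (rule open_rep[OF adm])
  fix v y assume v: "\<delta> v y" and y: "y \<in> {y. agree k x y}"
  obtain g where g: "\<delta> g x" using rep_surj[OF adm] by blast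
  obtain s where s: "close M k (map a [0..<s]) (map g [0..<s]) (map v [0..<s])"
    using close_complete[OF g v] y by blast
  show "\<exists>n. \<forall>v' x'. \<delta> v' x' \<longrightarrow> (\<forall>i<n. v' i = v i) \<longrightarrow> x' \<in> {y. agree k x y}"
  proof (intro exI[of _ s] allI impI)
    fix v' x' assume v': "\<delta> v' x'" "\<forall>i<s. v' i = v i"
    then have eq: "map v' [0..<s] = map v [0..<s]" by simp
    show "x' \<in> {y. agree k x y}" using close_sound[OF g v'(1), of k s, unfolded eq, OF s] by simp
  qed
qed

text \<open>The \<open>n\<close>-th digit of the Sierpinski value is given exactly at the prefix of
  length \<open>n\<close> and reports whether that prefix is accepted.\<close>

lemma apart_name_rep:
  assumes g: "\<delta> g x"
  shows "closed_rep \<delta> (apart_name M k a g) {y. \<not> agree k x y}"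
  unfolding closed_rep_def exp_rep_def
proof (intro conjI allI impI)
  show "closed {y. \<not> agree k x y}"
    using open_agree[of k x] by (simp add: closed_def Collect_neg_eq[symmetric])
  fix v y assume v: "\<delta> v y"
  let ?r = "\<lambda>n. of_bool (close M k (map a [0..<n]) (map g [0..<n]) (map v [0..<n])) :: nat"
  have val: "apart_name M k a g (list_encode (n # map v [0..<m]))
      = (if n \<le> m then Suc (of_bool (close M k (map a [0..<m]) (map g [0..<m]) (map v [0..<m]))) else 0)" for n m
    using length_tl_list_decode[of "list_encode (n # map v [0..<m])"]
    by (simp add: apart_name_def apart_val_def Let_def take_map min_def del: list_encode.simps)
  have "associate (apart_name M k a g) v ?r"
    unfolding associate_def
  proof
    fix n
    show "\<exists>m. apart_name M k a g (list_encode (n # map v [0..<m])) = Suc (?r n) \<and>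
        (\<forall>j<m. apart_name M k a g (list_encode (n # map v [0..<j])) = 0)"
      by (rule exI[of _ n]) (simp add: val del: list_encode.simps)
  qed
  moreover have "sierpinski_rep ?r (y \<notin> {y. \<not> agree k x y})"
    using close_sound[OF g v] close_complete[OF g v] by (auto simp: sierpinski_rep_def)
  ultimately show "\<exists>r. associate (apart_name M k a g) v r \<and> sierpinski_rep r (y \<notin> {y. \<not> agree k x y})" by blast
qed

text \<open>If \<open>y\<close> lay in the closed set of points without agreement, its distance to
  \<open>x\<close> would bound all entries of the name of the distance, one of which exceeds
  2^-m.\<close>

lemma steady_sound:
  assumes g: "\<delta> g x" and A: "tends A a" and G: "tends G g"
    and st: "steady M N m k (A s) (G s)" and y: "dist x y \<le> (1/2) ^ m"
  shows "agree k x y"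
proof (rule ccontr)
  assume no: "\<not> agree k x y"
  obtain r where r: "transforms N (pair_name g (apart_name M k a g)) r"
      "lower_rep r (INF y\<in>{y. \<not> agree k x y}. ennreal (dist x y))"
    using N_dist[OF g apart_name_rep[OF g]] by blast
  have t: "tends (\<lambda>s. run N (pair_list (G s) (apart_list M k (A s) (G s)))) r"
    by (intro tends_run[OF N r(1)] tends_pair_list tends_apart_list A G)
  obtain e where e: "e \<in> set (run N (pair_list (G s) (apart_list M k (A s) (G s))))" "(1/2) ^ m < rat_number e"
    using st unfolding steady_def far_iff by blast
  then obtain i where "e = r i" using tends_nth[OF t, of _ s] by (metis in_set_conv_nth)
  have "ennreal (rat_number (r i)) \<le> (SUP n. ennreal (rat_number (r n)))" by (rule SUP_upper) simp
  also have "\<dots> = (INF y\<in>{y. \<not> agree k x y}. ennreal (dist x y))" using r(2) by (simp add: lower_rep_def)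
  also have "\<dots> \<le> ennreal (dist x y)" using no by (intro INF_lower) simp
  finally have "rat_number e \<le> dist x y" using \<open>e = r i\<close> by simp
  with e(2) y show False by simp
qed

text \<open>The factor 2 provides the strict inequality that a lower bound can witness. An empty
  complement is no exception, as its distance is infinite.\<close>

lemma steady_complete:
  assumes g: "\<delta> g x" and A: "tends A a" and G: "tends G g"
    and y: "\<And>y. dist x y < 2 * (1/2) ^ m \<Longrightarrow> agree k x y"
  shows "\<forall>\<^sub>F s in sequentially. steady M N m k (A s) (G s)"
proof -
  obtain r where r: "transforms N (pair_name g (apart_name M k a g)) r"
      "lower_rep r (INF y\<in>{y. \<not> agree k x y}. ennreal (dist x y))"
    using N_dist[OF g apart_name_rep[OF g]] by blast
  have t: "tends (\<lambda>s. run N (pair_list (G s) (apart_list M k (A s) (G s)))) r"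
    by (intro tends_run[OF N r(1)] tends_pair_list tends_apart_list A G)
  have "ennreal ((1/2) ^ m) < ennreal (2 * (1/2) ^ m)" by (intro ennreal_lessI) auto
  also have "\<dots> \<le> (INF y\<in>{y. \<not> agree k x y}. ennreal (dist x y))"
    by (intro INF_greatest ennreal_leI) (use y in \<open>auto simp flip: not_less\<close>)
  also have "\<dots> = (SUP n. ennreal (rat_number (r n)))" using r(2) by (simp add: lower_rep_def)
  finally obtain n where "ennreal ((1/2) ^ m) < ennreal (rat_number (r n))" by (auto simp: less_SUP_iff)
  then have n: "(1/2) ^ m < rat_number (r n)" by (simp add: ennreal_less_iff)
  show ?thesis
    using tends_length[OF t, of "Suc n"]
  proof eventually_elim
    case (elim s)
    then have "r n \<in> set (run N (pair_list (G s) (apart_list M k (A s) (G s))))"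
      using tends_nth[OF t, of n s] by (metis Suc_le_eq nth_mem)
    then show ?case using n unfolding steady_def far_iff by blast
  qed
qed

end


section \<open>Approximation of the states, one transition at a time\<close>

context computable_metric
begin

text \<open>\<open>b\<close> names approximations \<open>W m\<close> of the \<open>n\<close>-th state \<open>X\<close>; like \<open>X\<close>, their names depend on the
  first \<open>n + 1\<close> factors of the base space only.\<close>

definition state_name ::
  "nat \<Rightarrow> name \<Rightarrow> (cantor \<Rightarrow> 'a) \<Rightarrow> (nat \<Rightarrow> cantor \<Rightarrow> name) \<Rightarrow> (nat \<Rightarrow> cantor \<Rightarrow> 'a) \<Rightarrow> bool" where
  "state_name n b X G W \<longleftrightarrow>
    (\<forall>m \<omega>. associate (slice b m) (bits \<omega>) (G m \<omega>) \<and> \<delta> (G m \<omega>) (W m \<omega>)) \<and>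
    (\<forall>m \<omega> \<omega>'. (\<forall>j\<le>n. slice \<omega> j = slice \<omega>' j) \<longrightarrow> G m \<omega> = G m \<omega>') \<and>
    (\<forall>m. measure coin {\<omega>. (1/2) ^ m < dist (W m \<omega>) (X \<omega>)} \<le> (1/2) ^ m)"

lemma state_name_measurable: "state_name n b X G W \<Longrightarrow> W m \<in> borel_measurable coin"
  unfolding borel_measurable_coin state_name_def
  by (blast intro: borel_measurable_continuous_onI continuous_on_realizer[OF adm])

lemma tends_state_name:
  assumes "state_name n b X G W"
  shows "tends (\<lambda>s. app_list (slice_list (map b [0..<s]) m) (map (bits \<omega>) [0..<s])) (G m \<omega>)"
proof -
  have "associate (slice b m) (bits \<omega>) (G m \<omega>)" using assms by (auto simp: state_name_def)
  then show ?thesis by (intro tends_app_list[OF tends_slice_list[OF tends_prefixes] tends_prefixes])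
qed

lemma init_state_name:
  assumes b: "rv_rep \<delta> dist b Xinit" and x: "version x Xinit"
  shows "\<exists>G W. state_name 0 (init_name b) (\<lambda>\<omega>. x (slice \<omega> 0)) G W"
proof -
  obtain Z where Z: "\<And>m. Z m \<in> borel_measurable coin" "\<And>m. exp_rep cantor_rep \<delta> (slice b m) (Z m)"
    "\<And>m. measure coin {\<omega>. (1/2) ^ m < dist (Z m \<omega>) (x \<omega>)} \<le> (1/2) ^ m"
    using rv_rep_approx[OF b x] by blast
  obtain G where G: "\<And>m \<omega>. associate (slice b m) (bits \<omega>) (G m \<omega>)" "\<And>m \<omega>. \<delta> (G m \<omega>) (Z m \<omega>)"
    using Z(2) unfolding exp_rep_cantor by metis
  have x_m: "x \<in> borel_measurable coin" using x by (simp add: version_def)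
  have "state_name 0 (init_name b) (\<lambda>\<omega>. x (slice \<omega> 0)) (\<lambda>m \<omega>. G m (slice \<omega> 0)) (\<lambda>m \<omega>. Z m (slice \<omega> 0))"
    unfolding state_name_def
  proof (intro conjI allI impI)
    show "associate (slice (init_name b) m) (bits \<omega>) (G m (slice \<omega> 0))" for m \<omega>
      by (rule associate_init_name) (simp add: slice_bits G)
    show "measure coin {\<omega>. (1/2) ^ m < dist (Z m (slice \<omega> 0)) (x (slice \<omega> 0))} \<le> (1/2) ^ m" for m
      using measure_slice[OF dist_sets(2)[OF Z(1) x_m], of 0 "(1/2) ^ m" m] Z(3)[of m] by simp
  qed (auto simp: G)
  then show ?thesis by blast
qed

end

context computable_kernel
begin

lemma agree_triangle:
  assumes "agree (Suc k) z x" "agree (Suc k) z y"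
  shows "agree k x y"
proof -
  let ?e = "(1/2) ^ Suc k :: real"
  let ?A = "\<lambda>u. {\<omega>. ?e \<le> dist (f u \<omega>) (f z \<omega>)}"
  have A: "measure coin (?A u) < ?e" if "agree (Suc k) z u" for u
    using that measure_less_compl[OF f_measurable f_measurable, of ?e u z] unfolding agree_def by linarith
  have "{\<omega>. (1/2) ^ k \<le> dist (f y \<omega>) (f x \<omega>)} \<subseteq> ?A x \<union> ?A y"
  proof
    fix \<omega> assume "\<omega> \<in> {\<omega>. (1/2) ^ k \<le> dist (f y \<omega>) (f x \<omega>)}"
    then have "?e + ?e \<le> dist (f y \<omega>) (f x \<omega>)" by simp
    also have "\<dots> \<le> dist (f y \<omega>) (f z \<omega>) + dist (f x \<omega>) (f z \<omega>)"
      by (rule dist_triangle2)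
    finally show "\<omega> \<in> ?A x \<union> ?A y" by auto
  qed
  then have "measure coin {\<omega>. (1/2) ^ k \<le> dist (f y \<omega>) (f x \<omega>)} \<le> measure coin (?A x \<union> ?A y)"
    by (intro coin.finite_measure_mono sets.Un dist_sets f_measurable)
  also have "\<dots> \<le> measure coin (?A x) + measure coin (?A y)"
    by (intro measure_Un_le dist_sets f_measurable)
  finally have "measure coin {\<omega>. (1/2) ^ k \<le> dist (f y \<omega>) (f x \<omega>)} < (1/2) ^ k"
    using A[OF assms(1)] A[OF assms(2)] by simp
  then show ?thesis
    using measure_less_compl[OF f_measurable f_measurable, of "(1/2) ^ k" y x] unfolding agree_def by linarith
qed

lemma precise_sound:
  assumes b: "state_name n b X G W" and pr: "precise M N k (map a [0..<s]) (map b [0..<s]) m s"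
  shows "\<exists>V\<in>sets coin. 1 - (1/2) ^ k < measure coin V \<and>
    (\<forall>\<omega>\<in>V. \<forall>y. dist (W m \<omega>) y \<le> (1/2) ^ m \<longrightarrow> agree k (W m \<omega>) y)"
proof -
  let ?V = "{\<omega>. steady M N m k (map a [0..<s])
    (app_list (slice_list (map b [0..<s]) m) (map (bits \<omega>) [0..<s]))}"
  have "1 - (1/2) ^ k < measure coin ?V"
    using pr unfolding precise_def count_iff' measure_prefix[symmetric] by simp
  moreover have "agree k (W m \<omega>) y" if "\<omega> \<in> ?V" "dist (W m \<omega>) y \<le> (1/2) ^ m" for \<omega> y
  proof (rule steady_sound)
    show "\<delta> (G m \<omega>) (W m \<omega>)" "dist (W m \<omega>) y \<le> (1/2) ^ m" using b that by (auto simp: state_name_def)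
    show "tends (\<lambda>s. app_list (slice_list (map b [0..<s]) m) (map (bits \<omega>) [0..<s])) (G m \<omega>)"
      by (rule tends_state_name[OF b])
    show "steady M N m k (map a [0..<s]) (app_list (slice_list (map b [0..<s]) m) (map (bits \<omega>) [0..<s]))"
      using that by simp
  qed (rule tends_prefixes)
  moreover have "?V \<in> sets coin" by (rule prefix_sets)
  ultimately show ?thesis by (intro bexI[of _ ?V]) blast+
qed

text \<open>The open sets \<open>S m\<close> of points near which \<open>F\<close> varies little at scale \<open>2\<^sup>-\<^sup>m\<close> increase to the
  whole space, so almost all of the mass of the state lies in one of them.\<close>

lemma precise_complete:
  assumes b: "state_name n b X G W" and X: "X \<in> borel_measurable coin"
  shows "\<exists>m\<ge>k. \<exists>s>m. precise M N k (map a [0..<s]) (map b [0..<s]) m s"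
proof -
  \<comment> \<open>The radius 4 * 2^-m: \<open>z\<close> is within 2^-m of the state and the state
    within 2^-m of \<open>W m\<close>, so a ball of radius 2 * 2^-m around \<open>W m\<close>, as
    needed for \<open>steady_complete\<close>, stays within 4 * 2^-m of \<open>z\<close>.\<close>
  define good where "good m z \<longleftrightarrow> (\<forall>x y. dist z x < 4 * (1/2) ^ m \<longrightarrow> dist z y < 4 * (1/2) ^ m \<longrightarrow> agree k x y)" for m z
  define S where "S m = (\<Union>z\<in>{z. good m z}. ball z ((1/2) ^ m))" for m
  have S_open: "open (S m)" for m unfolding S_def by auto
  have null: "(\<lambda>m. (1/2 :: real) ^ m) \<longlonglongrightarrow> 0" by (rule LIMSEQ_power_zero) simp
  have "incseq S"
  proof (intro incseq_SucI subsetI)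
    fix m x assume "x \<in> S m"
    then obtain z where z: "good m z" "dist z x < (1/2) ^ m" by (auto simp: S_def)
    have "good (Suc m) x" unfolding good_def
    proof (intro allI impI)
      fix u v assume "dist x u < 4 * (1/2) ^ Suc m" "dist x v < 4 * (1/2) ^ Suc m"
      moreover have "(1/2 :: real) ^ Suc m = (1/2) ^ m / 2" "0 < (1/2 :: real) ^ m" by simp_all
      ultimately have "dist z u < 4 * (1/2) ^ m" "dist z v < 4 * (1/2) ^ m"
        using z(2) dist_triangle[of z u x] dist_triangle[of z v x] by linarith+
      then show "agree k u v" using z(1) by (auto simp: good_def)
    qed
    then show "x \<in> S (Suc m)" unfolding S_def by (intro UN_I[of x]) auto
  qed
  have "(\<Union>m. S m) = UNIV"
  proof (intro set_eqI iffI UNIV_I)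
    fix z
    obtain e where e: "0 < e" "\<And>y. dist y z < e \<Longrightarrow> agree (Suc k) z y"
      using open_agree[of "Suc k" z] agree_refl unfolding open_dist by blast
    have "0 < e / 4" using e(1) by simp
    from order_tendstoD(2)[OF null this] obtain m where "(1/2) ^ m < e / 4"
      unfolding eventually_sequentially by blast
    then have "good m z"
      unfolding good_def by (auto intro!: agree_triangle[of k z] e(2) simp: dist_commute)
    then show "z \<in> (\<Union>m. S m)" by (auto simp: S_def intro!: exI[of _ m] exI[of _ z])
  qed
  define B where "B m = {\<omega>. X \<omega> \<in> S m}" for m
  have B_sets: "B m \<in> sets coin" for m
    using measurable_sets[OF X, of "S m"] S_open by (simp add: B_def vimage_def)
  have "(\<lambda>m. measure coin (B m)) \<longlonglongrightarrow> measure coin (\<Union>m. B m)"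
    using B_sets \<open>incseq S\<close> by (intro coin.finite_Lim_measure_incseq) (auto simp: incseq_def B_def)
  also have "(\<Union>m. B m) = UNIV" using \<open>(\<Union>m. S m) = UNIV\<close> by (auto simp: B_def)
  \<comment> \<open>The subtracted 2^-m accounts for the event that \<open>W m\<close> is farther
    than 2^-m from the state.\<close>
  finally have "(\<lambda>m. measure coin (B m) - (1/2) ^ m) \<longlonglongrightarrow> 1 - 0"
    using coin.prob_space by (intro tendsto_diff null) simp
  then have "\<forall>\<^sub>F m in sequentially. 1 - (1/2) ^ k < measure coin (B m) - (1/2) ^ m"
    by (rule order_tendstoD) simp
  with eventually_ge_at_top[of k]
  have "\<forall>\<^sub>F m in sequentially. k \<le> m \<and> 1 - (1/2) ^ k < measure coin (B m) - (1/2) ^ m"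
    by eventually_elim simp
  then obtain m where m: "k \<le> m" "1 - (1/2) ^ k < measure coin (B m) - (1/2) ^ m"
    unfolding eventually_sequentially by blast
  let ?C = "{\<omega>. (1/2) ^ m < dist (W m \<omega>) (X \<omega>)}"
  have C: "?C \<in> sets coin" by (intro dist_sets state_name_measurable[OF b] X)
  have "measure coin (B m) \<le> measure coin ((B m - ?C) \<union> ?C)"
    using B_sets C by (intro coin.finite_measure_mono) auto
  also have "\<dots> \<le> measure coin (B m - ?C) + measure coin ?C"
    using B_sets C by (intro measure_Un_le) auto
  finally have "1 - (1/2) ^ k < measure coin (B m - ?C)"
    using m(2) b by (auto simp: state_name_def dest!: spec[of _ m])
  then have "\<forall>\<^sub>F s in sequentially. 1 - (1/2) ^ k < length (filter (\<lambda>w. steady M N m k (map a [0..<s])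
      (app_list (slice_list (map b [0..<s]) m) w)) (bit_lists s)) / 2 ^ s"
  proof (rule measure_eventually_detected)
    show "B m - ?C \<in> sets coin" using B_sets C by auto
    fix \<omega> assume \<omega>: "\<omega> \<in> B m - ?C"
    then obtain z where z: "good m z" "dist z (X \<omega>) < (1/2) ^ m" by (auto simp: B_def S_def)
    have W: "dist (W m \<omega>) (X \<omega>) \<le> (1/2) ^ m" using \<omega> by auto
    show "\<forall>\<^sub>F s in sequentially. steady M N m k (map a [0..<s])
        (app_list (slice_list (map b [0..<s]) m) (map (bits \<omega>) [0..<s]))"
    proof (rule steady_complete)
      show "\<delta> (G m \<omega>) (W m \<omega>)" using b by (auto simp: state_name_def)
      show "tends (\<lambda>s. app_list (slice_list (map b [0..<s]) m) (map (bits \<omega>) [0..<s])) (G m \<omega>)"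
        by (rule tends_state_name[OF b])
      fix y assume y: "dist (W m \<omega>) y < 2 * (1/2) ^ m"
      have "dist z (W m \<omega>) < 2 * (1/2) ^ m"
        using z(2) W dist_triangle2[of z "W m \<omega>" "X \<omega>"] by linarith
      moreover from this have "dist z y < 4 * (1/2) ^ m"
        using y dist_triangle[of z y "W m \<omega>"] by linarith
      moreover have "0 < (1/2 :: real) ^ m" by simp
      ultimately show "agree k (W m \<omega>) y"
        using z(1) unfolding good_def by (smt (verit))
    qed (rule tends_prefixes)
  qed
  then have "\<forall>\<^sub>F s in sequentially. m < s \<and> precise M N k (map a [0..<s]) (map b [0..<s]) m s"
    using eventually_gt_at_top[of m] by eventually_elim (simp add: precise_def count_iff')
  then show ?thesis using m(1) unfolding eventually_sequentially by blast
qed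

text \<open>Later stages only append to the list. Its head need not be the \<open>m\<close> of
  \<open>precise_complete\<close>, but it comes with a stage \<open>s\<close> at which it passed the
  test, and this is all that \<open>precise_sound\<close> asks for.\<close>

lemma precisions_stable:
  assumes b: "state_name n b X G W" and X: "X \<in> borel_measurable coin"
  obtains m s where "k \<le> m" "precise M N k (map a [0..<s]) (map b [0..<s]) m s"
    "\<And>S. precisions M N k (map a [0..<S]) (map b [0..<S]) \<noteq> [] \<Longrightarrow>
      hdd 0 (precisions M N k (map a [0..<S]) (map b [0..<S])) = m"
    "\<forall>\<^sub>F S in sequentially. precisions M N k (map a [0..<S]) (map b [0..<S]) \<noteq> []"
proof -
  define prec where "prec m s = precise M N k (map a [0..<s]) (map b [0..<s]) m s" for m s
  define L where "L S = concat (map (\<lambda>s. filter (\<lambda>m. prec m s) [k..<s]) [0..<Suc S])" for S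
  have L: "precisions M N k (map a [0..<S]) (map b [0..<S]) = L S" for S
    unfolding precisions_def L_def prec_def length_map length_upt diff_zero
    by (intro arg_cong[where f = concat] map_cong refl filter_cong)
      (auto simp: precise_def take_map min_def simp del: upt_Suc)
  have LS: "\<exists>l. L (S + j) = L S @ l" for S j
  proof (induction j)
    case (Suc j)
    have "L (Suc T) = L T @ filter (\<lambda>m. prec m (Suc T)) [k..<Suc T]" for T
      by (simp add: L_def)
    with Suc show ?case by (metis add_Suc_right append.assoc)
  qed simp
  obtain m s where ms: "k \<le> m" "m < s" "prec m s" using precise_complete[OF b X] unfolding prec_def by blast
  then have "m \<in> set (L s)" by (auto simp: L_def intro!: bexI[of _ s])
  then have "L s \<noteq> []" by auto
  then obtain m' where m': "hdd 0 (L s) = m'" "m' \<in> set (L s)" by (cases "L s") auto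
  then obtain s' where "k \<le> m'" "prec m' s'" by (auto simp: L_def split: if_splits)
  have ne: "L S \<noteq> []" if "s \<le> S" for S
    using LS[of s "S - s"] that \<open>L s \<noteq> []\<close> by auto
  have hd: "hdd 0 (L S) = m'" if "L S \<noteq> []" for S
  proof (cases "s \<le> S")
    case True
    then show ?thesis using LS[of s "S - s"] \<open>L s \<noteq> []\<close> m'(1) by (cases "L s") auto
  next
    case False
    then show ?thesis using LS[of S "s - S"] that m'(1) by (cases "L S") auto
  qed
  have "\<forall>\<^sub>F S in sequentially. L S \<noteq> []" using ne unfolding eventually_sequentially by blast
  with \<open>k \<le> m'\<close> \<open>prec m' s'\<close> hd show thesis by (intro that[of m' s']) (simp_all add: L prec_def)
qed

text \<open>With \<open>e\<close> = 2^-(k+2), four events of probability at most \<open>e\<close>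
  are excluded. Two concern the past: the test for steadiness fails, or \<open>W m\<close> is
  farther than 2^-m from \<open>X\<close>. For a fixed past, two concern the fresh factor: the
  approximation of \<open>F (W m)\<close> is off by more than \<open>e\<close>, or
  \<open>F (W m)\<close> and \<open>F X\<close> differ by \<open>e\<close> or more. Otherwise the
  distance is below 2 * \<open>e\<close>, and both bounds fit into 4 * \<open>e\<close> =
  2^-k.\<close>

lemma step_state_name:
  assumes b: "state_name n b X G W" and X: "X \<in> borel_measurable coin"
    and X_dep: "\<And>\<omega> \<omega>'. (\<forall>j\<le>n. slice \<omega> j = slice \<omega>' j) \<Longrightarrow> X \<omega> = X \<omega>'"
    and X': "(\<lambda>\<omega>. f (X \<omega>) (slice \<omega> (Suc n))) \<in> borel_measurable coin"
  shows "\<exists>G W. state_name (Suc n) (step_name M N n a b) (\<lambda>\<omega>. f (X \<omega>) (slice \<omega> (Suc n))) G W"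
proof -
  have bG: "associate (slice b m) (bits \<omega>) (G m \<omega>)" "\<delta> (G m \<omega>) (W m \<omega>)" for m \<omega>
    using b by (auto simp: state_name_def)
  have G_dep: "G m \<omega> = G m \<omega>'" if "\<forall>j\<le>n. slice \<omega> j = slice \<omega>' j" for m \<omega> \<omega>'
    using b that by (auto simp: state_name_def)
  have W_dep: "W m \<omega> = W m \<omega>'" if "\<forall>j\<le>n. slice \<omega> j = slice \<omega>' j" for m \<omega> \<omega>'
    using bG(2)[of m \<omega>] bG(2)[of m \<omega>'] rep_unique[OF adm] G_dep[OF that] by metis
  define cs where "cs k S = precisions M N (k + 2) (map a [0..<S]) (map b [0..<S])" for k S
  have "\<exists>m s. k + 2 \<le> m \<and> precise M N (k + 2) (map a [0..<s]) (map b [0..<s]) m s \<and>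
    (\<forall>S. cs k S \<noteq> [] \<longrightarrow> hdd 0 (cs k S) = m) \<and> (\<forall>\<^sub>F S in sequentially. cs k S \<noteq> [])" for k
    by (rule precisions_stable[OF b X, of "k + 2"]) (auto simp: cs_def)
  then obtain m s where m: "\<And>k. k + 2 \<le> m k"
    "\<And>k. precise M N (k + 2) (map a [0..<s k]) (map b [0..<s k]) (m k) (s k)"
    "\<And>k S. cs k S \<noteq> [] \<Longrightarrow> hdd 0 (cs k S) = m k" "\<And>k. \<forall>\<^sub>F S in sequentially. cs k S \<noteq> []"
    by metis
  \<comment> \<open>The approximations of \<open>F x\<close> obtained from \<open>a\<close> may
    depend on the name \<open>g\<close> of \<open>x\<close>. This is why \<open>state_name\<close>
    asks that the names \<open>G\<close>, and not just the points \<open>W\<close>, depend on the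
    past only.\<close>
  define Q where "Q g x r Z H \<longleftrightarrow> associate a g r \<and> (\<forall>l. Z l \<in> borel_measurable coin) \<and>
      (\<forall>l \<omega>. associate (slice r l) (bits \<omega>) (H l \<omega>) \<and> \<delta> (H l \<omega>) (Z l \<omega>)) \<and>
      (\<forall>l. measure coin {\<omega>. (1/2) ^ l < dist (Z l \<omega>) (f x \<omega>)} \<le> (1/2) ^ l)" for g x r Z H
  have "\<exists>r Z H. Q g x r Z H" if "\<delta> g x" for g x
    unfolding Q_def by (rule F_approx[OF that]) blast
  then obtain R Z H where "\<And>g x. \<delta> g x \<Longrightarrow> Q g x (R g x) (Z g x) (H g x)" by metis
  then have R: "\<And>g x. \<delta> g x \<Longrightarrow> associate a g (R g x)"
    "\<And>g x l. \<delta> g x \<Longrightarrow> Z g x l \<in> borel_measurable coin"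
    "\<And>g x l \<omega>. \<delta> g x \<Longrightarrow> associate (slice (R g x) l) (bits \<omega>) (H g x l \<omega>)"
    "\<And>g x l \<omega>. \<delta> g x \<Longrightarrow> \<delta> (H g x l \<omega>) (Z g x l \<omega>)"
    "\<And>g x l. \<delta> g x \<Longrightarrow> measure coin {\<omega>. (1/2) ^ l < dist (Z g x l \<omega>) (f x \<omega>)} \<le> (1/2) ^ l"
    unfolding Q_def by blast+
  define G' where "G' k \<omega> = H (G (m k) \<omega>) (W (m k) \<omega>) (k + 2) (slice \<omega> (Suc n))" for k \<omega>
  define W' where "W' k \<omega> = Z (G (m k) \<omega>) (W (m k) \<omega>) (k + 2) (slice \<omega> (Suc n))" for k \<omega>
  let ?X' = "\<lambda>\<omega>. f (X \<omega>) (slice \<omega> (Suc n))"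
  have assoc: "associate (slice (step_name M N n a b) k) (bits \<omega>) (G' k \<omega>)" for k \<omega>
  proof (rule associate_step_name)
    let ?L = "\<lambda>S. app_list (slice_list (app_list (map a [0..<S])
      (app_list (slice_list (map b [0..<S]) (m k)) (map (bits \<omega>) [0..<S]))) (k + 2))
      (slice_list (map (bits \<omega>) [0..<S]) (Suc n))"
    have "tends ?L (G' k \<omega>)" unfolding G'_def
      by (rule tends_app_list[OF tends_slice_list[OF tends_app_list[OF tends_prefixes
            tends_app_list[OF tends_slice_list[OF tends_prefixes] tends_prefixes bG(1)] R(1)[OF bG(2)]]]
            tends_slice_list[OF tends_prefixes]])
        (simp only: slice_bits, rule R(3)[OF bG(2)])
    then have "tends (\<lambda>S. if cs k S \<noteq> [] then ?L S else []) (G' k \<omega>)"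
      by (rule tends_guard[OF _ m(4)])
    moreover have "(if cs k S \<noteq> [] then ?L S else [])
        = next_list M N n k (map a [0..<S]) (map b [0..<S]) (map (bits \<omega>) [0..<S])" for S
      using m(3)[of k S] by (simp add: next_list_def cs_def)
    ultimately show "tends (\<lambda>S. next_list M N n k (map a [0..<S]) (map b [0..<S]) (map (bits \<omega>) [0..<S])) (G' k \<omega>)"
      by simp
  qed
  have rep: "\<delta> (G' k \<omega>) (W' k \<omega>)" for k \<omega>
    unfolding G'_def W'_def by (rule R(4)[OF bG(2)])
  have G'_dep: "G' k \<omega> = G' k \<omega>'" if "\<forall>j\<le>Suc n. slice \<omega> j = slice \<omega>' j" for k \<omega> \<omega>'
    unfolding G'_def using that G_dep[of \<omega> \<omega>'] W_dep[of \<omega> \<omega>'] by simp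
  have W'_measurable: "W' k \<in> borel_measurable coin" for k
    unfolding borel_measurable_coin
    by (rule borel_measurable_continuous_onI[OF continuous_on_realizer[OF adm assoc rep]])
  have bound: "measure coin {\<omega>. (1/2) ^ k < dist (W' k \<omega>) (?X' \<omega>)} \<le> (1/2) ^ k" for k
  proof -
    let ?K = "k + 2"
    let ?e = "(1/2) ^ ?K :: real"
    let ?E = "{\<omega>. (1/2) ^ k < dist (W' k \<omega>) (?X' \<omega>)}"
    have E: "?E \<in> sets coin" by (intro dist_sets W'_measurable X')
    obtain V where V: "V \<in> sets coin" "1 - ?e < measure coin V"
        "\<And>\<omega> y. \<omega> \<in> V \<Longrightarrow> dist (W (m k) \<omega>) y \<le> (1/2) ^ m k \<Longrightarrow> agree ?K (W (m k) \<omega>) y"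
      using precise_sound[OF b m(2)[of k]] by blast
    let ?C = "{\<omega>. (1/2) ^ m k < dist (W (m k) \<omega>) (X \<omega>)}"
    have C: "?C \<in> sets coin" by (intro dist_sets state_name_measurable[OF b] X)
    have "measure coin ?C \<le> (1/2) ^ m k" using b by (auto simp: state_name_def)
    also have "\<dots> \<le> ?e" using m(1)[of k] by (intro power_decreasing) auto
    finally have "measure coin ?C \<le> ?e" .
    moreover have "measure coin (- V) \<le> ?e"
      using coin.prob_compl[OF V(1)] V(2) by (simp add: Compl_eq_Diff_UNIV)
    moreover have "measure coin (- V \<union> ?C) \<le> measure coin (- V) + measure coin ?C"
      using V(1) C by (intro measure_Un_le) (auto simp: Compl_eq_Diff_UNIV simp flip: space_coin)
    ultimately have B: "measure coin (- V \<union> ?C) \<le> 2 * ?e" by linarith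
    have "measure coin ?E \<le> measure coin (- V \<union> ?C) + 2 * ?e"
    proof (rule measure_merge_slice_le[OF E])
      show "- V \<union> ?C \<in> sets coin"
        using V(1) C by (auto simp: Compl_eq_Diff_UNIV simp flip: space_coin)
      fix \<omega> assume "\<omega> \<notin> - V \<union> ?C"
      then have \<omega>: "\<omega> \<in> V" "dist (W (m k) \<omega>) (X \<omega>) \<le> (1/2) ^ m k" by auto
      let ?w = "W (m k) \<omega>" and ?z = "Z (G (m k) \<omega>) (W (m k) \<omega>) ?K"
      have z: "?z \<in> borel_measurable coin" "measure coin {\<omega>'. ?e < dist (?z \<omega>') (f ?w \<omega>')} \<le> ?e"
        using R(2,5)[OF bG(2)] by blast+
      have ag: "measure coin {\<omega>'. ?e \<le> dist (f (X \<omega>) \<omega>') (f ?w \<omega>')} \<le> ?e"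
        using V(3)[OF \<omega>] measure_less_compl[OF f_measurable f_measurable, of ?e "X \<omega>" ?w]
        unfolding agree_def by linarith
      let ?L = "{\<omega>'. ?e < dist (?z \<omega>') (f ?w \<omega>')}" and ?R = "{\<omega>'. ?e \<le> dist (f (X \<omega>) \<omega>') (f ?w \<omega>')}"
      have fiber: "{\<omega>'. merge_slice (Suc n) \<omega> \<omega>' \<in> ?E} = {\<omega>'. (1/2) ^ k < dist (?z \<omega>') (f (X \<omega>) \<omega>')}"
      proof (intro Collect_cong)
        fix \<omega>'
        have same: "\<forall>j\<le>n. slice (merge_slice (Suc n) \<omega> \<omega>') j = slice \<omega> j"
          by (simp add: slice_merge_slice)
        show "merge_slice (Suc n) \<omega> \<omega>' \<in> ?E \<longleftrightarrow> (1/2) ^ k < dist (?z \<omega>') (f (X \<omega>) \<omega>')"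
          using G_dep[OF same] W_dep[OF same] X_dep[OF same] by (simp add: W'_def slice_merge_slice)
      qed
      have "measure coin {\<omega>'. (1/2) ^ k < dist (?z \<omega>') (f (X \<omega>) \<omega>')} \<le> measure coin (?L \<union> ?R)"
      proof (intro coin.finite_measure_mono subsetI)
        fix \<omega>' assume "\<omega>' \<in> {\<omega>'. (1/2) ^ k < dist (?z \<omega>') (f (X \<omega>) \<omega>')}"
        moreover have "(1/2) ^ k = 4 * ?e" by simp
        moreover have "0 < ?e" by simp
        ultimately show "\<omega>' \<in> ?L \<union> ?R"
          using dist_triangle2[of "?z \<omega>'" "f (X \<omega>) \<omega>'" "f ?w \<omega>'"] unfolding Un_iff mem_Collect_eq by linarith
      qed (intro sets.Un dist_sets z(1) f_measurable)
      moreover have "measure coin (?L \<union> ?R) \<le> measure coin ?L + measure coin ?R"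
        by (intro measure_Un_le dist_sets z(1) f_measurable)
      ultimately show "measure coin {\<omega>'. merge_slice (Suc n) \<omega> \<omega>' \<in> ?E} \<le> 2 * ?e"
        unfolding fiber using z(2) ag by linarith
    qed simp
    then have "measure coin ?E \<le> 4 * ?e" using B by linarith
    then show ?thesis by simp
  qed
  have "state_name (Suc n) (step_name M N n a b) ?X' G' W'"
    unfolding state_name_def using assoc rep G'_dep bound by blast
  then show ?thesis by blast
qed

text \<open>On each set of a countable cover by sets on which \<open>F\<close> varies little, \<open>F\<close> is replaced by one of
  its values; by the Borel-Cantelli lemma these jointly measurable functions converge almost
  everywhere in the second variable.\<close>

lemma joint_version_ex: "\<exists>h. joint_version h F"
proof -
  have "\<exists>c. \<forall>y. \<exists>i::nat. agree k (c i) y" for k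
  proof -
    obtain U where U: "U \<subseteq> range (\<lambda>z. {y. agree k z y})" "countable U" "\<Union>U = (\<Union>z. {y. agree k z y})"
      using Lindelof[of "range (\<lambda>z. {y. agree k z y})"] open_agree by blast
    have "(\<Union>z. {y. agree k z y}) = UNIV" using agree_refl by blast
    obtain C where C: "countable C" "U = (\<lambda>z. {y. agree k z y}) ` C"
      using U(1,2) countable_subset_image[of U "\<lambda>z. {y. agree k z y}" UNIV] by blast
    have "\<exists>i. agree k (from_nat_into C i) y" for y
    proof -
      have "y \<in> \<Union>U" using U(3) \<open>(\<Union>z. {y. agree k z y}) = UNIV\<close> by simp
      then obtain z where z: "z \<in> C" "agree k z y" unfolding C(2) by auto
      from from_nat_into_surj[OF C(1) z(1)] z(2) show ?thesis by blast
    qed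
    then show ?thesis by (intro exI[of _ "from_nat_into C"]) simp
  qed
  then obtain c where c: "\<And>k y. \<exists>i::nat. agree k (c k i) y" by metis
  define idx where "idx k y = (LEAST i. agree k (c k i) y)" for k y
  have idx: "agree k (c k (idx k y)) y" for k y
    unfolding idx_def using c by (rule LeastI_ex)
  define h where "h k z = f (c k (idx k (fst z))) (snd z)" for k z
  have [measurable]: "f x \<in> borel_measurable coin" for x by (rule f_measurable)
  have idx_m: "idx k \<in> measurable borel (count_space UNIV)" for k
  proof -
    have "Measurable.pred borel (\<lambda>y. agree k (c k i) y)" for i
      using borel_open[OF open_agree] by (simp add: pred_def)
    then show ?thesis unfolding idx_def by (rule measurable_Least)
  qed
  have h_m [measurable]: "h k \<in> borel_measurable (borel \<Otimes>\<^sub>M coin)" for k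
  proof -
    have "(\<lambda>z. f (c k i) (snd z)) \<in> borel_measurable (borel \<Otimes>\<^sub>M coin)" for i by measurable
    moreover have "(\<lambda>z. idx k (fst z)) \<in> measurable (borel \<Otimes>\<^sub>M coin) (count_space UNIV)"
      using idx_m by (rule measurable_compose[OF measurable_fst])
    ultimately show ?thesis
      unfolding h_def by (rule measurable_compose_countable[where f = "\<lambda>i z. f (c k i) (snd z)"])
  qed
  let ?P = "borel \<Otimes>\<^sub>M coin :: ('a \<times> cantor) measure"
  define A where "A = {z \<in> space ?P. Cauchy (\<lambda>k. h k z)}"
  have A: "A \<in> sets ?P" unfolding A_def by measurable
  define d :: 'a where "d = undefined"
  \<comment> \<open>Constant off \<open>A\<close>, so that the sequence converges everywhere and its
    limit is measurable.\<close>
  define h' where "h' k z = (if z \<in> A then h k z else d)" for k z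
  have h'_m: "h' k \<in> borel_measurable ?P" for k
    unfolding h'_def using A by measurable
  define H where "H z = lim (\<lambda>k. h' k z)" for z
  have lim: "(\<lambda>k. h' k z) \<longlonglongrightarrow> H z" for z
  proof -
    have "convergent (\<lambda>k. h' k z)"
    proof (cases "z \<in> A")
      case True
      then show ?thesis unfolding h'_def by (auto simp: A_def Cauchy_convergent_iff)
    next
      case False
      then show ?thesis unfolding h'_def by (simp add: convergent_const)
    qed
    then show ?thesis unfolding H_def by (simp add: convergent_LIMSEQ_iff)
  qed
  have H_m: "H \<in> borel_measurable ?P"
    by (rule borel_measurable_LIMSEQ_metric[OF h'_m lim])
  have "version (\<lambda>\<omega>. H (y, \<omega>)) (F y)" for y
  proof (rule version_cong[OF f])
    show "(\<lambda>\<omega>. H (y, \<omega>)) \<in> borel_measurable coin"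
      using H_m by (rule measurable_compose[OF measurable_Pair1', rotated]) simp
    define E where "E k = {\<omega>. (1/2) ^ k \<le> dist (f y \<omega>) (f (c k (idx k y)) \<omega>)}" for k
    have E_sets: "E k \<in> sets coin" for k unfolding E_def by (intro dist_sets f_measurable)
    have E_le: "measure coin (E k) \<le> (1/2) ^ k" for k
      using idx[of k y] measure_less_compl[OF f_measurable f_measurable, of "(1/2) ^ k" y "c k (idx k y)"]
      unfolding agree_def E_def by linarith
    have "AE \<omega> in coin. \<forall>\<^sub>F k in sequentially. \<omega> \<in> space coin - E k"
    proof (rule borel_cantelli_AE1)
      show "summable (\<lambda>k. measure coin (E k))"
        by (rule summable_comparison_test'[OF summable_geometric[of "1/2"]]) (use E_le in auto)
    qed (auto simp: E_sets less_top[symmetric])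
    then show "AE \<omega> in coin. f y \<omega> = H (y, \<omega>)"
    proof eventually_elim
      case (elim \<omega>)
      have null: "(\<lambda>k. (1/2 :: real) ^ k) \<longlonglongrightarrow> 0" by (rule LIMSEQ_power_zero) simp
      have "(\<lambda>k. dist (h k (y, \<omega>)) (f y \<omega>)) \<longlonglongrightarrow> 0"
        by (rule tendsto_sandwich[OF _ _ tendsto_const null])
          (use elim in \<open>auto simp: E_def h_def dist_commute elim!: eventually_mono\<close>)
      then have conv: "(\<lambda>k. h k (y, \<omega>)) \<longlonglongrightarrow> f y \<omega>" by (subst tendsto_dist_iff)
      then have "Cauchy (\<lambda>k. h k (y, \<omega>))" by (rule LIMSEQ_imp_Cauchy)
      then have "(\<lambda>k. h' k (y, \<omega>)) = (\<lambda>k. h k (y, \<omega>))"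
        by (simp add: h'_def A_def space_pair_measure)
      then show ?case using conv lim[of "(y, \<omega>)"] LIMSEQ_unique by metis
    qed
  qed
  then have "joint_version (\<lambda>y \<omega>. H (y, \<omega>)) F"
    using H_m by (simp add: joint_version_def)
  then show ?thesis by blast
qed

end

section \<open>Measurability and uniqueness of the process\<close>

lemma process_dep:
  "(\<forall>j\<le>n. slice \<omega> j = slice \<omega>' j) \<Longrightarrow> process f x n \<omega> = process f x n \<omega>'"
  by (induction n) auto

lemma process_measurable:
  assumes "joint_version f F" "version x X"
  shows "process f x n \<in> borel_measurable coin"
proof (induction n)
  case 0
  have "x \<in> borel_measurable coin" using assms(2) by (simp add: version_def)
  then show ?case by (simp add: measurable_compose[OF measurable_slice])
next
  case (Suc n)
  have f: "(\<lambda>(x, \<omega>). f x \<omega>) \<in> borel_measurable (borel \<Otimes>\<^sub>M coin)" using assms(1) by (simp add: joint_version_def)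
  have "(\<lambda>\<omega>. (process f x n \<omega>, slice \<omega> (Suc n))) \<in> measurable coin (borel \<Otimes>\<^sub>M coin)"
    by (intro measurable_Pair Suc measurable_slice)
  from measurable_compose[OF this f] show ?case by simp
qed

text \<open>For a fixed past both processes are in the same state, at which the two versions of
  \<open>F\<close> agree for almost every value of the fresh factor; Fubini's theorem combines this
  with the induction hypothesis.\<close>

lemma process_AE_unique:
  fixes F :: "'a::{metric_space, second_countable_topology} \<Rightarrow> 'a rv"
  assumes f: "joint_version f F" "version x X" and g: "joint_version g F" "version y X"
  shows "AE \<omega> in coin. process f x n \<omega> = process g y n \<omega>"
proof (induction n)
  case 0
  have m: "Measurable.pred coin (\<lambda>\<omega>. process f x 0 \<omega> = process g y 0 \<omega>)"
    unfolding pred_def by (intro measurable_equality_set process_measurable[OF f] process_measurable[OF g])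
  show ?case
    by (rule AE_merge_slice[OF m, of 0]) (use version_AE[OF f(2) g(2)] in \<open>simp add: slice_merge_slice\<close>)
next
  case (Suc n)
  have m: "Measurable.pred coin (\<lambda>\<omega>. process f x (Suc n) \<omega> = process g y (Suc n) \<omega>)"
    unfolding pred_def by (intro measurable_equality_set process_measurable[OF f] process_measurable[OF g])
  show ?case
  proof (rule AE_merge_slice[OF m, of "Suc n"])
    show "AE \<omega> in coin. AE \<omega>' in coin. process f x (Suc n) (merge_slice (Suc n) \<omega> \<omega>')
        = process g y (Suc n) (merge_slice (Suc n) \<omega> \<omega>')"
      using Suc
    proof eventually_elim
      case (elim \<omega>)
      have same: "process h z n (merge_slice (Suc n) \<omega> \<omega>') = process h z n \<omega>" for h :: "'a \<Rightarrow> cantor \<Rightarrow> 'a" and z \<omega>'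
        by (rule process_dep) (simp add: slice_merge_slice)
      have "AE \<omega>' in coin. f (process f x n \<omega>) \<omega>' = g (process f x n \<omega>) \<omega>'"
        using f(1) g(1) by (intro version_AE) (auto simp: joint_version_def)
      then show ?case by (simp add: same slice_merge_slice elim)
    qed
  qed
qed

lemma markov_process_unique:
  fixes F :: "'a::{metric_space, second_countable_topology} \<Rightarrow> 'a rv"
  assumes "markov_process F X Y" "markov_process F X Y'"
  shows "Y = Y'"
proof -
  obtain f x where f: "joint_version f F" "version x X" "version (\<lambda>\<omega> n. process f x n \<omega>) Y"
    using assms(1) unfolding markov_process_def by blast
  obtain g y where g: "joint_version g F" "version y X" "version (\<lambda>\<omega> n. process g y n \<omega>) Y'"
    using assms(2) unfolding markov_process_def by blast
  have "AE \<omega> in coin. \<forall>n. process f x n \<omega> = process g y n \<omega>"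
    unfolding AE_all_countable using process_AE_unique[OF f(1,2) g(1,2)] by blast
  then have "version (\<lambda>\<omega> n. process g y n \<omega>) Y"
    using g(3) by (intro version_cong[OF f(3)]) (auto simp: version_def)
  then show ?thesis using g(3) by (simp add: version_def)
qed

lemma markov_process_intro:
  fixes F :: "'a::{metric_space, second_countable_topology} \<Rightarrow> 'a rv"
  assumes "joint_version f F" "version x X"
  shows "markov_process F X (abs_rv (\<lambda>\<omega> n. process f x n \<omega>))"
proof -
  have "(\<lambda>\<omega> n. process f x n \<omega>) \<in> borel_measurable coin"
    by (rule measurable_coordinatewise_then_product) (use process_measurable[OF assms] in simp)
  then show ?thesis unfolding markov_process_def using assms version_abs_rv by blast
qed


section \<open>Random sequences\<close>

lemma summable_seq_dist: "summable (\<lambda>n. (1/2) ^ n * min 1 (dist (x n) (y n)))"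
  by (rule summable_comparison_test'[OF summable_geometric[of "1/2"]]) (auto simp: abs_mult)

lemma seq_dist_commute: "seq_dist x y = seq_dist y x"
  by (simp add: seq_dist_def dist_commute)

lemma seq_dist_triangle: "seq_dist x z \<le> seq_dist x y + seq_dist y z"
proof -
  have "seq_dist x z \<le> (\<Sum>n. (1/2) ^ n * min 1 (dist (x n) (y n)) + (1/2) ^ n * min 1 (dist (y n) (z n)))"
    unfolding seq_dist_def
  proof (rule suminf_le)
    fix n
    have "min 1 (dist (x n) (z n)) \<le> min 1 (dist (x n) (y n)) + min 1 (dist (y n) (z n))"
      using dist_triangle[of "x n" "z n" "y n"] zero_le_dist[of "x n" "y n"] zero_le_dist[of "y n" "z n"]
      unfolding min_def by (auto simp del: zero_le_dist)
    then show "(1/2) ^ n * min 1 (dist (x n) (z n))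
        \<le> (1/2) ^ n * min 1 (dist (x n) (y n)) + (1/2) ^ n * min 1 (dist (y n) (z n))"
      unfolding distrib_left[symmetric] by (intro mult_left_mono) auto
  qed (intro summable_add summable_seq_dist)+
  also have "\<dots> = seq_dist x y + seq_dist y z"
    unfolding seq_dist_def by (rule suminf_add[symmetric]) (rule summable_seq_dist)+
  finally show ?thesis .
qed

lemma seq_dist_le:
  assumes "\<And>n. dist (x n) (y n) \<le> (1/2) ^ (m + n + 4)"
  shows "seq_dist x y \<le> (1/2) ^ (m + 3)"
proof -
  have "seq_dist x y \<le> (\<Sum>n. (1/2) ^ n * (1/2) ^ (m + 4))"
    unfolding seq_dist_def
  proof (rule suminf_le)
    fix n
    have "(1/2 :: real) ^ (m + n + 4) \<le> (1/2) ^ (m + 4)" by (intro power_decreasing) auto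
    with assms[of n] have "min 1 (dist (x n) (y n)) \<le> (1/2) ^ (m + 4)" by linarith
    then show "(1/2) ^ n * min 1 (dist (x n) (y n)) \<le> (1/2) ^ n * (1/2) ^ (m + 4)"
      by (intro mult_left_mono) auto
  qed (intro summable_seq_dist summable_mult2 summable_geometric; simp)+
  also have "\<dots> = (1/2) ^ (m + 3)"
    by (subst suminf_mult2[symmetric]) (simp_all add: suminf_geometric power_add eval_nat_numeral)
  finally show ?thesis .
qed

lemma seq_dist_sets:
  fixes x y :: "cantor \<Rightarrow> nat \<Rightarrow> 'a::{metric_space, second_countable_topology}"
  assumes "\<And>n. (\<lambda>\<omega>. x \<omega> n) \<in> borel_measurable coin" "\<And>n. (\<lambda>\<omega>. y \<omega> n) \<in> borel_measurable coin"
  shows "{\<omega>. e < seq_dist (x \<omega>) (y \<omega>)} \<in> sets coin" "{\<omega>. e \<le> seq_dist (x \<omega>) (y \<omega>)} \<in> sets coin"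
proof -
  note [measurable] = assms
  have [measurable]: "(\<lambda>\<omega>. seq_dist (x \<omega>) (y \<omega>)) \<in> borel_measurable coin"
    unfolding seq_dist_def by measurable
  have "{\<omega>\<in>space coin. e < seq_dist (x \<omega>) (y \<omega>)} \<in> sets coin" "{\<omega>\<in>space coin. e \<le> seq_dist (x \<omega>) (y \<omega>)} \<in> sets coin"
    by measurable
  then show "{\<omega>. e < seq_dist (x \<omega>) (y \<omega>)} \<in> sets coin" "{\<omega>. e \<le> seq_dist (x \<omega>) (y \<omega>)} \<in> sets coin"
    by simp_all
qed

text \<open>One factor of 2 is given up because the Fan distance asks for a strict bound on a closed
  condition.\<close>

lemma fan_seq_dist_le:
  fixes x y :: "cantor \<Rightarrow> nat \<Rightarrow> 'a::{metric_space, second_countable_topology}"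
  assumes "\<And>n. (\<lambda>\<omega>. x \<omega> n) \<in> borel_measurable coin" "\<And>n. (\<lambda>\<omega>. y \<omega> n) \<in> borel_measurable coin"
    and "measure coin {\<omega>. (1/2) ^ Suc k < seq_dist (x \<omega>) (y \<omega>)} \<le> (1/2) ^ Suc k"
  shows "fan_dist seq_dist x y \<le> (1/2) ^ k"
proof (rule fan_dist_le)
  have pos: "(1/2 :: real) ^ Suc k < (1/2) ^ k" by simp
  have "measure coin {\<omega>. (1/2) ^ k \<le> seq_dist (x \<omega>) (y \<omega>)} \<le> measure coin {\<omega>. (1/2) ^ Suc k < seq_dist (x \<omega>) (y \<omega>)}"
  proof (rule coin.finite_measure_mono)
    show "{\<omega>. (1/2) ^ k \<le> seq_dist (x \<omega>) (y \<omega>)} \<subseteq> {\<omega>. (1/2) ^ Suc k < seq_dist (x \<omega>) (y \<omega>)}"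
      using pos by (blast intro: less_le_trans)
  qed (rule seq_dist_sets[OF assms(1,2)])
  with assms(3) pos show "measure coin {\<omega>. (1/2) ^ k \<le> seq_dist (x \<omega>) (y \<omega>)} < (1/2) ^ k" by linarith
  show "(1/2 :: real) ^ k \<in> \<rat>" by (intro Rats_power) (simp add: Rats_divide)
qed simp

text \<open>Coordinate \<open>n\<close> of approximation \<open>m\<close> errs by more than
  2^-(m+n+4) with at most that probability; both the events and the weighted distances sum to at
  most 2^-(m+3). Two approximations of index at least \<open>k\<close> then differ by at most
  2^-(k+2) up to that probability, which leaves room for the strict rate 2^-k that a name
  requires.\<close>

lemma (in computable_kernel) output_name_correct:
  assumes b: "rv_rep \<delta> dist b Xinit" and x: "version x Xinit" and f_joint: "joint_version f F"
  shows "rv_rep (seq_rep \<delta>) seq_dist (output_name M N a b) (abs_rv (\<lambda>\<omega> n. process f x n \<omega>))"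
proof -
  have p_m: "process f x n \<in> borel_measurable coin" for n by (rule process_measurable[OF f_joint x])
  have "\<exists>G W. state_name n (level_name M N a b n) (process f x n) G W" for n
  proof (induction n)
    case 0
    have "process f x 0 = (\<lambda>\<omega>. x (slice \<omega> 0))" by (rule ext) simp
    then show ?case using init_state_name[OF b x] by (simp add: level_name_def)
  next
    case (Suc n)
    then obtain G W where "state_name n (level_name M N a b n) (process f x n) G W" by blast
    moreover have eq: "process f x (Suc n) = (\<lambda>\<omega>. f (process f x n \<omega>) (slice \<omega> (Suc n)))" by (rule ext) simp
    ultimately have "\<exists>G W. state_name (Suc n) (step_name M N n a (level_name M N a b n)) (process f x (Suc n)) G W"
      unfolding eq using p_m[of "Suc n"] by (intro step_state_name p_m process_dep) (simp_all add: eq)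
    moreover have "level_name M N a b (Suc n) = step_name M N n a (level_name M N a b n)"
      by (simp add: level_name_def)
    ultimately show ?case by (simp only:)
  qed
  then obtain G W where st: "\<And>n. state_name n (level_name M N a b n) (process f x n) (G n) (W n)" by metis
  have GW: "associate (slice (level_name M N a b n) m) (bits \<omega>) (G n m \<omega>)" "\<delta> (G n m \<omega>) (W n m \<omega>)" for n m \<omega>
    using st[of n] by (auto simp: state_name_def)
  have W_m: "W n m \<in> borel_measurable coin" for n m by (rule state_name_measurable[OF st])
  define Y where "Y m \<omega> n = W n (m + n + 4) \<omega>" for m \<omega> n
  define X where "X \<omega> n = process f x n \<omega>" for \<omega> n
  have Y_m: "(\<lambda>\<omega>. Y m \<omega> n) \<in> borel_measurable coin" for m n using W_m by (simp add: Y_def)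
  have X_m: "(\<lambda>\<omega>. X \<omega> n) \<in> borel_measurable coin" for n using p_m by (simp add: X_def)
  have close: "measure coin {\<omega>. (1/2) ^ (m + 3) < seq_dist (Y m \<omega>) (X \<omega>)} \<le> (1/2) ^ (m + 3)" for m
  proof -
    let ?B = "\<lambda>n. {\<omega>. (1/2) ^ (m + n + 4) < dist (Y m \<omega> n) (X \<omega> n)}"
    have B: "?B n \<in> sets coin" for n by (intro dist_sets Y_m X_m)
    have B_le: "measure coin (?B n) \<le> (1/2) ^ (m + n + 4)" for n
      using st[of n] by (auto simp: state_name_def Y_def X_def)
    have geo: "summable (\<lambda>n. (1/2 :: real) ^ (m + n + 4))" "(\<Sum>n. (1/2 :: real) ^ (m + n + 4)) = (1/2) ^ (m + 3)"
    proof -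
      have eq: "(\<lambda>n. (1/2 :: real) ^ (m + n + 4)) = (\<lambda>n. (1/2) ^ n * (1/2) ^ (m + 4))"
        by (auto simp: power_add)
      show "summable (\<lambda>n. (1/2 :: real) ^ (m + n + 4))"
        unfolding eq by (intro summable_mult2 summable_geometric) simp
      show "(\<Sum>n. (1/2 :: real) ^ (m + n + 4)) = (1/2) ^ (m + 3)"
        unfolding eq by (subst suminf_mult2[symmetric]) (simp_all add: suminf_geometric power_add eval_nat_numeral)
    qed
    have sum: "summable (\<lambda>n. measure coin (?B n))"
      by (rule summable_comparison_test'[OF geo(1)]) (use B_le in auto)
    have "{\<omega>. (1/2) ^ (m + 3) < seq_dist (Y m \<omega>) (X \<omega>)} \<subseteq> (\<Union>n. ?B n)"
    proof
      fix \<omega> assume "\<omega> \<in> {\<omega>. (1/2) ^ (m + 3) < seq_dist (Y m \<omega>) (X \<omega>)}"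
      then have "\<not> (\<forall>n. dist (Y m \<omega> n) (X \<omega> n) \<le> (1/2) ^ (m + n + 4))"
        using seq_dist_le[of "Y m \<omega>" "X \<omega>" m] by auto
      then show "\<omega> \<in> (\<Union>n. ?B n)" by (auto simp: not_le)
    qed
    then have "measure coin {\<omega>. (1/2) ^ (m + 3) < seq_dist (Y m \<omega>) (X \<omega>)} \<le> measure coin (\<Union>n. ?B n)"
      using B by (intro coin.finite_measure_mono) auto
    also have "\<dots> \<le> (\<Sum>n. measure coin (?B n))"
      using B sum by (intro coin.finite_measure_subadditive_countably) auto
    also have "\<dots> \<le> (\<Sum>n. (1/2) ^ (m + n + 4))" by (intro suminf_le B_le sum geo)
    finally show ?thesis by (simp only: geo(2))
  qed
  have close2: "measure coin {\<omega>. (1/2) ^ (k + 2) < seq_dist (Y m \<omega>) (Y n \<omega>)} \<le> (1/2) ^ (k + 2)"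
    if "k \<le> m" "k \<le> n" for k m n
  proof -
    have small: "(1/2 :: real) ^ (m + 3) \<le> (1/2) ^ (k + 3)" "(1/2 :: real) ^ (n + 3) \<le> (1/2) ^ (k + 3)"
      using that by (intro power_decreasing; simp)+
    have half: "(1/2 :: real) ^ (k + 3) + (1/2) ^ (k + 3) = (1/2) ^ (k + 2)" by (simp add: eval_nat_numeral)
    let ?L = "\<lambda>m. {\<omega>. (1/2) ^ (m + 3) < seq_dist (Y m \<omega>) (X \<omega>)}"
    have L: "?L m \<in> sets coin" for m by (rule seq_dist_sets[OF Y_m X_m])
    have "measure coin {\<omega>. (1/2) ^ (k + 2) < seq_dist (Y m \<omega>) (Y n \<omega>)} \<le> measure coin (?L m \<union> ?L n)"
    proof (intro coin.finite_measure_mono subsetI sets.Un L)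
      fix \<omega> assume "\<omega> \<in> {\<omega>. (1/2) ^ (k + 2) < seq_dist (Y m \<omega>) (Y n \<omega>)}"
      then show "\<omega> \<in> ?L m \<union> ?L n"
        using seq_dist_triangle[of "Y m \<omega>" "Y n \<omega>" "X \<omega>"] seq_dist_commute[of "X \<omega>" "Y n \<omega>"] small half
        unfolding Un_iff mem_Collect_eq by linarith
    qed
    moreover have "measure coin (?L m \<union> ?L n) \<le> measure coin (?L m) + measure coin (?L n)"
      by (intro measure_Un_le L)
    ultimately show ?thesis using close[of m] close[of n] small half by linarith
  qed
  show ?thesis unfolding rv_rep_def
  proof (intro exI[of _ Y] exI[of _ X] conjI allI)
    fix m
    have "continuous_on UNIV (\<lambda>\<omega>. Y m \<omega> n)" for n
      unfolding Y_def by (rule continuous_on_realizer[OF adm GW])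
    then show "continuous_on UNIV (Y m)" by (rule continuous_on_coordinatewise_then_product)
    \<comment> \<open>Interleaves the names of the coordinates, inverting
      \<open>slice\<close>.\<close>
    define H where "H \<omega> c = G (fst (prod_decode c)) (m + fst (prod_decode c) + 4) \<omega> (snd (prod_decode c))" for \<omega> c
    have H: "slice (H \<omega>) n = G n (m + n + 4) \<omega>" for \<omega> n
      by (rule ext) (simp add: slice_def H_def)
    have "associate (slice (output_name M N a b) m) (bits \<omega>) (H \<omega>)" for \<omega>
      by (rule associate_output_name) (use GW(1) in \<open>simp add: H\<close>)
    moreover have "seq_rep \<delta> (H \<omega>) (Y m \<omega>)" for \<omega>
      using GW(2) by (simp add: seq_rep_def H Y_def)
    ultimately show "exp_rep cantor_rep (seq_rep \<delta>) (slice (output_name M N a b) m) (Y m)"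
      unfolding exp_rep_cantor by blast
  next
    fix m n
    have "fan_dist seq_dist (Y m) (Y n) \<le> (1/2) ^ Suc (min m n)"
      by (rule fan_seq_dist_le[OF Y_m Y_m]) (use close2[of "min m n" m n] in simp)
    also have "\<dots> < (1/2) ^ min m n" by simp
    finally show "fan_dist seq_dist (Y m) (Y n) < (1/2) ^ min m n" .
  next
    have "X \<in> borel_measurable coin"
      by (rule measurable_coordinatewise_then_product[OF X_m])
    then show "version X (abs_rv (\<lambda>\<omega> n. process f x n \<omega>))" unfolding X_def by (rule version_abs_rv)
  next
    have le: "fan_dist seq_dist (Y m) X \<le> (1/2) ^ (m + 2)" for m
      by (rule fan_seq_dist_le[OF Y_m X_m]) (use close[of m] in \<open>simp add: eval_nat_numeral\<close>)
    have "(\<lambda>m. (1/2 :: real) ^ (m + 2)) \<longlonglongrightarrow> 0"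
      by (intro LIMSEQ_ignore_initial_segment LIMSEQ_power_zero) simp
    then show "(\<lambda>m. fan_dist seq_dist (Y m) X) \<longlonglongrightarrow> 0"
      by (rule tendsto_sandwich[OF always_eventually always_eventually tendsto_const, rotated 2])
        (use le in \<open>simp_all add: fan_dist_nonneg\<close>)
  qed
qed

section \<open>Existence, uniqueness and computability of the process\<close>

lemma computable_metric_machines:
  assumes "computable_metric_space \<delta>"
  shows "\<exists>M N. computable_metric \<delta> M N"
proof -
  have adm: "admissible_quotient_rep \<delta>"
    using assms by (simp add: computable_metric_space_def)
  obtain M where M: "type2_machine M"
    "\<And>p z. prod_rep \<delta> \<delta> p z \<Longrightarrow> \<exists>q. transforms M p q \<and> real_rep q (case z of (x, y) \<Rightarrow> dist x y)"
    using assms unfolding computable_metric_space_def computable_def by blast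
  obtain N where N: "type2_machine N"
    "\<And>p z. prod_rep \<delta> (closed_rep \<delta>) p z \<Longrightarrow>
      \<exists>q. transforms N p q \<and> lower_rep q (case z of (x, A) \<Rightarrow> INF y\<in>A. ennreal (dist x y))"
    using assms unfolding computable_metric_space_def computable_def by blast
  have "computable_metric \<delta> M N"
  proof (unfold_locales)
    show "\<exists>r. transforms M (pair_name p q) r \<and> real_rep r (dist x y)" if "\<delta> p x" "\<delta> q y" for p q x y
      using M(2)[of "pair_name p q" "(x, y)"] that by (simp add: prod_rep_pair_name)
    show "\<exists>r. transforms N (pair_name p q) r \<and> lower_rep r (INF y\<in>A. ennreal (dist x y))"
      if "\<delta> p x" "closed_rep \<delta> q A" for p q x A
      using N(2)[of "pair_name p q" "(x, A)"] that by (simp add: prod_rep_pair_name)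
  qed (fact adm M(1) N(1))+
  then show ?thesis by blast
qed

text \<open>The first conjunct gives sense to the definite description in the second: the process
  exists and is unique for every \<open>F\<close> that has a name.\<close>

theorem theorem55:
  fixes \<delta> :: "'a::polish_space rep"
  assumes "computable_metric_space \<delta>"
  shows "(\<forall>F Xinit. (\<exists>p. exp_rep \<delta> (rv_rep \<delta> dist) p F) \<longrightarrow> (\<exists>!Y. markov_process F Xinit Y)) \<and>
    computable (prod_rep (exp_rep \<delta> (rv_rep \<delta> dist)) (rv_rep \<delta> dist)) (rv_rep (seq_rep \<delta>) seq_dist)
      (\<lambda>(F, Xinit). THE Y. markov_process F Xinit Y)"
proof -
  obtain M N where "computable_metric \<delta> M N"
    using computable_metric_machines[OF assms] by blast
  then interpret computable_metric \<delta> M N .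
  have joint: "\<exists>h. joint_version h F" if a: "exp_rep \<delta> (rv_rep \<delta> dist) a F" for a F
  proof -
    \<comment> \<open>Any pointwise choice of versions serves to construct a joint one; for the
      computation the kernel is interpreted anew, with the joint version as
      \<open>f\<close>.\<close>
    have "\<forall>x. \<exists>g. version g (F x)" using version_ex by blast
    then obtain f where "\<And>x. version (f x) (F x)" by metis
    then interpret computable_kernel \<delta> M N a F f by unfold_locales (use a in auto)
    show ?thesis by (rule joint_version_ex)
  qed
  obtain K where K: "type2_machine K"
    "\<And>p. transforms K p (output_name M N (\<lambda>n. p (2 * n)) (\<lambda>n. p (2 * n + 1)))"
    using output_machine[of M N] by blast
  show ?thesis
  proof (intro conjI allI impI)
    fix F :: "'a \<Rightarrow> 'a rv" and Xinit :: "'a rv" assume "\<exists>p. exp_rep \<delta> (rv_rep \<delta> dist) p F"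
    then obtain f where f: "joint_version f F" using joint by blast
    obtain x where x: "version x Xinit" using version_ex by blast
    show "\<exists>!Y. markov_process F Xinit Y"
      using markov_process_intro[OF f x] markov_process_unique by blast
  next
    show "computable (prod_rep (exp_rep \<delta> (rv_rep \<delta> dist)) (rv_rep \<delta> dist)) (rv_rep (seq_rep \<delta>) seq_dist)
        (\<lambda>(F, Xinit). THE Y. markov_process F Xinit Y)"
      unfolding computable_def
    proof (intro exI[of _ K] conjI allI impI K(1))
      fix p and z :: "('a \<Rightarrow> 'a rv) \<times> 'a rv"
      assume z: "prod_rep (exp_rep \<delta> (rv_rep \<delta> dist)) (rv_rep \<delta> dist) p z"
      obtain F Xinit where zeq: "z = (F, Xinit)" by (cases z)
      let ?a = "\<lambda>n. p (2 * n)" and ?b = "\<lambda>n. p (2 * n + 1)"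
      have a: "exp_rep \<delta> (rv_rep \<delta> dist) ?a F" and b: "rv_rep \<delta> dist ?b Xinit"
        using z by (simp_all add: prod_rep_def zeq)
      obtain f where joint_f: "joint_version f F" using joint[OF a] by blast
      obtain x where x: "version x Xinit" using version_ex by blast
      interpret computable_kernel \<delta> M N ?a F f
        by unfold_locales (use a joint_f in \<open>auto simp: joint_version_def\<close>)
      have "(THE Y. markov_process F Xinit Y) = abs_rv (\<lambda>\<omega> n. process f x n \<omega>)"
        using markov_process_intro[OF joint_f x] markov_process_unique by blast
      then show "\<exists>q. transforms K p q \<and> rv_rep (seq_rep \<delta>) seq_dist q
          (case z of (F, Xinit) \<Rightarrow> THE Y. markov_process F Xinit Y)"
        using K(2)[of p] output_name_correct[OF b x joint_f] by (auto simp: zeq)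
    qed
  qed
qed

end
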